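(* Let $\mathcal A_N$ be the vertex (super)algebra over $\mathbb C[N]$ of the context, obtained from the $\beta\gamma$–$bc$ system $\{Z_1,Z_2,b,c\}$ in the graded Deligne category $\mathrm{Rep}^{\mathbb Z}(\mathrm{GL}_{[N]})$. Let $$Q=\oint dz\,\Big(\mathrm{Tr}(:b(z)c(z)c(z):)+\mathrm{Tr}(:c(z)[Z_1(z),Z_2(z)]:)\Big):\mathcal A_N\to\mathcal A_N .$$ Then $Q^2=0$.
   Context: Deligne category: $\mathrm{Rep}_0(\mathrm{GL}_{[N]})$ is the $\mathbb C[N]$-linear category whose objects are finite words in $\bullet,\circ$ (empty word $=\mathbf 1$), with $\mathrm{Hom}(w,w')$ free over $\mathbb C[N]$ on $(w,w')$-diagrams: perfect matchings of the letters of $w$ (one row) and $w'$ (another row) such that an edge joins a $\bullet$ with a $\circ$ if and only if its endpoints are in the same row (so edges between rows join equal letters). Composition is stacking, each closed loop removed giving a factor $N$; tensor product is concatenation/juxtaposition; the braiding is the obvious permutation diagram. $\mathrm{Rep}_{\mathrm f}(\mathrm{GL}_{[N]})$ is the Karoubi envelope of the additive envelope, $\mathrm{Rep}(\mathrm{GL}_{[N]})$ its ind-completion, and $\mathrm{Rep}^{\mathbb Z}(\mathrm{GL}_{[N]})$ the category of $\mathbb Z$-graded objects with the Koszul-sign braiding. Put $[1,1]=\bullet\circ$. Generators: $c,Z_1,Z_2,b$ are four copies of $[1,1]$, in degrees $1,0,0,-1$, and $X=c\oplus Z_1\oplus Z_2\oplus b$. Let $D:[1,1]\otimes[1,1]=\bullet\circ\bullet\circ\to\mathbf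 1$ be the diagram joining letters $1$–$4$ and $2$–$3$. The form $\Omega:X\otimes X\to\mathbf 1$ is $D$ on $b\otimes c$ and on $c\otimes b$, $-D$ on $Z_1\otimes Z_2$, $+D$ on $Z_2\otimes Z_1$, and $0$ on all other pairs of summands; it is graded antisymmetric ($\Omega\circ\sigma=-\Omega$). $\beta\gamma$ vertex algebra: let $X_n$ ($n\in\mathbb Z$) be copies of $X$, $L_-X=\bigoplus_{n<0}X_n$, $V=S(L_-X)$ (graded symmetric algebra), $|0\rangle$ the unit, and $T$ the derivation with $T=(n+1)\mathrm{id}:X_{-n-1}\to X_{-n-2}$. The generating field is $X(z)=\sum_nz^{-n-1}X_{(n)}$, where $X_{(n)}:X\otimes V\to V$ is multiplication by the copy $X_n$ if $n<0$ and, if $n\ge0$, is the derivation contracting $X$ via $\Omega$ with the factors $X_{-n-1}$. Thus $X(z)\circ(\mathrm{id}\otimes X(w))=\frac{1}{z-w}\Omega+{:}X(z)X(w){:}$. The vertex operators of general elements are the normally ordered products $\frac1{n_1!\cdots n_k!}:\partial^{n_1}X(z)\cdots\partial^{n_k}X(z):$ for $X_{-n_1-1}\cdots X_{-n_k-1}$. Write $c(z),Z_1(z),Z_2(z),b(z)$ for the restrictions of $X(z)$ to the summands of $X$. $\mathcal A_N=\bigoplus_k\mathrm{Hom}_{\mathrm{Rep}(\mathrm{GL}_{[N]})}(\mathbf 1,V^{(k)})$, where $V^{(k)}$ is the degree-$k$ part of $V$ (graded $\mathrm{Hom}(\mathbf 1,V)$); it is a $\mathbb Z$-graded vertex superalgebra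 over $\mathbb C[N]$ with products $\alpha\cdot_n\beta=\cdot_n\circ(\alpha\otimes\beta)$ and Koszul signs. For summands $\phi_1,\dots,\phi_k$ of $X$, $\mathrm{Tr}:\mathbf 1\to\phi_1\otimes\cdots\otimes\phi_k\cong(\bullet\circ)^k$ is the diagram joining the $\circ$ of the $j$-th factor to the $\bullet$ of the $(j+1)$-st (cyclically), and $\mathrm{Tr}(:\phi_1(z)\cdots\phi_k(z):)$ is the field of $\mathcal A_N$ obtained by composing $:\phi_1(z)\cdots\phi_k(z):$ with $\mathrm{Tr}$. $[Z_1,Z_2]$ abbreviates $Z_1Z_2-Z_2Z_1$ inside the trace, and $\oint dz$ means taking the coefficient of $z^{-1}$. *)

theory Defs
  imports
    Complex_Main
    "HOL-Computational_Algebra.Polynomial"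
    "HOL-Combinatorics.Permutations"
    "HOL-Library.Poly_Mapping"
begin

section \<open>The diagram category\<close>

datatype letter = Bullet | Circ

type_synonym word = "letter list"

text \<open>
  A diagram from \<open>w\<close> to \<open>w'\<close> is given by its set of edges; the point \<open>Inl i\<close> is the \<open>i\<close>-th letter
  of the source \<open>w\<close> and \<open>Inr j\<close> the \<open>j\<close>-th letter of the target \<open>w'\<close>, both counted from 0.
\<close>

type_synonym diagram = "(nat + nat) set set"

definition points :: "word \<Rightarrow> word \<Rightarrow> (nat + nat) set" where
  "points w w' = Inl ` {..<length w} \<union> Inr ` {..<length w'}"

definition letter_at :: "word \<Rightarrow> word \<Rightarrow> nat + nat \<Rightarrow> letter" where
  "letter_at w w' p = (case p of Inl i \<Rightarrow> w ! i | Inr j \<Rightarrow> w' ! j)"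

definition diagrams :: "word \<Rightarrow> word \<Rightarrow> diagram set" where
  "diagrams w w' = {d.
     (\<forall>e\<in>d. e \<subseteq> points w w' \<and> card e = 2) \<and>
     (\<forall>p\<in>points w w'. \<exists>!e. e \<in> d \<and> p \<in> e) \<and>
     (\<forall>p q. p \<noteq> q \<longrightarrow> {p, q} \<in> d \<longrightarrow>
        (letter_at w w' p \<noteq> letter_at w w' q \<longleftrightarrow> isl p = isl q))}"

text \<open>
  Stacking \<open>d : w \<rightarrow> w'\<close> and \<open>e : w' \<rightarrow> w''\<close>: the points of the stacked graph are pairs (row, position),
  where the rows 0, 1, 2 carry \<open>w\<close>, \<open>w'\<close>, \<open>w''\<close>.
\<close>

definition stack_rel :: "diagram \<Rightarrow> diagram \<Rightarrow> ((nat \<times> nat) \<times> (nat \<times> nat)) set" where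
  "stack_rel d e =
     {(case_sum (Pair 0) (Pair 1) p, case_sum (Pair 0) (Pair 1) q) | p q. {p, q} \<in> d} \<union>
     {(case_sum (Pair 1) (Pair 2) p, case_sum (Pair 1) (Pair 2) q) | p q. {p, q} \<in> e}"

definition stack :: "diagram \<Rightarrow> diagram \<Rightarrow> diagram" where
  "stack d e = {{p, q} | p q. p \<noteq> q \<and>
     (case_sum (Pair 0) (Pair 2) p, case_sum (Pair 0) (Pair 2) q) \<in> (stack_rel d e)\<^sup>+}"

text \<open>
  The relation \<open>stack_rel d e\<close> is symmetric, so the classes of its transitive closure on its field are
  the connected components; the closed loops are the components contained in the middle row.
\<close>

definition loops :: "diagram \<Rightarrow> diagram \<Rightarrow> nat" where
  "loops d e = card {C \<in> Field (stack_rel d e) // (stack_rel d e)\<^sup>+. fst ` C \<subseteq> {1}}"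

text \<open>
  The ring \<open>\<complex>[N]\<close> is \<^typ>\<open>complex poly\<close>, with \<open>N\<close> the indeterminate.
\<close>

definition N_poly :: "complex poly" where
  "N_poly = [:0, 1:]"

type_synonym mor = "diagram \<Rightarrow>\<^sub>0 complex poly"

definition Hom0 :: "word \<Rightarrow> word \<Rightarrow> mor set" where
  "Hom0 w w' = {f. Poly_Mapping.keys f \<subseteq> diagrams w w'}"

definition mor_of :: "diagram \<Rightarrow> mor" where
  "mor_of d = Poly_Mapping.single d 1"

definition scale_mor :: "complex poly \<Rightarrow> mor \<Rightarrow> mor" where
  "scale_mor r f = Poly_Mapping.map ((*) r) f"

definition mor_comp :: "mor \<Rightarrow> mor \<Rightarrow> mor" (infixl "\<circ>\<^sub>m" 70) where
  "g \<circ>\<^sub>m f = (\<Sum>d\<in>Poly_Mapping.keys f. \<Sum>e\<in>Poly_Mapping.keys g.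
     Poly_Mapping.single (stack d e)
       (Poly_Mapping.lookup f d * Poly_Mapping.lookup g e * N_poly ^ loops d e))"

definition mor_id :: "word \<Rightarrow> mor" where
  "mor_id w = mor_of {{Inl i, Inr i} | i. i < length w}"

text \<open>
  The tensor product of \<open>f : w \<rightarrow> w'\<close> with another morphism; the words \<open>w\<close> and \<open>w'\<close> are needed to know
  how far the second factor is shifted.
\<close>

definition diagram_tensor :: "word \<Rightarrow> word \<Rightarrow> diagram \<Rightarrow> diagram \<Rightarrow> diagram" where
  "diagram_tensor w w' d e = d \<union> (`) (map_sum ((+) (length w)) ((+) (length w'))) ` e"

definition mor_tensor :: "word \<Rightarrow> word \<Rightarrow> mor \<Rightarrow> mor \<Rightarrow> mor" where
  "mor_tensor w w' f g = (\<Sum>d\<in>Poly_Mapping.keys f. \<Sum>e\<in>Poly_Mapping.keys g.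
     Poly_Mapping.single (diagram_tensor w w' d e)
       (Poly_Mapping.lookup f d * Poly_Mapping.lookup g e))"

definition mor_braid :: "word \<Rightarrow> word \<Rightarrow> mor" where
  "mor_braid w w' = mor_of
     ({{Inl i, Inr (length w' + i)} | i. i < length w} \<union>
      {{Inl (length w + j), Inr j} | j. j < length w'})"


section \<open>Graded objects\<close>

text \<open>
  The objects needed lie in the Karoubi envelope of the category of formal, possibly infinite, direct
  sums of graded words. Words are compact in the ind-completion, so
  \<open>Hom (\<Oplus>\<^sub>i w\<^sub>i) (\<Oplus>\<^sub>j w'\<^sub>j) = \<Prod>\<^sub>i \<Oplus>\<^sub>j Hom w\<^sub>i w'\<^sub>j\<close>; hence these objects form a full subcategory of
  the category of graded ind-objects, and morphisms are column-finite matrices. A column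
  \<^typ>\<open>'j \<Rightarrow>\<^sub>0 mor\<close> is a morphism from one word to the direct sum indexed by \<^typ>\<open>'j\<close>.
\<close>

type_synonym 'j col = "'j \<Rightarrow>\<^sub>0 mor"
type_synonym ('i, 'j) mat = "'i \<Rightarrow> 'j col"

definition post_comp :: "('i, 'j) mat \<Rightarrow> 'i col \<Rightarrow> 'j col" where
  "post_comp G f = (\<Sum>i\<in>Poly_Mapping.keys f.
     Poly_Mapping.map (\<lambda>g. g \<circ>\<^sub>m Poly_Mapping.lookup f i) (G i))"

definition pre_comp :: "'j col \<Rightarrow> mor \<Rightarrow> 'j col" where
  "pre_comp f h = Poly_Mapping.map (\<lambda>g. g \<circ>\<^sub>m h) f"

definition mat_comp :: "('j, 'k) mat \<Rightarrow> ('i, 'j) mat \<Rightarrow> ('i, 'k) mat" where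
  "mat_comp G F = (\<lambda>i. post_comp G (F i))"

text \<open>The left whiskering \<open>id\<^sub>w \<otimes> f\<close> of a column.\<close>

definition whisker :: "word \<Rightarrow> 'j col \<Rightarrow> 'j col" where
  "whisker w f = Poly_Mapping.map (mor_tensor w w (mor_id w)) f"

record 'i gobj =
  word_of :: "'i \<Rightarrow> word"
  deg_of :: "'i \<Rightarrow> int"
  idem_of :: "('i, 'i) mat"

definition hom_deg :: "int \<Rightarrow> 'i gobj \<Rightarrow> 'j gobj \<Rightarrow> ('i, 'j) mat set" where
  "hom_deg k A B = {F.
     (\<forall>i. \<forall>j\<in>Poly_Mapping.keys (F i). deg_of B j = deg_of A i + k) \<and>
     (\<forall>i j. Poly_Mapping.lookup (F i) j \<in> Hom0 (word_of A i) (word_of B j)) \<and>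
     mat_comp (idem_of B) (mat_comp F (idem_of A)) = F}"

definition unit_obj :: "unit gobj" where
  "unit_obj = \<lparr>word_of = (\<lambda>_. []), deg_of = (\<lambda>_. 0),
     idem_of = (\<lambda>_. Poly_Mapping.single () (mor_id []))\<rparr>"


section \<open>The symmetric algebra\<close>

datatype gen = Gen_c | Gen_Z1 | Gen_Z2 | Gen_b

fun gen_deg :: "gen \<Rightarrow> int" where
  "gen_deg Gen_c = 1"
| "gen_deg Gen_Z1 = 0"
| "gen_deg Gen_Z2 = 0"
| "gen_deg Gen_b = - 1"

definition adj :: word where
  "adj = [Bullet, Circ]"

text \<open>
  \<open>(x, n)\<close> stands for the summand \<open>x\<close> of the copy \<open>X\<^bsub>-n-1\<^esub>\<close>, and a list of such pairs for the tensor
  product of these summands. All lists together index the tensor algebra of \<open>L\<^sub>-X\<close>.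
\<close>

type_synonym tidx = "(gen \<times> nat) list"

definition tword :: "tidx \<Rightarrow> word" where
  "tword l = concat (replicate (length l) adj)"

definition tdeg :: "tidx \<Rightarrow> int" where
  "tdeg l = (\<Sum>y\<leftarrow>l. gen_deg (fst y))"

definition koszul :: "int \<Rightarrow> int \<Rightarrow> complex" where
  "koszul k m = (if odd k \<and> odd m then - 1 else 1)"

definition graded_braid :: "tidx \<Rightarrow> tidx \<Rightarrow> mor" where
  "graded_braid l l' =
     scale_mor [:koszul (tdeg l) (tdeg l'):] (mor_braid (tword l) (tword l'))"

text \<open>
  The permutation \<open>\<pi>\<close> moves the \<open>i\<close>-th tensor factor of \<open>l\<close> to position \<open>\<pi> i\<close>; each factor consists of
  two letters.
\<close>

definition perm_idx :: "(nat \<Rightarrow> nat) \<Rightarrow> tidx \<Rightarrow> tidx" where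
  "perm_idx \<pi> l = map (\<lambda>j. l ! inv \<pi> j) [0..<length l]"

definition perm_diagram :: "(nat \<Rightarrow> nat) \<Rightarrow> nat \<Rightarrow> diagram" where
  "perm_diagram \<pi> k = {{Inl (2 * i + a), Inr (2 * \<pi> i + a)} | i a. i < k \<and> a < 2}"

definition perm_sign :: "(nat \<Rightarrow> nat) \<Rightarrow> tidx \<Rightarrow> complex" where
  "perm_sign \<pi> l = (\<Prod>(i, j) \<in> {(i, j). i < j \<and> j < length l \<and> \<pi> i > \<pi> j}.
     koszul (gen_deg (fst (l ! i))) (gen_deg (fst (l ! j))))"

definition symmetrizer :: "(tidx, tidx) mat" where
  "symmetrizer l = (\<Sum>\<pi> | \<pi> permutes {..<length l}.
     Poly_Mapping.single (perm_idx \<pi> l)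
       (scale_mor [:perm_sign \<pi> l / fact (length l):]
         (mor_of (perm_diagram \<pi> (length l)))))"

text \<open>\<open>V = S(L\<^sub>-X)\<close> is the image of the symmetrizing idempotent on the tensor algebra.\<close>

definition V_obj :: "tidx gobj" where
  "V_obj = \<lparr>word_of = tword, deg_of = tdeg, idem_of = symmetrizer\<rparr>"

definition A_N_deg :: "int \<Rightarrow> tidx col set" where
  "A_N_deg k = {\<alpha>. (\<lambda>_. \<alpha>) \<in> hom_deg k unit_obj V_obj}"

definition A_N :: "tidx col set" where
  "A_N = {\<Sum>k\<in>K. f k | K f. finite K \<and> (\<forall>k\<in>K. f k \<in> A_N_deg k)}"


section \<open>Fields\<close>

fun Omega_coeff :: "gen \<Rightarrow> gen \<Rightarrow> complex" where
  "Omega_coeff Gen_b Gen_c = 1"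
| "Omega_coeff Gen_c Gen_b = 1"
| "Omega_coeff Gen_Z1 Gen_Z2 = - 1"
| "Omega_coeff Gen_Z2 Gen_Z1 = 1"
| "Omega_coeff _ _ = 0"

definition Omega :: "gen \<Rightarrow> gen \<Rightarrow> mor" where
  "Omega x y = scale_mor [:Omega_coeff x y:] (mor_of {{Inl 0, Inl 3}, {Inl 1, Inl 2}})"

text \<open>
  The summand \<open>x \<otimes> l\<close> of the derivation of the tensor algebra that contracts \<open>X\<close> with the copies \<open>X\<^bsub>-n-1\<^esub>\<close>:
  braid \<open>x\<close> past the first \<open>j\<close> factors of \<open>l\<close>, then apply \<open>\<Omega>\<close> to \<open>x\<close> and the next factor. The second
  component of \<open>(x, 0)\<close> only serves to form an index; it affects neither the word nor the degree.
\<close>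

definition contraction :: "gen \<Rightarrow> nat \<Rightarrow> (tidx, tidx) mat" where
  "contraction x n l = (\<Sum>j | j < length l \<and> snd (l ! j) = n.
     let u = take j l; v = drop (Suc j) l in
     Poly_Mapping.single (u @ v)
       (mor_tensor (tword u) (tword u) (mor_id (tword u))
          (mor_tensor (adj @ adj) [] (Omega x (fst (l ! j))) (mor_id (tword v)))
        \<circ>\<^sub>m mor_tensor (adj @ tword u) (tword u @ adj)
             (graded_braid [(x, 0)] u) (mor_id (tword (drop j l)))))"

text \<open>
  In all operators below, the column at \<open>l\<close> of a morphism \<open>W \<otimes> V \<rightarrow> V\<close>, with \<open>W\<close> a fixed word, is the
  restriction to the summand \<open>W \<otimes> tword l\<close>. \<open>gen_mode x n\<close> is the restriction of \<open>X\<^bsub>(n)\<^esub>\<close> to the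
  summand \<open>x\<close> of \<open>X\<close>. Multiplication in the symmetric algebra is concatenation followed by the
  symmetrizer.
\<close>

definition gen_mode :: "gen \<Rightarrow> int \<Rightarrow> (tidx, tidx) mat" where
  "gen_mode x n l =
     (if n < 0 then symmetrizer ((x, nat (- n - 1)) # l)
      else post_comp (contraction x (nat n)) (whisker adj (symmetrizer l)))"

text \<open>The coefficient of \<open>z\<^bsup>-n-1\<^esup>\<close> in \<open>\<partial>\<^sup>kx(z) / k!\<close>, where \<open>x(z) = \<Sum>\<^sub>n z\<^bsup>-n-1\<^esup> x\<^bsub>(n)\<^esub>\<close>.\<close>

definition deriv_mode :: "gen \<times> nat \<Rightarrow> int \<Rightarrow> (tidx, tidx) mat" where
  "deriv_mode y n l = (case y of (x, k) \<Rightarrow>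
     Poly_Mapping.map (scale_mor [:of_int (int k - n - 1) gchoose k:])
       (gen_mode x (n - int k) l))"

text \<open>
  \<open>vertex_op [(x\<^sub>1,n\<^sub>1),\<dots>,(x\<^sub>k,n\<^sub>k)] n\<close> is the coefficient of \<open>z\<^bsup>-n-1\<^esup>\<close> in
  \<open>:\<partial>\<^bsup>n\<^sub>1\<^esup>x\<^sub>1(z) \<cdots> \<partial>\<^bsup>n\<^sub>k\<^esup>x\<^sub>k(z): / (n\<^sub>1! \<cdots> n\<^sub>k!)\<close>, by right-nested normal ordering
  \<open>:A(z) B(z): = A(z)\<^sub>+ B(z) + B(z) A(z)\<^sub>-\<close>, where \<open>A(z)\<^sub>+\<close> and \<open>A(z)\<^sub>-\<close> collect the modes \<open>A\<^bsub>(p)\<^esub>\<close>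
  with \<open>p < 0\<close> and \<open>p \<ge> 0\<close>, and the second term is preceded by the braiding of the sources of \<open>A\<close>
  and \<open>B\<close>. On a fixed \<open>l\<close> only finitely many \<open>p\<close> contribute, so \<^const>\<open>Sum_any\<close> is the genuine sum.
\<close>

primrec vertex_op :: "tidx \<Rightarrow> int \<Rightarrow> (tidx, tidx) mat" where
  "vertex_op [] = (\<lambda>n l. if n = - 1 then symmetrizer l else 0)"
| "vertex_op (y # ys) = (\<lambda>n l. Sum_any (\<lambda>p.
     if p < 0 then
       post_comp (deriv_mode y p) (whisker adj (vertex_op ys (n - p - 1) l))
     else
       pre_comp
         (post_comp (vertex_op ys (n - p - 1)) (whisker (tword ys) (deriv_mode y p l)))
         (mor_tensor (adj @ tword ys) (tword ys @ adj)
            (graded_braid [y] ys) (mor_id (tword l)))))"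

text \<open>
  \<open>state_field \<alpha> n \<beta>\<close> is the coefficient of \<open>z\<^bsup>-n-1\<^esup>\<close> in the field of \<open>\<alpha>\<close> applied to \<open>\<beta>\<close>, that is the
  composite of \<open>\<alpha> \<otimes> \<beta>\<close> with the vertex operators; for \<open>\<alpha>\<close> and \<open>\<beta>\<close> in \<^const>\<open>A_N\<close> it is the product
  \<open>\<alpha> \<cdot>\<^sub>n \<beta>\<close>.
\<close>

definition state_field :: "tidx col \<Rightarrow> int \<Rightarrow> tidx col \<Rightarrow> tidx col" where
  "state_field \<alpha> n \<beta> = (\<Sum>l\<in>Poly_Mapping.keys \<alpha>.
     post_comp (vertex_op l n)
       (Poly_Mapping.map (mor_tensor [] (tword l) (Poly_Mapping.lookup \<alpha> l)) \<beta>))"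

text \<open>
  \<open>Tr : 1 \<rightarrow> \<phi>\<^sub>1 \<otimes> \<cdots> \<otimes> \<phi>\<^sub>k\<close>, where \<open>\<phi>\<^sub>1 \<otimes> \<cdots> \<otimes> \<phi>\<^sub>k\<close> is placed in the copies \<open>X\<^bsub>-1\<^esub>\<close>, whose field is
  \<open>X(z)\<close>. In the two-letter factor \<open>j\<close>, the letters \<open>2j\<close> and \<open>2j+1\<close> are a bullet and a circle.
\<close>

definition Tr :: "gen list \<Rightarrow> tidx col" where
  "Tr xs = Poly_Mapping.single (map (\<lambda>x. (x, 0)) xs)
     (mor_of {{Inr (2 * j + 1), Inr (2 * (Suc j mod length xs))} | j. j < length xs})"

definition Tr_field :: "gen list \<Rightarrow> int \<Rightarrow> tidx col \<Rightarrow> tidx col" where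
  "Tr_field xs = state_field (Tr xs)"

text \<open>The coefficient of \<open>z\<^bsup>-1\<^esup>\<close> of a field given by its coefficients of \<open>z\<^bsup>-n-1\<^esup>\<close>.\<close>

definition residue_mode :: "(int \<Rightarrow> 'a) \<Rightarrow> 'a" where
  "residue_mode F = F 0"

definition Q :: "tidx col \<Rightarrow> tidx col" where
  "Q = residue_mode (\<lambda>n \<beta>.
     Tr_field [Gen_b, Gen_c, Gen_c] n \<beta> +
     (Tr_field [Gen_c, Gen_Z1, Gen_Z2] n \<beta> - Tr_field [Gen_c, Gen_Z2, Gen_Z1] n \<beta>))"

end

(*
  Putting N = n for a natural number n turns a diagram into a product of Kronecker deltas and a
  morphism into a tensor with indices below n, and a morphism out of the unit object vanishes once all
  these tensors vanish. An element of A_N thereby becomes, for every n, a graded symmetric function s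
  of words in the matrix entries of the generators. Annihilating modes turn into the prefix operators
  (A_u s)(w) = s(u w), creating modes into signed deletions, and normally ordered products obey finite
  recursions on the length of w.

  In these terms A_u Q = J_u + (-1)^|u| Q A_u, where J_u is the current attached to the element u of the
  Lie superalgebra gl_n (x) Lambda[e1, e2] (x) C[t], with c = 1, Z_i = e_i and b = e1 e2. By induction on
  w, Q^2 = 0 follows from [J_u, Q] = 0, which follows in the same way from the relation between [J_u, J_v]
  and J_[u,v], and everything reduces to identities between letters: the Jacobi identity, the
  coassociativity of the cobracket, its cocycle property, and the vanishing of the bracket composed
  with the cobracket. In the last one the contributions of b, c and of Z_1, Z_2 cancel.
*)
theory Submission
  imports Defs
begin

text \<open>Two obstacles shape the proof: composing diagrams creates loops, and normally ordered
  products are infinite sums of modes. Evaluation removes the loops, since composition becomes a sum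
  over shared indices; it loses nothing, because coefficients are polynomials in N and for large n
  some index list isolates any given diagram. The sums of modes are avoided by describing an
  operator through its value on the empty word and its commutation with prefix operators. These data
  determine it, and identities between operators follow for all functions at once by induction on
  the word. The Grassmann algebra comes from the data: up to sign, Omega pairs x with y by the
  coefficient of e1 e2 in the product x y, and the cubic terms of Q consist of the products of three
  generators in which e1 e2 occurs. Contracting one field of a current against a letter therefore
  yields the product, and annihilating with both fields yields the dual coproduct. The signs differ
  from the usual ones because an atom and its current have opposite parity.\<close>

abbreviation lookup :: "('a \<Rightarrow>\<^sub>0 'b::zero) \<Rightarrow> 'a \<Rightarrow> 'b" where
  "lookup \<equiv> Poly_Mapping.lookup"

abbreviation keys :: "('a \<Rightarrow>\<^sub>0 'b::zero) \<Rightarrow> 'a set" where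
  "keys \<equiv> Poly_Mapping.keys"

abbreviation single :: "'a \<Rightarrow> 'b \<Rightarrow> 'a \<Rightarrow>\<^sub>0 'b::zero" where
  "single \<equiv> Poly_Mapping.single"

section \<open>Matchings as directed graphs, and their stacking\<close>

section \<open>Oriented diagrams\<close>

text \<open>Bullets of the source and circles of the target are declared tails of edges. The
  condition relating letters and rows then becomes uniform: every edge has one tail and one
  head.\<close>

definition outp :: "word \<Rightarrow> word \<Rightarrow> nat + nat \<Rightarrow> bool" where
  "outp w w' p = (case p of Inl i \<Rightarrow> w ! i = Bullet | Inr j \<Rightarrow> w' ! j = Circ)"

lemma outp_iff: "(letter_at w w' p \<noteq> letter_at w w' q \<longleftrightarrow> isl p = isl q) \<longleftrightarrow> (outp w w' p \<noteq> outp w w' q)"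
  by (cases p; cases q; cases "letter_at w w' p"; cases "letter_at w w' q")
    (simp_all add: letter_at_def outp_def)

lemma diagramsI:
  assumes "\<And>e. e \<in> d \<Longrightarrow> \<exists>p q. e = {p, q} \<and> p \<in> points w w' \<and> q \<in> points w w' \<and> outp w w' p \<and> \<not> outp w w' q"
    and "\<And>p. p \<in> points w w' \<Longrightarrow> \<exists>!e. e \<in> d \<and> p \<in> e"
  shows "d \<in> diagrams w w'"
proof -
  have "e \<subseteq> points w w' \<and> card e = 2" if "e \<in> d" for e
    using assms(1)[OF that] by (auto simp: card_insert_if)
  moreover have "outp w w' p \<noteq> outp w w' q" if "p \<noteq> q" "{p, q} \<in> d" for p q
    using assms(1)[OF that(2)] that(1) by (auto simp: doubleton_eq_iff)
  ultimately show ?thesis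
    using assms(2) by (auto simp: diagrams_def outp_iff)
qed

lemma diagrams_edge:
  assumes "d \<in> diagrams w w'" "e \<in> d"
  obtains p q where "e = {p, q}" "p \<in> points w w'" "q \<in> points w w'" "outp w w' p" "\<not> outp w w' q"
proof -
  have e: "e \<subseteq> points w w'" "card e = 2"
    and l: "\<And>p q. p \<noteq> q \<Longrightarrow> {p, q} \<in> d \<Longrightarrow> outp w w' p \<noteq> outp w w' q"
    using assms by (auto simp: diagrams_def outp_iff)
  from e(2) obtain p q where "e = {p, q}" "p \<noteq> q" by (auto simp: card_2_iff)
  with e(1) l[of p q] that[of p q] that[of q p] assms(2) show ?thesis
    by (auto simp: insert_commute)
qed

lemma diagrams_ex1: "d \<in> diagrams w w' \<Longrightarrow> p \<in> points w w' \<Longrightarrow> \<exists>!e. e \<in> d \<and> p \<in> e"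
  by (simp add: diagrams_def)

lemma diagrams_outp: "d \<in> diagrams w w' \<Longrightarrow> {p, q} \<in> d \<Longrightarrow> outp w w' p \<noteq> outp w w' q"
  by (erule diagrams_edge) (auto simp: doubleton_eq_iff)

lemma diagrams_points: "d \<in> diagrams w w' \<Longrightarrow> {p, q} \<in> d \<Longrightarrow> p \<in> points w w' \<and> q \<in> points w w'"
  by (erule diagrams_edge) (auto simp: doubleton_eq_iff)

lemma diagrams_unique: "d \<in> diagrams w w' \<Longrightarrow> {p, q} \<in> d \<Longrightarrow> {p, r} \<in> d \<Longrightarrow> q = r"
proof -
  assume d: "d \<in> diagrams w w'" and pq: "{p, q} \<in> d" and e2: "{p, r} \<in> d"
  have "{p, q} = {p, r}"
    using diagrams_ex1[OF d, of p] diagrams_points[OF d pq] pq e2 by blast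
  then show "q = r" by (auto simp: doubleton_eq_iff)
qed

lemma diagrams_partner:
  assumes "d \<in> diagrams w w'" "p \<in> points w w'"
  obtains q where "{p, q} \<in> d"
proof -
  obtain e where "e \<in> d" "p \<in> e" using diagrams_ex1[OF assms] by auto
  obtain q r where "e = {q, r}"
    by (rule diagrams_edge[OF assms(1) \<open>e \<in> d\<close>])
  with \<open>e \<in> d\<close> \<open>p \<in> e\<close> that[of q] that[of r] show ?thesis
    by (auto simp: insert_commute)
qed

lemma finite_points [simp]: "finite (points w w')"
  by (simp add: points_def)

section \<open>Paths\<close>

text \<open>Pigeonhole: if every point reachable from \<open>p\<close> had a successor, choosing
  successors would be injective on this finite set, as predecessors are unique, and would miss
  \<open>p\<close>, which has no predecessor.\<close>

lemma ex_path_end: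
  assumes "finite G" "single_valued (G\<inverse>)" "p \<notin> Range G"
  shows "\<exists>q. (p, q) \<in> G\<^sup>* \<and> q \<notin> Domain G"
proof (rule ccontr)
  assume *: "\<not> ?thesis"
  define S where "S = G\<^sup>* `` {p}"
  have fin: "finite S"
  proof (rule finite_subset)
    show "S \<subseteq> insert p (Range G)" by (auto simp: S_def elim: rtranclE)
  qed (use assms(1) in \<open>simp add: finite_Range\<close>)
  define f where "f q = (SOME r. (q, r) \<in> G)" for q
  have f: "(q, f q) \<in> G" if "q \<in> S" for q
    unfolding f_def using * that by (intro someI_ex[of "\<lambda>r. (q, r) \<in> G"]) (auto simp: S_def)
  have "inj_on f S"
    using f assms(2) by (auto simp: inj_on_def single_valued_def) (metis)
  moreover have "f ` S \<subseteq> S - {p}"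
    using f assms(3) by (auto simp: S_def intro: rtrancl_into_rtrancl)
  ultimately have "card S \<le> card (S - {p})"
    using fin by (intro card_inj_on_le) auto
  moreover have "p \<in> S" by (simp add: S_def)
  ultimately show False
    using fin by (metis card_Diff1_less not_less)
qed

lemma path_end_unique:
  assumes "single_valued G" "(p, q) \<in> G\<^sup>*" "(p, r) \<in> G\<^sup>*" "q \<notin> Domain G" "r \<notin> Domain G"
  shows "q = r"
  using single_valued_confluent[OF assms(1-3)] assms(4,5) by (metis Not_Domain_rtrancl)

text \<open>Where successors and predecessors are unique, turning back along a path only retraces
  it, so an undirected path can be straightened to a directed one.\<close>

lemma symcl_path:
  assumes "single_valued G" "single_valued (G\<inverse>)" "(x, y) \<in> (G \<union> G\<inverse>)\<^sup>*"
  shows "(x, y) \<in> G\<^sup>* \<or> (y, x) \<in> G\<^sup>*"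
  using assms(3)
proof induction
  case (step y z)
  from step(2) show ?case
  proof
    assume "(y, z) \<in> G"
    with step(3) show ?thesis
      using single_valued_confluent[OF assms(1), of y x z] by (blast intro: rtrancl_into_rtrancl)
  next
    assume "(y, z) \<in> G\<inverse>"
    then have "(z, y) \<in> G" by simp
    with step(3) show ?thesis
      using single_valued_confluent[OF assms(2), of y x z]
      by (auto simp: rtrancl_converse intro: converse_rtrancl_into_rtrancl)
  qed
qed simp

section \<open>Stacking\<close>

abbreviation "row01 \<equiv> case_sum (Pair (0::nat)) (Pair (1::nat)) :: nat + nat \<Rightarrow> nat \<times> nat"
abbreviation "row12 \<equiv> case_sum (Pair (1::nat)) (Pair (2::nat)) :: nat + nat \<Rightarrow> nat \<times> nat"
abbreviation "row02 \<equiv> case_sum (Pair (0::nat)) (Pair (2::nat)) :: nat + nat \<Rightarrow> nat \<times> nat"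

lemma row_inj: "row01 p = row01 q \<longleftrightarrow> p = q" "row12 p = row12 q \<longleftrightarrow> p = q" "row02 p = row02 q \<longleftrightarrow> p = q"
  by (cases p; cases q; simp)+

lemma row_cross: "row01 p = row12 q \<longleftrightarrow> (\<exists>x. p = Inr x \<and> q = Inl x)"
  "row12 q = row01 p \<longleftrightarrow> (\<exists>x. p = Inr x \<and> q = Inl x)"
  by (cases p; cases q; auto)+

lemma sym_stack_rel: "sym (stack_rel d e)"
proof (rule symI)
  fix x y assume "(x, y) \<in> stack_rel d e"
  then consider p q where "x = row01 p" "y = row01 q" "{p, q} \<in> d" | p q where "x = row12 p" "y = row12 q" "{p, q} \<in> e"
    unfolding stack_rel_def by blast
  then show "(y, x) \<in> stack_rel d e"
  proof cases
    case 1
    then have "{q, p} \<in> d" by (simp add: insert_commute)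
    with 1 show ?thesis unfolding stack_rel_def by blast
  next
    case 2
    then have "{q, p} \<in> e" by (simp add: insert_commute)
    with 2 show ?thesis unfolding stack_rel_def by blast
  qed
qed

lemma stack_iff: "{p, q} \<in> stack d e \<longleftrightarrow> p \<noteq> q \<and> (row02 p, row02 q) \<in> (stack_rel d e)\<^sup>+"
  using symD[OF sym_trancl[OF sym_stack_rel, of d e], of "row02 q" "row02 p"]
  unfolding stack_def by (auto simp: doubleton_eq_iff)

text \<open>
  With every edge directed away from its endpoint satisfying \<^const>\<open>outp\<close>, a point of the middle row
  has exactly one incoming and one outgoing edge, and an outer point has exactly one of the two. So the
  component of an outer point is a directed path between two outer points.
\<close>

definition flow :: "word \<Rightarrow> word \<Rightarrow> word \<Rightarrow> diagram \<Rightarrow> diagram \<Rightarrow> ((nat \<times> nat) \<times> (nat \<times> nat)) set" where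
  "flow w w' w'' d e = {(row01 p, row01 q) | p q. {p, q} \<in> d \<and> outp w w' p} \<union>
     {(row12 p, row12 q) | p q. {p, q} \<in> e \<and> outp w' w'' p}"

context
  fixes w w' w'' d e
  assumes d: "d \<in> diagrams w w'" and e: "e \<in> diagrams w' w''"
begin

lemma stack_rel_flow: "stack_rel d e = flow w w' w'' d e \<union> (flow w w' w'' d e)\<inverse>"
proof (intro equalityI subsetI)
  fix z assume "z \<in> stack_rel d e"
  then consider p q where "z = (row01 p, row01 q)" "{p, q} \<in> d" | p q where "z = (row12 p, row12 q)" "{p, q} \<in> e"
    unfolding stack_rel_def by blast
  then show "z \<in> flow w w' w'' d e \<union> (flow w w' w'' d e)\<inverse>"
  proof cases
    case 1
    then have "{q, p} \<in> d" "outp w w' p \<or> outp w w' q"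
      using diagrams_outp[OF d, of p q] by (auto simp: insert_commute)
    with 1 show ?thesis unfolding flow_def by blast
  next
    case 2
    then have "{q, p} \<in> e" "outp w' w'' p \<or> outp w' w'' q"
      using diagrams_outp[OF e, of p q] by (auto simp: insert_commute)
    with 2 show ?thesis unfolding flow_def by blast
  qed
next
  fix z assume "z \<in> flow w w' w'' d e \<union> (flow w w' w'' d e)\<inverse>"
  moreover have "flow w w' w'' d e \<subseteq> stack_rel d e"
    unfolding flow_def stack_rel_def by blast
  ultimately show "z \<in> stack_rel d e"
    using symD[OF sym_stack_rel[of d e]] by blast
qed

lemma flow_cases:
  assumes "(x, y) \<in> flow w w' w'' d e"
  obtains p q where "x = row01 p" "y = row01 q" "{p, q} \<in> d" "outp w w' p" "\<not> outp w w' q"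
  | p q where "x = row12 p" "y = row12 q" "{p, q} \<in> e" "outp w' w'' p" "\<not> outp w' w'' q"
  using assms diagrams_outp[OF d] diagrams_outp[OF e] unfolding flow_def by blast

lemma single_valued_flow: "single_valued (flow w w' w'' d e)"
proof (rule single_valuedI)
  fix x y z assume "(x, y) \<in> flow w w' w'' d e" "(x, z) \<in> flow w w' w'' d e"
  then show "y = z"
    by (elim flow_cases)
      (auto simp: row_inj row_cross outp_def dest: diagrams_unique[OF d] diagrams_unique[OF e])
qed

lemma single_valued_flow_converse: "single_valued ((flow w w' w'' d e)\<inverse>)"
proof (rule single_valuedI)
  fix x y z assume "(x, y) \<in> (flow w w' w'' d e)\<inverse>" "(x, z) \<in> (flow w w' w'' d e)\<inverse>"
  then have "(y, x) \<in> flow w w' w'' d e" "(z, x) \<in> flow w w' w'' d e" by simp_all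
  moreover have "{a, c} \<in> d \<Longrightarrow> {b, c} \<in> d \<Longrightarrow> a = b" "{a, c} \<in> e \<Longrightarrow> {b, c} \<in> e \<Longrightarrow> a = b" for a b c
    using diagrams_unique[OF d, of c a b] diagrams_unique[OF e, of c a b] by (simp_all add: insert_commute)
  moreover have "a \<noteq> Bullet \<Longrightarrow> a = Circ" for a by (cases a) simp_all
  ultimately show "y = z"
    by (elim flow_cases) (auto simp: row_inj row_cross outp_def)
qed

lemma finite_flow: "finite (flow w w' w'' d e)"
proof (rule finite_subset)
  show "flow w w' w'' d e \<subseteq> (row01 ` points w w' \<union> row12 ` points w' w'') \<times> (row01 ` points w w' \<union> row12 ` points w' w'')"
    using diagrams_points[OF d] diagrams_points[OF e] unfolding flow_def by blast
qed simp

text \<open>An outer point belongs to only one of the two diagrams, hence lies on exactly one edge,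
  with the orientation that it also has in the stacked diagram.\<close>

lemma Domain_flow_outer:
  assumes "p \<in> points w w''"
  shows "row02 p \<in> Domain (flow w w' w'' d e) \<longleftrightarrow> outp w w'' p"
    "row02 p \<in> Range (flow w w' w'' d e) \<longleftrightarrow> \<not> outp w w'' p"
proof -
  have "(row02 p \<in> Domain (flow w w' w'' d e) \<longleftrightarrow> outp w w'' p) \<and> (row02 p \<in> Range (flow w w' w'' d e) \<longleftrightarrow> \<not> outp w w'' p)"
  proof (cases p)
    case (Inl x)
    then have "Inl x \<in> points w w'" using assms by (auto simp: points_def)
    then obtain q where q: "{Inl x, q} \<in> d" using diagrams_partner[OF d] by blast
    then have q': "{q, Inl x} \<in> d" by (simp add: insert_commute)
    have o: "outp w w' (Inl x) = outp w w'' p" by (simp add: Inl outp_def)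
    have r: "row02 p = row01 (Inl x)" "row02 p \<noteq> row12 r" for r by (cases r; simp add: Inl)+
    show ?thesis
    proof (cases "outp w w'' p")
      case True
      then have "(row02 p, row01 q) \<in> flow w w' w'' d e" using q o r unfolding flow_def by blast
      moreover have "(y, row02 p) \<notin> flow w w' w'' d e" for y
        using True o by (auto elim!: flow_cases simp: r row_inj row_cross simp del: sum.case)
      ultimately show ?thesis using True by blast
    next
      case False
      then have "outp w w' q" using diagrams_outp[OF d q] o by simp
      then have "(row01 q, row02 p) \<in> flow w w' w'' d e" using q' r unfolding flow_def by blast
      moreover have "(row02 p, y) \<notin> flow w w' w'' d e" for y
        using False o by (auto elim!: flow_cases simp: r row_inj row_cross simp del: sum.case)
      ultimately show ?thesis using False by blast
    qed
  next
    case (Inr x)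
    then have "Inr x \<in> points w' w''" using assms by (auto simp: points_def)
    then obtain q where q: "{Inr x, q} \<in> e" using diagrams_partner[OF e] by blast
    then have q': "{q, Inr x} \<in> e" by (simp add: insert_commute)
    have o: "outp w' w'' (Inr x) = outp w w'' p" by (simp add: Inr outp_def)
    have r: "row02 p = row12 (Inr x)" "row02 p \<noteq> row01 r" for r by (cases r; simp add: Inr)+
    show ?thesis
    proof (cases "outp w w'' p")
      case True
      then have "(row02 p, row12 q) \<in> flow w w' w'' d e" using q o r unfolding flow_def by blast
      moreover have "(y, row02 p) \<notin> flow w w' w'' d e" for y
        using True o by (auto elim!: flow_cases simp: r row_inj row_cross simp del: sum.case)
      ultimately show ?thesis using True by blast
    next
      case False
      then have "outp w' w'' q" using diagrams_outp[OF e q] o by simp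
      then have "(row12 q, row02 p) \<in> flow w w' w'' d e" using q' r unfolding flow_def by blast
      moreover have "(row02 p, y) \<notin> flow w w' w'' d e" for y
        using False o by (auto elim!: flow_cases simp: r row_inj row_cross simp del: sum.case)
      ultimately show ?thesis using False by blast
    qed
  qed
  then show "row02 p \<in> Domain (flow w w' w'' d e) \<longleftrightarrow> outp w w'' p"
    "row02 p \<in> Range (flow w w' w'' d e) \<longleftrightarrow> \<not> outp w w'' p" by blast+
qed

text \<open>A letter of \<open>w'\<close> is a target letter for \<open>d\<close> and a source
  letter for \<open>e\<close>, so it is a head in one diagram and a tail in the other. Hence no path
  ends in the middle row.\<close>

lemma middle_flow:
  assumes "x < length w'"
  shows "(1, x) \<in> Domain (flow w w' w'' d e)" "(1, x) \<in> Range (flow w w' w'' d e)"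
proof -
  have "Inr x \<in> points w w'" "Inl x \<in> points w' w''" using assms by (auto simp: points_def)
  then obtain q r where q: "{Inr x, q} \<in> d" and r: "{Inl x, r} \<in> e"
    using diagrams_partner[OF d] diagrams_partner[OF e] by metis
  then have q': "{q, Inr x} \<in> d" and r': "{r, Inl x} \<in> e" by (simp_all add: insert_commute)
  have "((1, x), y) \<in> flow w w' w'' d e" if "y = (if w' ! x = Circ then row01 q else row12 r)" for y
  proof (cases "w' ! x")
    case Circ
    with that q show ?thesis unfolding flow_def outp_def by force
  next
    case Bullet
    with that r show ?thesis unfolding flow_def outp_def by force
  qed
  then show "(1, x) \<in> Domain (flow w w' w'' d e)" by blast
  have "(y, (1, x)) \<in> flow w w' w'' d e" if "y = (if w' ! x = Circ then row12 r else row01 q)" for y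
  proof (cases "w' ! x")
    case Circ
    then have "outp w' w'' r" using diagrams_outp[OF e r] by (simp add: outp_def)
    then have "(row12 r, row12 (Inl x)) \<in> flow w w' w'' d e" using r' unfolding flow_def by blast
    then show ?thesis using Circ that by simp
  next
    case Bullet
    then have "outp w w' q" using diagrams_outp[OF d q] by (simp add: outp_def)
    then have "(row01 q, row01 (Inr x)) \<in> flow w w' w'' d e" using q' unfolding flow_def by blast
    then show ?thesis using Bullet that by simp
  qed
  then show "(1, x) \<in> Range (flow w w' w'' d e)" by blast
qed

lemma Field_flow:
  assumes "x \<in> Field (flow w w' w'' d e)"
  shows "(\<exists>p\<in>points w w''. x = row02 p) \<or> (\<exists>i<length w'. x = (1, i))"
proof -
  from assms obtain y where "(x, y) \<in> stack_rel d e"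
    unfolding stack_rel_flow by (auto simp: Field_def)
  then consider p q where "x = row01 p" "{p, q} \<in> d" | p q where "x = row12 p" "{p, q} \<in> e"
    unfolding stack_rel_def by blast
  then show ?thesis
  proof cases
    case 1
    then have p: "p \<in> points w w'" using diagrams_points[OF d] by blast
    show ?thesis
    proof (cases p)
      case (Inl a)
      with p have "Inl a \<in> points w w''" by (auto simp: points_def)
      moreover have "x = row02 (Inl a)" using 1 Inl by simp
      ultimately show ?thesis by blast
    qed (use 1 p in \<open>auto simp: points_def\<close>)
  next
    case 2
    then have p: "p \<in> points w' w''" using diagrams_points[OF e] by blast
    show ?thesis
    proof (cases p)
      case (Inr a)
      with p have "Inr a \<in> points w w''" by (auto simp: points_def)
      moreover have "x = row02 (Inr a)" using 2 Inr by simp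
      ultimately show ?thesis by blast
    qed (use 2 p in \<open>auto simp: points_def\<close>)
  qed
qed

lemma stack_path:
  assumes "(row02 p, row02 q) \<in> (stack_rel d e)\<^sup>+" "p \<noteq> q"
  shows "p \<in> points w w''" "q \<in> points w w''"
    "(outp w w'' p \<and> \<not> outp w w'' q \<and> (row02 p, row02 q) \<in> (flow w w' w'' d e)\<^sup>*) \<or>
     (outp w w'' q \<and> \<not> outp w w'' p \<and> (row02 q, row02 p) \<in> (flow w w' w'' d e)\<^sup>*)"
proof -
  let ?G = "flow w w' w'' d e"
  have F: "Field (stack_rel d e) = Field ?G" unfolding stack_rel_flow by (auto simp: Field_def)
  have "row02 p \<in> Field ?G" "row02 q \<in> Field ?G"
    using assms(1) unfolding F[symmetric] by (metis FieldI1 FieldI2 tranclD tranclD2)+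
  moreover have "row02 r \<noteq> (1, i)" for r i by (cases r) simp_all
  ultimately show pts: "p \<in> points w w''" "q \<in> points w w''"
    using Field_flow[of "row02 p"] Field_flow[of "row02 q"] by (auto simp: row_inj simp del: sum.case)
  have "(row02 p, row02 q) \<in> ?G\<^sup>* \<or> (row02 q, row02 p) \<in> ?G\<^sup>*"
    by (rule symcl_path[OF single_valued_flow single_valued_flow_converse])
      (use assms(1) in \<open>simp add: stack_rel_flow trancl_into_rtrancl\<close>)
  moreover have "outp w w'' a \<and> \<not> outp w w'' b" if "(row02 a, row02 b) \<in> ?G\<^sup>*" "a \<noteq> b" "a \<in> points w w''" "b \<in> points w w''" for a b
  proof -
    have "(row02 a, row02 b) \<in> ?G\<^sup>+" using that(1,2) by (auto simp: rtrancl_eq_or_trancl row_inj)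
    then have "row02 a \<in> Domain ?G" "row02 b \<in> Range ?G"
      by (meson DomainI tranclD, meson RangeI tranclD2)
    then show ?thesis using Domain_flow_outer that by blast
  qed
  ultimately show "(outp w w'' p \<and> \<not> outp w w'' q \<and> (row02 p, row02 q) \<in> ?G\<^sup>*) \<or>
     (outp w w'' q \<and> \<not> outp w w'' p \<and> (row02 q, row02 p) \<in> ?G\<^sup>*)"
    using pts assms(2) by blast
qed

text \<open>The partner of \<open>p\<close> is the other end of its path, followed forwards from a
  tail and backwards from a head. By finiteness the path stops, and it cannot stop in the middle
  row.\<close>

lemma stack_partner:
  assumes "p \<in> points w w''"
  shows "\<exists>!q. {p, q} \<in> stack d e"
proof -
  let ?G = "flow w w' w'' d e"
  have R: "stack_rel d e = ?G \<union> ?G\<inverse>" by (rule stack_rel_flow)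
  have sub: "(row02 p, row02 q) \<in> (stack_rel d e)\<^sup>+" if "(row02 p, row02 q) \<in> ?G\<^sup>* \<or> (row02 q, row02 p) \<in> ?G\<^sup>*" "p \<noteq> q" for q
  proof -
    have "(row02 p, row02 q) \<in> (stack_rel d e)\<^sup>*"
      using that(1) unfolding R by (metis converse_iff in_rtrancl_UnI rtrancl_converse)
    then show ?thesis using that(2) by (auto simp: rtrancl_eq_or_trancl row_inj)
  qed
  show ?thesis
  proof (cases "outp w w'' p")
    case True
    then have "row02 p \<notin> Range ?G" using Domain_flow_outer assms by blast
    then obtain y where y: "(row02 p, y) \<in> ?G\<^sup>*" "y \<notin> Domain ?G"
      using ex_path_end[OF finite_flow single_valued_flow_converse] by blast
    have "row02 p \<in> Domain ?G" using Domain_flow_outer assms True by blast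
    with y have "(row02 p, y) \<in> ?G\<^sup>+" by (auto simp: rtrancl_eq_or_trancl)
    then have "y \<in> Field ?G" by (metis FieldI2 tranclD2)
    with Field_flow y(2) middle_flow(1) obtain q where q: "q \<in> points w w''" "y = row02 q"
      by blast
    have "p \<noteq> q" using y(2) q \<open>row02 p \<in> Domain ?G\<close> by blast
    show ?thesis
    proof (rule ex1I)
      show "{p, q} \<in> stack d e" using sub y q \<open>p \<noteq> q\<close> by (simp add: stack_iff)
      fix r assume "{p, r} \<in> stack d e"
      then have "p \<noteq> r" "(row02 p, row02 r) \<in> (stack_rel d e)\<^sup>+" by (simp_all add: stack_iff)
      from stack_path[OF this(2,1)] True
      have "(row02 p, row02 r) \<in> ?G\<^sup>*" "row02 r \<notin> Domain ?G" using Domain_flow_outer by blast+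
      then show "r = q"
        using path_end_unique[OF single_valued_flow y(1), of "row02 r"] y(2) q(2) by (simp add: row_inj)
    qed
  next
    case False
    then have "row02 p \<notin> Range (?G\<inverse>)" using Domain_flow_outer assms by (metis Range_converse)
    then obtain y where y: "(row02 p, y) \<in> (?G\<inverse>)\<^sup>*" "y \<notin> Domain (?G\<inverse>)"
      using ex_path_end[of "?G\<inverse>"] finite_flow single_valued_flow by (metis converse_converse finite_converse)
    have "row02 p \<in> Range ?G" using Domain_flow_outer assms False by blast
    with y have "(row02 p, y) \<in> (?G\<inverse>)\<^sup>+" by (auto simp: rtrancl_eq_or_trancl)
    then have "y \<in> Field ?G" by (metis Field_converse FieldI2 tranclD2)
    with Field_flow y(2) middle_flow(2) obtain q where q: "q \<in> points w w''" "y = row02 q"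
      by (metis Domain_converse)
    have "p \<noteq> q" using y(2) q \<open>row02 p \<in> Range ?G\<close> by auto
    show ?thesis
    proof (rule ex1I)
      show "{p, q} \<in> stack d e" using sub y q \<open>p \<noteq> q\<close> by (simp add: stack_iff rtrancl_converse)
      fix r assume "{p, r} \<in> stack d e"
      then have "p \<noteq> r" "(row02 p, row02 r) \<in> (stack_rel d e)\<^sup>+" by (simp_all add: stack_iff)
      from stack_path[OF this(2,1)] False
      have "(row02 p, row02 r) \<in> (?G\<inverse>)\<^sup>*" "row02 r \<notin> Domain (?G\<inverse>)"
        using Domain_flow_outer by (auto simp: rtrancl_converse)
      then show "r = q"
        using path_end_unique[OF single_valued_flow_converse y(1), of "row02 r"] y(2) q(2) by (simp add: row_inj)
    qed
  qed
qed

lemma stack_diagrams: "stack d e \<in> diagrams w w''"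
proof (rule diagramsI)
  fix a assume a: "a \<in> stack d e"
  then obtain p q where pq: "a = {p, q}" "p \<noteq> q" "(row02 p, row02 q) \<in> (stack_rel d e)\<^sup>+"
    by (auto simp: stack_def)
  from stack_path[OF pq(3,2)] pq(1)
  show "\<exists>p q. a = {p, q} \<and> p \<in> points w w'' \<and> q \<in> points w w'' \<and> outp w w'' p \<and> \<not> outp w w'' q"
    by (metis insert_commute)
next
  fix p assume "p \<in> points w w''"
  then obtain q where q: "{p, q} \<in> stack d e" "\<And>r. {p, r} \<in> stack d e \<Longrightarrow> r = q"
    using stack_partner by metis
  show "\<exists>!a. a \<in> stack d e \<and> p \<in> a"
  proof (rule ex1I)
    show "{p, q} \<in> stack d e \<and> p \<in> {p, q}" using q(1) by simp
    fix a assume a: "a \<in> stack d e \<and> p \<in> a"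
    then obtain x y where "a = {x, y}" unfolding stack_def by blast
    then have "a = {p, if p = x then y else x}" using a by auto
    with a q(2) show "a = {p, q}" by metis
  qed
qed

end

section \<open>Evaluation at N = n as a faithful tensor functor\<close>

section \<open>Evaluation at natural numbers\<close>

text \<open>
  At \<open>N = n\<close> a diagram becomes the tensor that tests, by \<open>sat\<close>, whether every edge joins two equal
  indices; \<open>i\<close> and \<open>j\<close> list the indices of the source and of the target.
\<close>

definition vals :: "nat list \<Rightarrow> nat list \<Rightarrow> nat + nat \<Rightarrow> nat" where
  "vals i j p = (case p of Inl x \<Rightarrow> i ! x | Inr y \<Rightarrow> j ! y)"

definition sat :: "nat list \<Rightarrow> nat list \<Rightarrow> diagram \<Rightarrow> bool" where
  "sat i j d \<longleftrightarrow> (\<forall>p q. {p, q} \<in> d \<longrightarrow> vals i j p = vals i j q)"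

lemma sat_insert: "sat i j (insert {p, q} d) \<longleftrightarrow> vals i j p = vals i j q \<and> sat i j d"
  unfolding sat_def by (auto simp: doubleton_eq_iff)

lemma sat_empty: "sat i j {}"
  by (simp add: sat_def)

definition idx :: "nat \<Rightarrow> nat \<Rightarrow> nat list set" where
  "idx n k = {i. length i = k \<and> set i \<subseteq> {..<n}}"

lemma finite_idx [simp]: "finite (idx n k)"
  unfolding idx_def using finite_lists_length_eq[of "{..<n}" k] by (simp add: conj_commute)

definition ev :: "nat \<Rightarrow> mor \<Rightarrow> nat list \<Rightarrow> nat list \<Rightarrow> complex" where
  "ev n f i j = (\<Sum>d\<in>keys f. poly (lookup f d) (of_nat n) * of_bool (sat i j d))"

lemma ev_superset:
  assumes "finite D" "keys f \<subseteq> D"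
  shows "ev n f i j = (\<Sum>d\<in>D. poly (lookup f d) (of_nat n) * of_bool (sat i j d))"
  unfolding ev_def using assms by (intro sum.mono_neutral_left) (auto simp: in_keys_iff)

lemma ev_zero [simp]: "ev n 0 i j = 0"
  by (simp add: ev_def)

lemma ev_add: "ev n (f + g) i j = ev n f i j + ev n g i j"
proof -
  let ?D = "keys f \<union> keys g"
  have "ev n (f + g) i j = (\<Sum>d\<in>?D. poly (lookup (f + g) d) (of_nat n) * of_bool (sat i j d))"
    by (rule ev_superset) (auto simp: Poly_Mapping.keys_add)
  moreover have "ev n f i j = (\<Sum>d\<in>?D. poly (lookup f d) (of_nat n) * of_bool (sat i j d))"
    by (rule ev_superset) auto
  moreover have "ev n g i j = (\<Sum>d\<in>?D. poly (lookup g d) (of_nat n) * of_bool (sat i j d))"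
    by (rule ev_superset) auto
  ultimately show ?thesis by (simp add: lookup_add sum.distrib distrib_right)
qed

lemma ev_sum: "ev n (\<Sum>x\<in>X. f x) i j = (\<Sum>x\<in>X. ev n (f x) i j)"
  by (induction X rule: infinite_finite_induct) (simp_all add: ev_add)

lemma ev_single [simp]: "ev n (single d c) i j = poly c (of_nat n) * of_bool (sat i j d)"
  by (cases "c = 0") (simp_all add: ev_def)

lemma ev_mor_of [simp]: "ev n (mor_of d) i j = of_bool (sat i j d)"
  by (simp add: mor_of_def)

lemma lookup_map: "g 0 = 0 \<Longrightarrow> lookup (Poly_Mapping.map g f) k = g (lookup f k)"
  by (simp add: Poly_Mapping.map.rep_eq when_def)

lemma lookup_scale_mor [simp]: "lookup (scale_mor r f) d = r * lookup f d"
  unfolding scale_mor_def by (simp add: lookup_map)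

lemma keys_scale_mor: "keys (scale_mor r f) \<subseteq> keys f"
  by (auto simp: in_keys_iff)

lemma ev_scale [simp]: "ev n (scale_mor r f) i j = poly r (of_nat n) * ev n f i j"
proof -
  have "ev n (scale_mor r f) i j =
      (\<Sum>d\<in>keys f. poly (lookup (scale_mor r f) d) (of_nat n) * of_bool (sat i j d))"
    by (rule ev_superset[OF finite_keys keys_scale_mor])
  then show ?thesis unfolding ev_def sum_distrib_left lookup_scale_mor poly_mult mult.assoc .
qed

definition vval :: "nat list \<Rightarrow> nat list \<Rightarrow> nat list \<Rightarrow> nat \<times> nat \<Rightarrow> nat" where
  "vval i j k x = (if fst x = 0 then i else if fst x = 1 then j else k) ! snd x"

lemma vval_row: "vval i j k (row01 p) = vals i j p" "vval i j k (row12 p) = vals j k p" "vval i j k (row02 p) = vals i k p"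
  by (cases p; simp add: vval_def vals_def)+

lemma sat_pair_iff: "sat i j d \<and> sat j k e \<longleftrightarrow> (\<forall>(x, y)\<in>stack_rel d e. vval i j k x = vval i j k y)"
proof
  assume "sat i j d \<and> sat j k e"
  then show "\<forall>(x, y)\<in>stack_rel d e. vval i j k x = vval i j k y"
    unfolding sat_def stack_rel_def by (auto simp: vval_row simp del: sum.case)
next
  assume *: "\<forall>(x, y)\<in>stack_rel d e. vval i j k x = vval i j k y"
  have "vals i j p = vals i j q" if "{p, q} \<in> d" for p q
  proof -
    have "(row01 p, row01 q) \<in> stack_rel d e" using that unfolding stack_rel_def by blast
    with * have "vval i j k (row01 p) = vval i j k (row01 q)" by blast
    then show ?thesis by (simp only: vval_row)
  qed
  moreover have "vals j k p = vals j k q" if "{p, q} \<in> e" for p q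
  proof -
    have "(row12 p, row12 q) \<in> stack_rel d e" using that unfolding stack_rel_def by blast
    with * have "vval i j k (row12 p) = vval i j k (row12 q)" by blast
    then show ?thesis by (simp only: vval_row)
  qed
  ultimately show "sat i j d \<and> sat j k e" by (simp add: sat_def)
qed

lemma sat_stack_iff: "sat i k (stack d e) \<longleftrightarrow>
    (\<forall>p q. (row02 p, row02 q) \<in> (stack_rel d e)\<^sup>+ \<longrightarrow> vals i k p = vals i k q)"
  unfolding sat_def stack_iff by metis

lemma trancl_vval:
  assumes "\<forall>(x, y)\<in>R. f x = f y" "(x, y) \<in> R\<^sup>+"
  shows "f x = f y"
  using assms(2) by induction (use assms(1) in auto)

context
  fixes w w' w'' d e
  assumes d: "d \<in> diagrams w w'" and e: "e \<in> diagrams w' w''"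
begin

lemma equiv_stack: "equiv (Field (stack_rel d e)) ((stack_rel d e)\<^sup>+)"
proof (rule equivI)
  have s: "(y, x) \<in> stack_rel d e" if "(x, y) \<in> stack_rel d e" for x y
    using symD[OF sym_stack_rel that] .
  show "(stack_rel d e)\<^sup>+ \<subseteq> Field (stack_rel d e) \<times> Field (stack_rel d e)"
    using trancl_subset_Field2 by (auto simp: Field_def dest: tranclD tranclD2)
  show "refl_on (Field (stack_rel d e)) ((stack_rel d e)\<^sup>+)"
  proof (rule refl_onI)
    fix x assume "x \<in> Field (stack_rel d e)"
    then obtain y where "(x, y) \<in> stack_rel d e" using s unfolding Field_def by blast
    with s[OF this] show "(x, x) \<in> (stack_rel d e)\<^sup>+" by (meson r_into_trancl' trancl_trans)
  qed
  show "sym ((stack_rel d e)\<^sup>+)" by (rule sym_trancl[OF sym_stack_rel])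
  show "trans ((stack_rel d e)\<^sup>+)" by (rule trans_trancl)
qed

lemma Field_stack:
  "x \<in> Field (stack_rel d e) \<longleftrightarrow> (\<exists>p\<in>points w w''. x = row02 p) \<or> (\<exists>i<length w'. x = (1, i))"
proof -
  have "Field (stack_rel d e) = Field (flow w w' w'' d e)"
    unfolding stack_rel_flow[OF d e] by (auto simp: Field_def)
  then show ?thesis
    using Field_flow[OF d e, of x] Domain_flow_outer[OF d e] middle_flow[OF d e]
    by (auto simp: Field_def simp del: sum.case)
qed

text \<open>The lists counted are the labellings that are constant on the components of the stacked
  graph. On components meeting an outer row the value is forced by \<open>i\<close> and
  \<open>k\<close>, consistently by \<open>sat\<close>; each closed loop has a free value below
  \<open>n\<close>.\<close>

lemma card_middle:
  assumes i: "i \<in> idx n (length w)" and k: "k \<in> idx n (length w'')" and sat: "sat i k (stack d e)"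
  shows "card {j \<in> idx n (length w'). sat i j d \<and> sat j k e} = n ^ loops d e"
proof -
  let ?R = "stack_rel d e" and ?F = "Field (stack_rel d e)"
  note eq = equiv_stack
  define L where "L = {C \<in> ?F // ?R\<^sup>+. fst ` C \<subseteq> {1}}"
  define J where "J = {j \<in> idx n (length w'). sat i j d \<and> sat j k e}"
  have finF: "finite ?F"
  proof (rule finite_subset)
    show "?F \<subseteq> row02 ` points w w'' \<union> {1} \<times> {..<length w'}" using Field_stack by auto
  qed simp
  then have finL: "finite L"
    unfolding L_def using finite_quotient[OF finF trancl_subset_Field2] by simp
  define rep where "rep C = (SOME x. x \<in> C)" for C :: "(nat \<times> nat) set"
  have rep: "rep C \<in> C" if "C \<in> L" for C
  proof -
    have "C \<noteq> {}" using in_quotient_imp_non_empty[OF eq, of C] that by (simp add: L_def)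
    then show ?thesis unfolding rep_def by (simp add: some_in_eq)
  qed
  define out where "out C = (SOME x. x \<in> C \<and> fst x \<noteq> 1)" for C :: "(nat \<times> nat) set"
  have out: "out C \<in> C \<and> fst (out C) \<noteq> 1" if "C \<in> ?F // ?R\<^sup>+" "C \<notin> L" for C
  proof -
    have "\<exists>x. x \<in> C \<and> fst x \<noteq> 1" using that unfolding L_def by blast
    then show ?thesis unfolding out_def by (rule someI_ex)
  qed
  have const: "vval i j k x = vval i j k y" if "j \<in> J" "(x, y) \<in> ?R\<^sup>+" for j x y
  proof (rule trancl_vval[OF _ that(2)])
    show "\<forall>(x, y)\<in>?R. vval i j k x = vval i j k y"
      using that(1) unfolding sat_pair_iff[symmetric] by (simp add: J_def)
  qed
  have const_out: "vval i j k x = vval i j' k y" if "(x, y) \<in> ?R\<^sup>+" "fst x \<noteq> 1" "fst y \<noteq> 1" for j j' x y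
  proof -
    have "x \<in> ?F" "y \<in> ?F" using that(1) by (metis FieldI1 FieldI2 tranclD tranclD2)+
    with that(2,3) obtain p q where "x = row02 p" "y = row02 q" unfolding Field_stack by auto
    with that(1) sat show ?thesis unfolding sat_stack_iff by (simp add: vval_row)
  qed
  have out_indep: "vval i j k x = vval i j' k x" if "fst x \<noteq> 1" for j j' x
    using that by (simp add: vval_def)
  have mid: "x \<in> ?F \<and> snd x < length w' \<and> x = (1, snd x)" if "x \<in> C" "C \<in> L" for x C
  proof -
    have "C \<subseteq> ?F" using that(2) in_quotient_imp_subset[OF eq] by (auto simp: L_def)
    with that have "x \<in> ?F" "fst x = 1" by (auto simp: L_def)
    moreover have "fst (row02 p) \<noteq> 1" for p by (cases p) simp_all
    ultimately show ?thesis using Field_stack[of x] by auto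
  qed
  \<comment> \<open>The free data: the value of the labelling at a chosen point of each closed
    loop.\<close>
  define \<Psi> where "\<Psi> j = restrict (\<lambda>C. vval i j k (rep C)) L" for j
  have "bij_betw \<Psi> J (L \<rightarrow>\<^sub>E {..<n})"
    unfolding bij_betw_def
  proof
    show "inj_on \<Psi> J"
    proof (rule inj_onI)
      fix j j' assume j: "j \<in> J" "j' \<in> J" "\<Psi> j = \<Psi> j'"
      show "j = j'"
      proof (rule nth_equalityI)
        show "length j = length j'" using j by (simp add: J_def idx_def)
        fix x assume "x < length j"
        then have x: "(1, x) \<in> ?F" using j unfolding Field_stack by (auto simp: J_def idx_def)
        let ?C = "?R\<^sup>+ `` {(1, x)}"
        have C: "?C \<in> ?F // ?R\<^sup>+" using x by (rule quotientI)
        have "vval i j k (1, x) = vval i j' k (1, x)"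
        proof (cases "?C \<in> L")
          case True
          from rep[OF True] have r: "((1, x), rep ?C) \<in> ?R\<^sup>+" by simp
          have "vval i j k (rep ?C) = vval i j' k (rep ?C)"
            using fun_cong[OF j(3), of ?C] True by (simp add: \<Psi>_def)
          then show ?thesis using const[OF j(1) r] const[OF j(2) r] by simp
        next
          case False
          from out[OF C False] have r: "((1, x), out ?C) \<in> ?R\<^sup>+" "fst (out ?C) \<noteq> 1" by simp_all
          then show ?thesis using const[OF j(1) r(1)] const[OF j(2) r(1)] out_indep[OF r(2)] by metis
        qed
        then show "j ! x = j' ! x" by (simp add: vval_def)
      qed
    qed
    show "\<Psi> ` J = (L \<rightarrow>\<^sub>E {..<n})"
    proof (intro equalityI subsetI)
      fix h assume "h \<in> \<Psi> ` J"
      then obtain j where j: "j \<in> J" "h = \<Psi> j" by auto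
      have "vval i j k (rep C) < n" if "C \<in> L" for C
      proof -
        have r: "snd (rep C) < length w'" "rep C = (1, snd (rep C))" using mid[OF rep[OF that] that] by auto
        have "j ! snd (rep C) < n" using j(1) r(1) by (auto simp: J_def idx_def subset_iff)
        moreover have "vval i j k (rep C) = j ! snd (rep C)" by (subst r(2)) (simp add: vval_def)
        ultimately show ?thesis by simp
      qed
      then show "h \<in> L \<rightarrow>\<^sub>E {..<n}" by (simp add: j(2) \<Psi>_def)
    next
      fix h assume h: "h \<in> L \<rightarrow>\<^sub>E {..<n}"
      \<comment> \<open>The inverse construction gives every component a value. The empty list
        standing for the middle indices is never read, because \<open>out C\<close> lies in an outer
        row.\<close>
      define cv where "cv C = (if C \<in> L then h C else vval i [] k (out C))" for C
      define j where "j = map (\<lambda>x. cv (?R\<^sup>+ `` {(1, x)})) [0..<length w']"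
      have vv: "vval i j k x = cv (?R\<^sup>+ `` {x})" if "x \<in> ?F" for x
      proof (cases "fst x = 1")
        case True
        have "fst (row02 p) \<noteq> 1" for p by (cases p) simp_all
        with True that obtain y where "y < length w'" "x = (1, y)" unfolding Field_stack by auto
        then show ?thesis by (simp add: vval_def j_def)
      next
        case False
        let ?C = "?R\<^sup>+ `` {x}"
        have C: "?C \<in> ?F // ?R\<^sup>+" using that by (rule quotientI)
        have "x \<in> ?C" using equiv_class_self[OF eq that] .
        with False have nL: "?C \<notin> L" by (auto simp: L_def)
        from out[OF C nL] have r: "(x, out ?C) \<in> ?R\<^sup>+" "fst (out ?C) \<noteq> 1" by simp_all
        then show ?thesis using nL const_out[OF r(1) False r(2)] by (simp add: cv_def)
      qed
      have lt: "cv (?R\<^sup>+ `` {x}) < n" if "x \<in> ?F" for x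
      proof (cases "?R\<^sup>+ `` {x} \<in> L")
        case True
        then show ?thesis using h by (auto simp: cv_def)
      next
        case False
        let ?C = "?R\<^sup>+ `` {x}"
        have C: "?C \<in> ?F // ?R\<^sup>+" using that by (rule quotientI)
        from out[OF C False] have r: "out ?C \<in> ?C" "fst (out ?C) \<noteq> 1" by auto
        then have "out ?C \<in> ?F" using in_quotient_imp_subset[OF eq C] by blast
        with r(2) obtain p where p: "p \<in> points w w''" "out ?C = row02 p" unfolding Field_stack by auto
        have "vals i k p < n" using p(1) i k by (auto simp: points_def vals_def idx_def subset_iff)
        then show ?thesis using False p(2) by (simp add: cv_def vval_row)
      qed
      have "j \<in> J"
      proof -
        have "j \<in> idx n (length w')"
          using lt Field_stack by (auto simp: idx_def j_def)
        moreover have "vval i j k x = vval i j k y" if "(x, y) \<in> ?R" for x y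
        proof -
          have "x \<in> ?F" "y \<in> ?F" using that by (auto simp: Field_def)
          moreover have "?R\<^sup>+ `` {x} = ?R\<^sup>+ `` {y}" using equiv_class_eq[OF eq] that by blast
          ultimately show ?thesis by (simp add: vv)
        qed
        ultimately show ?thesis using sat_pair_iff[of i j d k e] by (auto simp: J_def)
      qed
      moreover have "\<Psi> j = h"
      proof
        fix C show "\<Psi> j C = h C"
        proof (cases "C \<in> L")
          case True
          have m: "rep C \<in> ?F" "rep C \<in> C" using mid[OF rep[OF True] True] rep[OF True] by auto
          moreover have "?R\<^sup>+ `` {rep C} = C"
          proof -
            obtain x where x: "C = ?R\<^sup>+ `` {x}" using True by (auto simp: L_def elim: quotientE)
            with m(2) have "(x, rep C) \<in> ?R\<^sup>+" by blast
            from equiv_class_eq[OF eq this] show ?thesis using x by blast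
          qed
          ultimately show ?thesis using True by (simp add: \<Psi>_def vv cv_def)
        next
          case False
          then show ?thesis using h by (auto simp: \<Psi>_def PiE_def extensional_def)
        qed
      qed
      ultimately show "h \<in> \<Psi> ` J" by blast
    qed
  qed
  then have "card J = card (L \<rightarrow>\<^sub>E {..<n})" by (rule bij_betw_same_card)
  also have "\<dots> = n ^ card L" using finL by (simp add: card_PiE)
  finally show ?thesis by (simp add: J_def loops_def L_def)
qed

lemma sum_middle:
  assumes i: "i \<in> idx n (length w)" and k: "k \<in> idx n (length w'')"
  shows "(\<Sum>j\<in>idx n (length w'). of_bool (sat i j d) * of_bool (sat j k e) :: complex) =
    of_nat n ^ loops d e * of_bool (sat i k (stack d e))"
proof -
  have "(\<Sum>j\<in>idx n (length w'). of_bool (sat i j d) * of_bool (sat j k e) :: complex) =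
      of_nat (card {j \<in> idx n (length w'). sat i j d \<and> sat j k e})"
    by (simp add: Int_def flip: of_bool_conj)
  moreover have "{j \<in> idx n (length w'). sat i j d \<and> sat j k e} = {}" if "\<not> sat i k (stack d e)"
  proof -
    from that obtain p q where pq: "(row02 p, row02 q) \<in> (stack_rel d e)\<^sup>+" "vals i k p \<noteq> vals i k q"
      unfolding sat_stack_iff by blast
    have False if "sat i j d \<and> sat j k e" for j
      using trancl_vval[of "stack_rel d e" "vval i j k" "row02 p" "row02 q"] that pq
      unfolding sat_pair_iff by (simp add: vval_row)
    then show ?thesis by blast
  qed
  ultimately show ?thesis using card_middle[OF i k] by auto
qed

end

text \<open>Each closed loop contributes a factor \<open>n\<close> to the sum over the middle
  indices, which is the value at \<open>n\<close> of the factor N that composition puts in its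
  place.\<close>

lemma ev_comp:
  assumes "f \<in> Hom0 w w'" "g \<in> Hom0 w' w''" "i \<in> idx n (length w)" "k \<in> idx n (length w'')"
  shows "ev n (g \<circ>\<^sub>m f) i k = (\<Sum>j\<in>idx n (length w'). ev n f i j * ev n g j k)"
proof -
  let ?F = "\<lambda>d. poly (lookup f d) (of_nat n)" and ?G = "\<lambda>e. poly (lookup g e) (of_nat n)"
  have "ev n (g \<circ>\<^sub>m f) i k = (\<Sum>d\<in>keys f. \<Sum>e\<in>keys g.
      ?F d * ?G e * (of_nat n ^ loops d e * of_bool (sat i k (stack d e))))"
    unfolding mor_comp_def ev_sum by (simp add: N_poly_def poly_power mult.assoc)
  also have "\<dots> = (\<Sum>d\<in>keys f. \<Sum>e\<in>keys g.
      ?F d * ?G e * (\<Sum>j\<in>idx n (length w'). of_bool (sat i j d) * of_bool (sat j k e)))"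
    using assms(1,2) by (intro sum.cong refl) (subst sum_middle[OF _ _ assms(3,4)], auto simp: Hom0_def)
  also have "\<dots> = (\<Sum>d\<in>keys f. \<Sum>e\<in>keys g. \<Sum>j\<in>idx n (length w').
      (?F d * of_bool (sat i j d)) * (?G e * of_bool (sat j k e)))"
    by (simp add: sum_distrib_left mult_ac)
  also have "\<dots> = (\<Sum>d\<in>keys f. \<Sum>j\<in>idx n (length w'). \<Sum>e\<in>keys g.
      (?F d * of_bool (sat i j d)) * (?G e * of_bool (sat j k e)))"
    by (intro sum.cong refl) (rule sum.swap)
  also have "\<dots> = (\<Sum>j\<in>idx n (length w'). \<Sum>d\<in>keys f. \<Sum>e\<in>keys g.
      (?F d * of_bool (sat i j d)) * (?G e * of_bool (sat j k e)))"
    by (rule sum.swap)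
  finally show ?thesis unfolding ev_def sum_product .
qed

lemma Hom0_zero [simp]: "0 \<in> Hom0 w w'"
  by (simp add: Hom0_def)

lemma Hom0_add: "f \<in> Hom0 w w' \<Longrightarrow> g \<in> Hom0 w w' \<Longrightarrow> f + g \<in> Hom0 w w'"
  unfolding Hom0_def using Poly_Mapping.keys_add[of f g] by blast

lemma Hom0_sum: "(\<And>x. x \<in> X \<Longrightarrow> f x \<in> Hom0 w w') \<Longrightarrow> sum f X \<in> Hom0 w w'"
  by (induction X rule: infinite_finite_induct) (simp_all add: Hom0_add)

lemma Hom0_scale: "f \<in> Hom0 w w' \<Longrightarrow> scale_mor r f \<in> Hom0 w w'"
  unfolding Hom0_def using keys_scale_mor by blast

lemma Hom0_single: "d \<in> diagrams w w' \<Longrightarrow> single d c \<in> Hom0 w w'"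
  unfolding Hom0_def by (cases "c = 0") simp_all

lemma Hom0_mor_of: "d \<in> diagrams w w' \<Longrightarrow> mor_of d \<in> Hom0 w w'"
  unfolding mor_of_def by (rule Hom0_single)

lemma Hom0_comp: "f \<in> Hom0 w w' \<Longrightarrow> g \<in> Hom0 w' w'' \<Longrightarrow> g \<circ>\<^sub>m f \<in> Hom0 w w''"
  unfolding mor_comp_def by (intro Hom0_sum Hom0_single stack_diagrams) (auto simp: Hom0_def)

lemma comp_zero [simp]: "0 \<circ>\<^sub>m f = 0" "f \<circ>\<^sub>m 0 = 0"
  by (simp_all add: mor_comp_def)

lemma tensor_zero [simp]: "mor_tensor w w' 0 f = 0" "mor_tensor w w' f 0 = 0"
  by (simp_all add: mor_tensor_def)

lemma scale_zero [simp]: "scale_mor r 0 = 0"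
  by (rule poly_mapping_eqI) simp

section \<open>Tensor products\<close>

abbreviation shift :: "word \<Rightarrow> word \<Rightarrow> nat + nat \<Rightarrow> nat + nat" where
  "shift w w' \<equiv> map_sum ((+) (length w)) ((+) (length w'))"

lemma inj_shift: "inj (shift w w')"
  by (intro sum.inj_map) simp_all

lemma shift_points: "shift w w' p \<in> points (w @ v) (w' @ v') \<longleftrightarrow> p \<in> points v v'"
  by (cases p) (auto simp: points_def)

lemma shift_outp: "outp (w @ v) (w' @ v') (shift w w' p) = outp v v' p"
  by (cases p) (simp_all add: outp_def nth_append)

lemma points_append: "p \<in> points (w @ v) (w' @ v') \<longleftrightarrow> p \<in> points w w' \<or> (\<exists>q\<in>points v v'. p = shift w w' q)"
proof (cases p)
  case (Inl x)
  have "x < length w + length v \<longleftrightarrow> x < length w \<or> (\<exists>y<length v. x = length w + y)"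
    by presburger
  then show ?thesis using Inl by (auto simp: points_def image_iff Bex_def)
next
  case (Inr x)
  have "x < length w' + length v' \<longleftrightarrow> x < length w' \<or> (\<exists>y<length v'. x = length w' + y)"
    by presburger
  then show ?thesis using Inr by (auto simp: points_def image_iff Bex_def)
qed

lemma shift_not_points: "shift w w' q \<notin> points w w'"
  by (cases q) (auto simp: points_def)

lemma outp_append: "p \<in> points w w' \<Longrightarrow> outp (w @ v) (w' @ v') p = outp w w' p"
  by (auto simp: points_def outp_def nth_append)

lemma diagram_tensor_diagrams:
  assumes d: "d \<in> diagrams w w'" and e: "e \<in> diagrams v v'"
  shows "diagram_tensor w w' d e \<in> diagrams (w @ v) (w' @ v')"
proof (rule diagramsI)
  fix a assume "a \<in> diagram_tensor w w' d e"
  then consider "a \<in> d" | b where "b \<in> e" "a = shift w w' ` b"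
    by (auto simp: diagram_tensor_def)
  then show "\<exists>p q. a = {p, q} \<and> p \<in> points (w @ v) (w' @ v') \<and> q \<in> points (w @ v) (w' @ v') \<and>
      outp (w @ v) (w' @ v') p \<and> \<not> outp (w @ v) (w' @ v') q"
  proof cases
    case 1
    from diagrams_edge[OF d 1] obtain p q where pq: "a = {p, q}" "p \<in> points w w'" "q \<in> points w w'" "outp w w' p" "\<not> outp w w' q" .
    show ?thesis
      by (rule exI[of _ p], rule exI[of _ q]) (use pq in \<open>simp add: points_append outp_append\<close>)
  next
    case 2
    from diagrams_edge[OF e 2(1)] obtain p q where pq: "b = {p, q}" "p \<in> points v v'" "q \<in> points v v'" "outp v v' p" "\<not> outp v v' q" .
    show ?thesis
      by (rule exI[of _ "shift w w' p"], rule exI[of _ "shift w w' q"]) (use pq 2 in \<open>simp add: shift_points shift_outp\<close>)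
  qed
next
  fix p assume "p \<in> points (w @ v) (w' @ v')"
  then consider "p \<in> points w w'" | q where "q \<in> points v v'" "p = shift w w' q"
    by (auto simp: points_append)
  then show "\<exists>!a. a \<in> diagram_tensor w w' d e \<and> p \<in> a"
  proof cases
    case 1
    have "p \<notin> shift w w' ` b" for b using shift_not_points 1 by blast
    then have "a \<in> diagram_tensor w w' d e \<and> p \<in> a \<longleftrightarrow> a \<in> d \<and> p \<in> a" for a
      by (auto simp: diagram_tensor_def)
    then show ?thesis using diagrams_ex1[OF d 1] by simp
  next
    case 2
    have "p \<notin> a" if "a \<in> d" for a
      using 2 diagrams_edge[OF d that] shift_not_points by (metis empty_iff insert_iff)
    then have *: "a \<in> diagram_tensor w w' d e \<and> p \<in> a \<longleftrightarrow> (\<exists>b\<in>e. q \<in> b \<and> a = shift w w' ` b)" for a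
      using inj_image_mem_iff[OF inj_shift, of w w' q] by (auto simp: diagram_tensor_def 2)
    show ?thesis unfolding * using diagrams_ex1[OF e 2(1)] by blast
  qed
qed

lemma Hom0_tensor: "f \<in> Hom0 w w' \<Longrightarrow> g \<in> Hom0 v v' \<Longrightarrow> mor_tensor w w' f g \<in> Hom0 (w @ v) (w' @ v')"
  unfolding mor_tensor_def by (intro Hom0_sum Hom0_single diagram_tensor_diagrams) (auto simp: Hom0_def)

lemma sat_tensor:
  assumes "d \<in> diagrams w w'" "length i = length w" "length j = length w'"
  shows "sat (i @ i') (j @ j') (diagram_tensor w w' d e) \<longleftrightarrow> sat i j d \<and> sat i' j' e"
proof -
  have v1: "vals (i @ i') (j @ j') p = vals i j p" if "p \<in> points w w'" for p
    using that assms(2,3) by (auto simp: vals_def points_def nth_append)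
  have v2: "vals (i @ i') (j @ j') (shift w w' p) = vals i' j' p" for p
    using assms(2,3) by (cases p) (simp_all add: vals_def nth_append)
  have "sat (i @ i') (j @ j') d \<longleftrightarrow> sat i j d"
    unfolding sat_def using v1 diagrams_points[OF assms(1)] by metis
  moreover have "sat (i @ i') (j @ j') ((`) (shift w w') ` e) \<longleftrightarrow> sat i' j' e"
  proof
    assume *: "sat (i @ i') (j @ j') ((`) (shift w w') ` e)"
    show "sat i' j' e"
      unfolding sat_def
    proof (intro allI impI)
      fix p q assume "{p, q} \<in> e"
      then have "shift w w' ` {p, q} \<in> (`) (shift w w') ` e" by blast
      then have "vals (i @ i') (j @ j') (shift w w' p) = vals (i @ i') (j @ j') (shift w w' q)"
        using * by (simp add: sat_def)
      then show "vals i' j' p = vals i' j' q" by (simp only: v2)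
    qed
  next
    assume *: "sat i' j' e"
    show "sat (i @ i') (j @ j') ((`) (shift w w') ` e)"
      unfolding sat_def
    proof (intro allI impI)
      fix p q assume "{p, q} \<in> (`) (shift w w') ` e"
      then obtain b where b: "b \<in> e" "{p, q} = shift w w' ` b" by blast
      then obtain p' q' where "p' \<in> b" "q' \<in> b" "p = shift w w' p'" "q = shift w w' q'" by blast
      moreover from this b have "shift w w' ` b = shift w w' ` {p', q'}" by simp
      then have "b = {p', q'}" by (simp only: inj_image_eq_iff[OF inj_shift])
      ultimately show "vals (i @ i') (j @ j') p = vals (i @ i') (j @ j') q"
        using b(1) * by (simp only: v2 sat_def)
    qed
  qed
  moreover have "sat I J (A \<union> B) \<longleftrightarrow> sat I J A \<and> sat I J B" for I J A B
    unfolding sat_def by blast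
  ultimately show ?thesis by (simp add: diagram_tensor_def)
qed

lemma ev_tensor:
  assumes "f \<in> Hom0 w w'" "length i = length w" "length j = length w'"
  shows "ev n (mor_tensor w w' f g) (i @ i') (j @ j') = ev n f i j * ev n g i' j'"
proof -
  have "ev n (mor_tensor w w' f g) (i @ i') (j @ j') =
    (\<Sum>d\<in>keys f. \<Sum>e\<in>keys g.
      poly (lookup f d) (of_nat n) * poly (lookup g e) (of_nat n) *
      of_bool (sat (i @ i') (j @ j') (diagram_tensor w w' d e)))"
    unfolding mor_tensor_def ev_sum ev_single poly_mult ..
  also have "\<dots> = (\<Sum>d\<in>keys f. \<Sum>e\<in>keys g.
      (poly (lookup f d) (of_nat n) * of_bool (sat i j d)) *
      (poly (lookup g e) (of_nat n) * of_bool (sat i' j' e)))"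
  proof (intro sum.cong refl)
    fix d e assume "d \<in> keys f"
    then have "d \<in> diagrams w w'" using assms(1) by (auto simp: Hom0_def)
    then show "poly (lookup f d) (of_nat n) * poly (lookup g e) (of_nat n) *
      of_bool (sat (i @ i') (j @ j') (diagram_tensor w w' d e)) =
      (poly (lookup f d) (of_nat n) * of_bool (sat i j d)) *
      (poly (lookup g e) (of_nat n) * of_bool (sat i' j' e))"
      by (simp add: sat_tensor assms(2,3))
  qed
  finally show ?thesis unfolding ev_def sum_product .
qed

section \<open>Diagrams without turning edges\<close>

text \<open>Identities, braidings and permutations of tensor factors all have this shape and are
  treated together; \<open>f\<close> gives the target position of each source letter.\<close>

definition through :: "nat \<Rightarrow> (nat \<Rightarrow> nat) \<Rightarrow> diagram" where
  "through k f = {{Inl i, Inr (f i)} | i. i < k}"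

lemma through_diagrams:
  assumes "bij_betw f {..<length w} {..<length w'}" "\<And>i. i < length w \<Longrightarrow> w' ! f i = w ! i"
  shows "through (length w) f \<in> diagrams w w'"
proof (rule diagramsI)
  fix a assume "a \<in> through (length w) f"
  then obtain i where i: "i < length w" "a = {Inl i, Inr (f i)}" by (auto simp: through_def)
  have fi: "f i < length w'" using assms(1) i(1) by (auto simp: bij_betw_def)
  have pt: "Inl i \<in> points w w'" "Inr (f i) \<in> points w w'" using i fi by (auto simp: points_def)
  show "\<exists>p q. a = {p, q} \<and> p \<in> points w w' \<and> q \<in> points w w' \<and> outp w w' p \<and> \<not> outp w w' q"
  proof (cases "w ! i")
    case Bullet
    with assms(2)[OF i(1)] show ?thesis
      by (intro exI[of _ "Inl i"] exI[of _ "Inr (f i)"]) (use pt i in \<open>simp add: outp_def\<close>)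
  next
    case Circ
    with assms(2)[OF i(1)] show ?thesis
      by (intro exI[of _ "Inr (f i)"] exI[of _ "Inl i"]) (use pt i in \<open>simp add: outp_def insert_commute\<close>)
  qed
next
  fix p assume p: "p \<in> points w w'"
  show "\<exists>!a. a \<in> through (length w) f \<and> p \<in> a"
  proof (cases p)
    case (Inl i)
    with p have "i < length w" by (auto simp: points_def)
    then show ?thesis
      by (intro ex1I[of _ "{Inl i, Inr (f i)}"]) (auto simp: through_def Inl)
  next
    case (Inr j)
    with p have "j < length w'" by (auto simp: points_def)
    then obtain i where i: "i < length w" "j = f i"
      using assms(1) by (auto simp: bij_betw_def image_iff set_eq_iff)
    show ?thesis
    proof (rule ex1I[of _ "{Inl i, Inr (f i)}"])
      fix a assume "a \<in> through (length w) f \<and> p \<in> a"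
      then obtain i' where "i' < length w" "a = {Inl i', Inr (f i')}" "f i' = f i"
        by (auto simp: through_def Inr i)
      with i show "a = {Inl i, Inr (f i)}" using assms(1) by (auto simp: bij_betw_def inj_on_def)
    qed (use i in \<open>auto simp: through_def Inr\<close>)
  qed
qed

lemma sat_through: "sat i j (through k f) \<longleftrightarrow> (\<forall>x<k. i ! x = j ! f x)"
proof
  assume s: "sat i j (through k f)"
  show "\<forall>x<k. i ! x = j ! f x"
  proof (intro allI impI)
    fix x assume "x < k"
    then have "{Inl x, Inr (f x)} \<in> through k f" by (auto simp: through_def)
    with s have "vals i j (Inl x) = vals i j (Inr (f x))" by (simp add: sat_def)
    then show "i ! x = j ! f x" by (simp add: vals_def)
  qed
next
  assume "\<forall>x<k. i ! x = j ! f x"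
  then show "sat i j (through k f)"
    unfolding sat_def through_def by (auto simp: doubleton_eq_iff vals_def)
qed

lemma mor_id_through: "mor_id w = mor_of (through (length w) id)"
  by (simp add: mor_id_def through_def)

lemma Hom0_id [simp]: "mor_id w \<in> Hom0 w w"
  unfolding mor_id_through by (intro Hom0_mor_of through_diagrams) simp_all

lemma ev_id: "length i = length w \<Longrightarrow> length j = length w \<Longrightarrow> ev n (mor_id w) i j = of_bool (i = j)"
  unfolding mor_id_through ev_mor_of sat_through by (simp add: list_eq_iff_nth_eq)

lemma mor_braid_through:
  "mor_braid w w' = mor_of (through (length (w @ w')) (\<lambda>i. if i < length w then length w' + i else i - length w))"
proof -
  have "{{Inl i, Inr (length w' + i)} | i. i < length w} \<union> {{Inl (length w + j), Inr j} | j. j < length w'} =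
     through (length (w @ w')) (\<lambda>i. if i < length w then length w' + i else i - length w)"
    (is "?A \<union> ?B = ?C")
  proof (intro equalityI subsetI)
    fix a assume "a \<in> ?A \<union> ?B"
    then show "a \<in> ?C"
    proof
      assume "a \<in> ?A"
      then obtain i where "i < length w" "a = {Inl i, Inr (length w' + i)}" by blast
      then show ?thesis unfolding through_def by (intro CollectI exI[of _ i]) simp
    next
      assume "a \<in> ?B"
      then obtain j where "j < length w'" "a = {Inl (length w + j), Inr j}" by blast
      then show ?thesis unfolding through_def by (intro CollectI exI[of _ "length w + j"]) simp
    qed
  next
    fix a assume "a \<in> ?C"
    then obtain i where i: "i < length (w @ w')" "a = {Inl i, Inr (if i < length w then length w' + i else i - length w)}"
      unfolding through_def by blast
    show "a \<in> ?A \<union> ?B"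
    proof (cases "i < length w")
      case True
      with i show ?thesis by auto
    next
      case False
      with i have "i - length w < length w'" "a = {Inl (length w + (i - length w)), Inr (i - length w)}" by auto
      then show ?thesis by blast
    qed
  qed
  then show ?thesis by (simp add: mor_braid_def)
qed

lemma braid_bij: "bij_betw (\<lambda>i. if i < length w then length w' + i else i - length w) {..<length (w @ w')} {..<length (w' @ w)}"
  by (rule bij_betw_byWitness[where f' = "\<lambda>i. if i < length w' then length w + i else i - length w'"]) auto

lemma Hom0_braid [simp]: "mor_braid w w' \<in> Hom0 (w @ w') (w' @ w)"
  unfolding mor_braid_through by (intro Hom0_mor_of through_diagrams braid_bij) (auto simp: nth_append)

lemma ev_braid:
  assumes "length i = length w" "length i' = length w'" "length j = length w'" "length j' = length w"
  shows "ev n (mor_braid w w') (i @ i') (j @ j') = of_bool (i = j' \<and> i' = j)"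
proof -
  have "(\<forall>x<length (w @ w'). (i @ i') ! x = (j @ j') ! (if x < length w then length w' + x else x - length w)) \<longleftrightarrow> i = j' \<and> i' = j"
    (is "?L \<longleftrightarrow> ?R")
  proof
    assume L: ?L
    have "i ! x = j' ! x" if "x < length w" for x
      using L[rule_format, of x] that assms by (simp add: nth_append)
    moreover have "i' ! x = j ! x" if "x < length w'" for x
      using L[rule_format, of "length w + x"] that assms by (simp add: nth_append)
    ultimately show ?R using assms by (simp add: list_eq_iff_nth_eq)
  next
    assume ?R
    then show ?L using assms by (auto simp: nth_append)
  qed
  then show ?thesis unfolding mor_braid_through ev_mor_of sat_through by simp
qed

section \<open>Faithfulness\<close>

lemma diagrams_subset_eq:
  assumes "d \<in> diagrams w w'" "d' \<in> diagrams w w'" "d \<subseteq> d'"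
  shows "d = d'"
proof
  show "d' \<subseteq> d"
  proof
    fix a assume a: "a \<in> d'"
    then obtain p q where pq: "a = {p, q}" "p \<in> points w w'" by (rule diagrams_edge[OF assms(2)])
    then obtain r where r: "{p, r} \<in> d" using diagrams_partner[OF assms(1)] by blast
    then have "r = q" using diagrams_unique[OF assms(2), of p r q] assms(3) a pq by auto
    then show "a \<in> d" using r pq by simp
  qed
qed fact

text \<open>An index list compatible with exactly one diagram isolates the coefficient of that
  diagram, which is then a polynomial with infinitely many zeros.\<close>

lemma ev_faithful:
  assumes f: "f \<in> Hom0 [] w" and ev: "\<And>n j. j \<in> idx n (length w) \<Longrightarrow> ev n f [] j = 0"
  shows "f = 0"
proof (rule poly_mapping_eqI)
  fix d show "lookup f d = lookup 0 d"
  proof (cases "d \<in> keys f")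
    case True
    then have d: "d \<in> diagrams [] w" using f by (auto simp: Hom0_def)
    have "\<exists>y. {Inr x, Inr y} \<in> d \<and> y < length w" if "x < length w" for x
    proof -
      have "Inr x \<in> points [] w" using that by (simp add: points_def)
      then obtain q where q: "{Inr x, q} \<in> d" using diagrams_partner[OF d] by blast
      with diagrams_points[OF d q] show ?thesis by (auto simp: points_def)
    qed
    then obtain m where m: "\<And>x. x < length w \<Longrightarrow> {Inr x, Inr (m x)} \<in> d" "\<And>x. x < length w \<Longrightarrow> m x < length w" by metis
    \<comment> \<open>Colour the points by the edges of \<open>d\<close>; then \<open>d\<close> is the only diagram compatible with the colours.\<close>
    define j where "j = map (\<lambda>x. min x (m x)) [0..<length w]"
    have sat: "sat [] j d' \<longleftrightarrow> d' = d" if d': "d' \<in> diagrams [] w" for d'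
    proof
      assume s: "sat [] j d'"
      have "d' \<subseteq> d"
      proof
        fix a assume a: "a \<in> d'"
        then obtain p q where pq: "a = {p, q}" "p \<in> points [] w" "q \<in> points [] w" "outp [] w p" "\<not> outp [] w q"
          by (rule diagrams_edge[OF d'])
        then obtain x y where xy: "p = Inr x" "q = Inr y" "x < length w" "y < length w" "x \<noteq> y"
          by (auto simp: points_def)
        have "vals [] j p = vals [] j q" using s a pq(1) by (simp add: sat_def)
        then have "min x (m x) = min y (m y)" using xy by (simp add: vals_def j_def)
        moreover have "m x \<noteq> m y"
          using xy(5) m(1)[OF xy(3)] m(1)[OF xy(4)] diagrams_unique[OF d, of "Inr (m x)" "Inr x" "Inr y"] by (auto simp: insert_commute)
        ultimately have "m x = y \<or> m y = x" using xy(5) by (auto simp: min_def split: if_splits)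
        then show "a \<in> d" using m(1)[OF xy(3)] m(1)[OF xy(4)] pq(1) xy by (auto simp: insert_commute)
      qed
      then show "d' = d" by (rule diagrams_subset_eq[OF d' d])
    next
      assume "d' = d"
      show "sat [] j d'"
        unfolding \<open>d' = d\<close> sat_def
      proof (intro allI impI)
        fix p q assume pq: "{p, q} \<in> d"
        then obtain x y where xy: "p = Inr x" "q = Inr y" "x < length w" "y < length w"
          using diagrams_points[OF d pq] by (auto simp: points_def)
        have "m x = y" using diagrams_unique[OF d pq, of "Inr (m x)"] m(1)[OF xy(3)] xy by simp
        moreover have "m y = x"
          using diagrams_unique[OF d, of q p "Inr (m y)"] pq m(1)[OF xy(4)] xy by (simp add: insert_commute)
        ultimately show "vals [] j p = vals [] j q" using xy by (simp add: vals_def j_def min.commute)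
      qed
    qed
    \<comment> \<open>From this bound on, the colours, which are positions in \<open>w\<close>, are
      admissible indices below \<open>n\<close>.\<close>
    have root: "poly (lookup f d) (of_nat n) = 0" if "n \<ge> length w" for n
    proof -
      have "j \<in> idx n (length w)" using that m(2) by (auto simp: idx_def j_def)
      then have "0 = ev n f [] j" using ev by simp
      also have "\<dots> = (\<Sum>d'\<in>keys f. if d' = d then poly (lookup f d') (of_nat n) else 0)"
        unfolding ev_def by (intro sum.cong refl) (use f sat in \<open>auto simp: Hom0_def\<close>)
      also have "\<dots> = poly (lookup f d) (of_nat n)" using True by simp
      finally show ?thesis by simp
    qed
    have "lookup f d = 0"
    proof (rule ccontr)
      assume "lookup f d \<noteq> 0"
      then have "finite {x. poly (lookup f d) x = 0}" by (rule poly_roots_finite)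
      moreover have "of_nat ` {length w..} \<subseteq> {x. poly (lookup f d) x = 0}" using root by auto
      ultimately have "finite (of_nat ` {length w..} :: complex set)" using finite_subset by blast
      then show False by (simp add: finite_image_iff inj_on_def infinite_Ici)
    qed
    then show ?thesis by simp
  qed (simp add: in_keys_iff)
qed

section \<open>Symmetric functions of words: creators, annihilators and normally ordered
  products\<close>

section \<open>Fock functions\<close>

text \<open>
  The atom \<open>((x, k), a, b)\<close> is the matrix entry \<open>(a, b)\<close> of the summand \<open>x\<close> of the copy \<open>X\<^bsub>-k-1\<^esub>\<close>. A state is
  described by the function that sends a word \<open>w\<close> of atoms to \<open>length w!\<close> times its coefficient at \<open>w\<close>;
  this factor makes the prefix operator \<open>ann\<close> an annihilator and \<open>cre\<close>, the signed sum over all deletions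
  of a given letter, a creator.
\<close>

type_synonym atom = "(gen \<times> nat) \<times> nat \<times> nat"
type_synonym label = "gen \<times> nat \<times> nat"
type_synonym fock = "atom list \<Rightarrow> complex"

fun gen_of :: "atom \<Rightarrow> gen" where "gen_of ((x, k), i) = x"
fun lev :: "atom \<Rightarrow> nat" where "lev ((x, k), i) = k"
fun lab :: "atom \<Rightarrow> label" where "lab ((x, k), i) = (x, i)"

definition kap :: "gen \<Rightarrow> gen \<Rightarrow> complex" where
  "kap x y = koszul (gen_deg x) (gen_deg y)"

lemma kap_sym: "kap x y = kap y x"
  by (auto simp: kap_def koszul_def)

abbreviation akap :: "atom \<Rightarrow> atom \<Rightarrow> complex" where
  "akap u v \<equiv> kap (gen_of u) (gen_of v)"

lemma kap_sq [simp]: "kap x y * kap x y = 1" "kap x y * (kap x y * c) = c"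
  by (auto simp: kap_def koszul_def)

lemma kap_table [simp]:
  "kap Gen_c Gen_c = - 1" "kap Gen_c Gen_b = - 1" "kap Gen_b Gen_c = - 1" "kap Gen_b Gen_b = - 1"
  "kap Gen_Z1 y = 1" "kap Gen_Z2 y = 1" "kap y Gen_Z1 = 1" "kap y Gen_Z2 = 1"
  by (auto simp: kap_def koszul_def)

lemma kap_sq' [simp]: "kap x y * kap y x = 1" "kap x y * (kap y x * c) = c"
  by (auto simp: kap_def koszul_def)

definition ann :: "atom \<Rightarrow> fock \<Rightarrow> fock" where
  "ann u s = (\<lambda>w. s (u # w))"

lemma ann_apply [simp]: "ann u s w = s (u # w)"
  by (simp add: ann_def)

definition linear_op :: "(fock \<Rightarrow> fock) \<Rightarrow> bool" where
  "linear_op F \<longleftrightarrow> (\<forall>s t. F (\<lambda>w. s w + t w) = (\<lambda>w. F s w + F t w)) \<and>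
     (\<forall>c s. F (\<lambda>w. c * s w) = (\<lambda>w. c * F s w))"

lemma linear_opI:
  assumes "\<And>s t w. F (\<lambda>w. s w + t w) w = F s w + F t w"
    and "\<And>c s w. F (\<lambda>w. c * s w) w = c * F s w"
  shows "linear_op F"
  using assms by (auto simp: linear_op_def)

lemma linear_op_add: "linear_op F \<Longrightarrow> F (\<lambda>w. s w + t w) w = F s w + F t w"
  by (simp add: linear_op_def)

lemma linear_op_scale: "linear_op F \<Longrightarrow> F (\<lambda>w. c * s w) w = c * F s w"
  by (simp add: linear_op_def)

lemma linear_op_sum:
  assumes "linear_op F" "finite V"
  shows "F (\<lambda>w. \<Sum>v\<in>V. c v * g v w) w = (\<Sum>v\<in>V. c v * F (g v) w)"
  using assms(2)
proof (induction V)
  case empty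
  show ?case using linear_op_scale[OF assms(1), of 0 "\<lambda>_. 0" w] by simp
next
  case (insert v V)
  then show ?case
    by (simp add: linear_op_add[OF assms(1)] linear_op_scale[OF assms(1)])
qed

lemma linear_op_comp: "linear_op F \<Longrightarrow> linear_op G \<Longrightarrow> linear_op (\<lambda>s. F (G s))"
  by (simp add: linear_op_def)

lemma linear_op_id: "linear_op (\<lambda>s. s)"
  by (simp add: linear_op_def)

lemma linear_op_zero: "linear_op (\<lambda>s w. 0)"
  by (simp add: linear_op_def)

lemma linear_op_plus: "linear_op F \<Longrightarrow> linear_op G \<Longrightarrow> linear_op (\<lambda>s w. F s w + G s w)"
  by (simp add: linear_op_def algebra_simps)

lemma linear_op_mult: "linear_op F \<Longrightarrow> linear_op (\<lambda>s w. c * F s w)"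
  by (simp add: linear_op_def algebra_simps)

lemma linear_op_Sum:
  assumes "\<And>i. i \<in> I \<Longrightarrow> linear_op (F i)"
  shows "linear_op (\<lambda>s w. \<Sum>i\<in>I. F i s w)"
  using assms by (auto simp: linear_op_def sum.distrib sum_distrib_left)

lemma linear_op_ann: "linear_op (ann u)"
  by (simp add: linear_op_def fun_eq_iff)

definition symm :: "fock \<Rightarrow> bool" where
  "symm s \<longleftrightarrow> (\<forall>p x y v. s (p @ x # y # v) = akap x y * s (p @ y # x # v))"

lemma symmD: "symm s \<Longrightarrow> s (p @ x # y # v) = akap x y * s (p @ y # x # v)"
  unfolding symm_def by blast

lemma symmI: "(\<And>p x y v. s (p @ x # y # v) = akap x y * s (p @ y # x # v)) \<Longrightarrow> symm s"
  unfolding symm_def by blast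

lemma symm_swap: "symm s \<Longrightarrow> s (x # y # v) = akap x y * s (y # x # v)"
  using symmD[of s "[]" x y v] unfolding append_Nil .

lemma symm_ann [simp]:
  assumes "symm s"
  shows "symm (ann u s)"
proof (rule symmI)
  fix p x y v
  show "ann u s (p @ x # y # v) = akap x y * ann u s (p @ y # x # v)"
    using symmD[OF assms, of "u # p" x y v] by (simp only: ann_apply append_Cons)
qed

lemma ann_ann:
  assumes "symm s"
  shows "ann y (ann x s) = (\<lambda>w. akap x y * ann x (ann y s) w)"
  using symm_swap[OF assms, of x y] by (intro ext) (simp only: ann_apply)

lemma symm_plus:
  assumes "symm s" "symm t"
  shows "symm (\<lambda>w. s w + t w)"
proof (rule symmI)
  fix p x y v
  show "s (p @ x # y # v) + t (p @ x # y # v) = akap x y * (s (p @ y # x # v) + t (p @ y # x # v))"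
    unfolding symmD[OF assms(1), of p x y v] symmD[OF assms(2), of p x y v] by (simp only: distrib_left)
qed

lemma symm_scale:
  assumes "symm s"
  shows "symm (\<lambda>w. c * s w)"
proof (rule symmI)
  fix p x y v
  show "c * s (p @ x # y # v) = akap x y * (c * s (p @ y # x # v))"
    unfolding symmD[OF assms, of p x y v] by (simp only: mult.left_commute)
qed

lemma symm_zero: "symm (\<lambda>w. 0)"
  by (rule symmI) simp

lemma symm_sum:
  assumes "\<And>i. i \<in> I \<Longrightarrow> symm (s i)"
  shows "symm (\<lambda>w. \<Sum>i\<in>I. s i w)"
proof (rule symmI)
  fix p x y v
  show "(\<Sum>i\<in>I. s i (p @ x # y # v)) = akap x y * (\<Sum>i\<in>I. s i (p @ y # x # v))"
    unfolding sum_distrib_left by (rule sum.cong[OF refl]) (rule symmD[OF assms])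
qed

text \<open>Serves all operators defined by recursion on the first letter: \<open>E\<close> is what
  happens when this letter is consumed, \<open>c\<close> the sign of passing it. A swap at the front
  is the hypothesis \<open>swap\<close> together with the symmetry of \<open>s\<close>; a deeper one
  is reached by stripping letters with annihilators.\<close>

lemma symm_rec:
  assumes lin: "linear_op F"
    and rec: "\<And>s u w. symm s \<Longrightarrow> F s (u # w) = E u s w + c u * F (ann u s) w"
    and E: "\<And>s u. symm s \<Longrightarrow> symm (E u s)"
    and swap: "\<And>s x y v. symm s \<Longrightarrow>
        E x s (y # v) + c x * E y (ann x s) v =
        akap x y * (E y s (x # v) + c y * E x (ann y s) v)"
    and s: "symm s"
  shows "symm (F s)"
proof -
  have "F s (p @ x # y # v) = akap x y * F s (p @ y # x # v)" for p x y v
    using s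
  proof (induction p arbitrary: s)
    case Nil
    have 1: "F s (x # y # v) = E x s (y # v) + c x * E y (ann x s) v + c x * c y * F (ann y (ann x s)) v" for x y
      using Nil by (simp add: rec algebra_simps)
    have 2: "F (ann y (ann x s)) v = akap x y * F (ann x (ann y s)) v"
      unfolding ann_ann[OF Nil, of y x] by (rule linear_op_scale[OF lin])
    show ?case
      by (simp add: 1 2 swap[OF Nil, of x y v] algebra_simps)
  next
    case (Cons t p)
    show ?case
      using Cons.IH[OF symm_ann[OF Cons.prems, of t]] Cons.prems symmD[OF E[OF Cons.prems, of t], of p x y v]
      by (simp add: rec algebra_simps del: ann_apply)
  qed
  then show ?thesis by (rule symmI)
qed

fun cre :: "atom \<Rightarrow> fock \<Rightarrow> atom list \<Rightarrow> complex" where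
  "cre u s [] = 0"
| "cre u s (v # w) = (if u = v then s w else 0) + akap u v * cre u (ann v s) w"

lemma ann_lin: "ann v (\<lambda>w. s w + t w) = (\<lambda>w. ann v s w + ann v t w)"
  "ann v (\<lambda>w. c * s w) = (\<lambda>w. c * ann v s w)"
  by (simp_all add: fun_eq_iff)

lemma linear_op_cre: "linear_op (cre u)"
proof (rule linear_opI)
  show "cre u (\<lambda>w. s w + t w) w = cre u s w + cre u t w" for s t w
    by (induction w arbitrary: s t) (simp_all add: ann_lin algebra_simps del: ann_apply)
  show "cre u (\<lambda>w. c * s w) w = c * cre u s w" for c s w
    by (induction w arbitrary: s) (simp_all add: ann_lin algebra_simps del: ann_apply)
qed

lemma symm_cre:
  assumes "symm s"
  shows "symm (cre u s)"
proof (rule symm_rec[OF linear_op_cre _ _ _ assms])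
  fix s :: fock and v w
  show "cre u s (v # w) = (if u = v then s else (\<lambda>_. 0)) w + akap u v * cre u (ann v s) w"
    by simp
next
  fix s :: fock and v
  assume "symm s"
  then show "symm (if u = v then s else (\<lambda>_. 0))"
    by (simp add: symm_zero)
next
  fix s :: fock and x y v
  show "(if u = x then s else (\<lambda>_. 0)) (y # v) +
        akap u x * (if u = y then ann x s else (\<lambda>_. 0)) v =
        akap x y * ((if u = y then s else (\<lambda>_. 0)) (x # v) +
        akap u y * (if u = x then ann y s else (\<lambda>_. 0)) v)"
    using kap_sym[of "gen_of x" "gen_of y"] by (cases "u = x"; cases "u = y") (simp_all add: algebra_simps)
qed

text \<open>The only generator that pairs non-trivially with the given one under Omega.\<close>

fun dual :: "gen \<Rightarrow> gen" where
  "dual Gen_c = Gen_b" | "dual Gen_b = Gen_c" | "dual Gen_Z1 = Gen_Z2" | "dual Gen_Z2 = Gen_Z1"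

lemma kap_dual [simp]: "kap (dual x) y = kap x y" "kap x (dual y) = kap x y"
  by (cases x; cases y; simp)+

definition omega :: "gen \<Rightarrow> complex" where "omega x = Omega_coeff x (dual x)"

lemma omega_table [simp]: "omega Gen_c = 1" "omega Gen_b = 1" "omega Gen_Z1 = - 1" "omega Gen_Z2 = 1"
  by (simp_all add: omega_def)

text \<open>The annihilated atom carries the transposed entry \<open>(b, a)\<close> because the
  pairing diagram joins letters 1 and 4 and letters 2 and 3. Contraction is a single prefix
  operator: on symmetric functions all positions of the contracted factor are equivalent to the
  first.\<close>

fun mode :: "label \<Rightarrow> int \<Rightarrow> fock \<Rightarrow> fock" where
  "mode (x, a, b) m s =
     (if m < 0 then cre ((x, nat (- m - 1)), a, b) s
      else (\<lambda>w. omega x * ann ((dual x, nat m), b, a) s w))"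

lemma linear_op_mode: "linear_op (mode y m)"
proof -
  obtain x a b where y: "y = (x, a, b)" by (cases y)
  have "mode y m = (if m < 0 then cre ((x, nat (- m - 1)), a, b)
      else (\<lambda>s w. omega x * ann ((dual x, nat m), b, a) s w))"
    by (simp add: y fun_eq_iff del: split_paired_All)
  then show ?thesis
    by (simp add: linear_op_cre linear_op_mult linear_op_ann del: ann_apply)
qed

lemma symm_mode: "symm s \<Longrightarrow> symm (mode y m s)"
  by (cases y) (auto simp: symm_cre intro: symm_scale simp del: ann_apply)

text \<open>The graded commutation relation of a mode with a prefix operator. An annihilating mode
  is itself a prefix operator and passes with a sign; a creating mode leaves a delta term, and the
  mode \<open>- lev u - 1\<close> is the one that creates level \<open>lev u\<close>.\<close>

lemma mode_Cons:
  assumes "symm s"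
  shows "mode y m s (u # w) = (if lab u = y \<and> m = - int (lev u) - 1 then s w else 0) +
           kap (gen_of u) (fst y) * mode y m (ann u s) w"
proof -
  obtain x a b where y: "y = (x, a, b)" by (cases y)
  obtain x' k c d where u: "u = ((x', k), c, d)" by (metis surj_pair)
  show ?thesis
    using symm_swap[OF assms, of "((dual x, nat m), b, a)" u w]
    by (auto simp: y u kap_sym algebra_simps)
qed

text \<open>
  \<open>pair_op y\<^sub>1 y\<^sub>2 m\<close> is the coefficient of \<open>z\<^bsup>-m-1\<^esup>\<close> in \<open>:y\<^sub>1(z) y\<^sub>2(z):\<close>. The recursion asks which
  field created the first letter, if any; only on the empty word, where both fields annihilate, does a
  sum over modes remain, and it is finite.
\<close>

abbreviation pair_head :: "label \<Rightarrow> label \<Rightarrow> int \<Rightarrow> atom \<Rightarrow> fock \<Rightarrow> fock" where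
  "pair_head y1 y2 m u s w \<equiv> (if lab u = y1 then mode y2 (m + int (lev u)) s w else 0) +
     kap (gen_of u) (fst y1) * (if lab u = y2 then mode y1 (m + int (lev u)) s w else 0)"

fun pair_op :: "label \<Rightarrow> label \<Rightarrow> int \<Rightarrow> fock \<Rightarrow> fock" where
  "pair_op y1 y2 m s [] = (\<Sum>q<nat m. mode y1 (int q) (mode y2 (m - 1 - int q) s) [])"
| "pair_op y1 y2 m s (u # w) = pair_head y1 y2 m u s w +
     kap (gen_of u) (fst y1) * kap (gen_of u) (fst y2) * pair_op y1 y2 m (ann u s) w"

lemma linear_op_pair_op: "linear_op (pair_op y1 y2 m)"
proof (rule linear_opI)
  have mm: "mode y1 q (mode y2 r (\<lambda>w. s w + t w)) = (\<lambda>w. mode y1 q (mode y2 r s) w + mode y1 q (mode y2 r t) w)"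
    "mode y1 q (mode y2 r (\<lambda>w. c * s w)) = (\<lambda>w. c * mode y1 q (mode y2 r s) w)" for q r s t c
    using linear_op_comp[OF linear_op_mode[of y1 q] linear_op_mode[of y2 r]] by (auto simp: linear_op_def)
  note ma = linear_op_add[OF linear_op_mode] linear_op_scale[OF linear_op_mode]
  show "pair_op y1 y2 m (\<lambda>w. s w + t w) w = pair_op y1 y2 m s w + pair_op y1 y2 m t w" for s t w
    by (induction w arbitrary: s t) (simp_all add: ann_lin mm ma sum.distrib algebra_simps del: ann_apply mode.simps)
  show "pair_op y1 y2 m (\<lambda>w. c * s w) w = c * pair_op y1 y2 m s w" for c s w
    by (induction w arbitrary: s) (simp_all add: ann_lin mm ma sum_distrib_left algebra_simps del: ann_apply mode.simps)
qed

lemma gen_of_lab: "lab u = y \<Longrightarrow> gen_of u = fst y"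
  by (cases u rule: lab.cases) auto

lemma symm_pair_op:
  assumes "symm s"
  shows "symm (pair_op y1 y2 m s)"
proof (rule symm_rec[OF linear_op_pair_op _ _ _ assms,
      where E = "pair_head y1 y2 m" and c = "\<lambda>u. kap (gen_of u) (fst y1) * kap (gen_of u) (fst y2)"])
  fix s :: fock and u assume s: "symm s"
  show "symm (pair_head y1 y2 m u s)"
    by (intro symm_plus symm_scale; cases "lab u = y1"; cases "lab u = y2";
        simp add: symm_mode[OF s] symm_zero del: mode.simps)
next
  fix s :: fock and x y v assume s: "symm s"
  show "pair_head y1 y2 m x s (y # v) + kap (gen_of x) (fst y1) * kap (gen_of x) (fst y2) * pair_head y1 y2 m y (ann x s) v =
       akap x y *
       (pair_head y1 y2 m y s (x # v) + kap (gen_of y) (fst y1) * kap (gen_of y) (fst y2) * pair_head y1 y2 m x (ann y s) v)"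
    using kap_sym[of "gen_of x" "gen_of y"]
    by (auto simp: mode_Cons[OF s] gen_of_lab algebra_simps simp del: mode.simps)
qed (simp add: algebra_simps)

declare mode.simps [simp del] ann_apply [simp del]

text \<open>Normally ordered products are graded commutative. On the empty word two annihilating
  modes commute up to sign and the sum is read backwards; on other words the two cases of
  \<open>pair_head\<close> trade places.\<close>

lemma pair_op_swap:
  assumes "symm s"
  shows "pair_op y1 y2 m s w = kap (fst y1) (fst y2) * pair_op y2 y1 m s w"
  using assms
proof (induction w arbitrary: s)
  case Nil
  have ann2: "mode y1 (int q) (mode y2 (int r) s) [] = kap (fst y1) (fst y2) * mode y2 (int r) (mode y1 (int q) s) []" for q r
  proof -
    obtain x1 a1 b1 x2 a2 b2 where y: "y1 = (x1, a1, b1)" "y2 = (x2, a2, b2)"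
      by (metis surj_pair)
    show ?thesis
      using symm_swap[OF Nil, of "((dual x2, r), b2, a2)" "((dual x1, q), b1, a1)" "[]"]
      by (simp add: y mode.simps ann_apply kap_sym)
  qed
  have "pair_op y1 y2 m s [] = (\<Sum>q<nat m. mode y1 (int (nat m - Suc q)) (mode y2 (m - 1 - int (nat m - Suc q)) s) [])"
    unfolding pair_op.simps by (rule sum.nat_diff_reindex[symmetric])
  also have "\<dots> = (\<Sum>q<nat m. kap (fst y1) (fst y2) * mode y2 (int q) (mode y1 (m - 1 - int q) s) [])"
  proof (rule sum.cong[OF refl])
    fix q assume "q \<in> {..<nat m}"
    then have "m - 1 - int (nat m - Suc q) = int q" "int (nat m - Suc q) = m - 1 - int q"
      by auto
    then show "mode y1 (int (nat m - Suc q)) (mode y2 (m - 1 - int (nat m - Suc q)) s) [] =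
        kap (fst y1) (fst y2) * mode y2 (int q) (mode y1 (m - 1 - int q) s) []"
      using ann2[of "nat m - Suc q" q] by simp
  qed
  finally show ?case by (simp add: sum_distrib_left)
next
  case (Cons u w)
  show ?case
    using Cons.IH[OF symm_ann[OF Cons.prems, of u]] kap_sym[of "gen_of u" "fst y1"] kap_sym[of "gen_of u" "fst y2"]
      kap_sym[of "fst y1" "fst y2"]
    by (auto simp: gen_of_lab algebra_simps)
qed

text \<open>
  The residue of a cubic normally ordered product; on the empty word it vanishes, since three annihilating
  modes cannot have total degree \<open>-2\<close>.
\<close>

abbreviation triple_head :: "label \<Rightarrow> label \<Rightarrow> label \<Rightarrow> atom \<Rightarrow> fock \<Rightarrow> fock" where
  "triple_head y1 y2 y3 u s w \<equiv> (if lab u = y1 then pair_op y2 y3 (int (lev u)) s w else 0) +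
     kap (gen_of u) (fst y1) * (if lab u = y2 then pair_op y1 y3 (int (lev u)) s w else 0) +
     kap (gen_of u) (fst y1) * kap (gen_of u) (fst y2) *
       (if lab u = y3 then pair_op y1 y2 (int (lev u)) s w else 0)"

abbreviation triple_sign :: "label \<Rightarrow> label \<Rightarrow> label \<Rightarrow> atom \<Rightarrow> complex" where
  "triple_sign y1 y2 y3 u \<equiv> kap (gen_of u) (fst y1) * kap (gen_of u) (fst y2) * kap (gen_of u) (fst y3)"

fun triple_op :: "label \<Rightarrow> label \<Rightarrow> label \<Rightarrow> fock \<Rightarrow> fock" where
  "triple_op y1 y2 y3 s [] = 0"
| "triple_op y1 y2 y3 s (u # w) = triple_head y1 y2 y3 u s w + triple_sign y1 y2 y3 u * triple_op y1 y2 y3 (ann u s) w"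

lemma linear_op_triple_op: "linear_op (triple_op y1 y2 y3)"
proof (rule linear_opI)
  note pa = linear_op_add[OF linear_op_pair_op] linear_op_scale[OF linear_op_pair_op]
  show "triple_op y1 y2 y3 (\<lambda>w. s w + t w) w = triple_op y1 y2 y3 s w + triple_op y1 y2 y3 t w" for s t w
    by (induction w arbitrary: s t) (simp_all add: ann_lin pa algebra_simps)
  show "triple_op y1 y2 y3 (\<lambda>w. c * s w) w = c * triple_op y1 y2 y3 s w" for c s w
    by (induction w arbitrary: s) (simp_all add: ann_lin pa algebra_simps)
qed

text \<open>The sign bookkeeping for swapping two leading letters, with operator values abstracted
  to numbers. The conditions \<open>X1\<close> to \<open>Y3\<close> say which field may have created
  which letter; \<open>m1\<close>, \<open>m2\<close>, \<open>m3\<close> stand for the remaining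
  single mode, the \<open>q\<close> and \<open>r\<close> values for the remaining pair.\<close>

lemma triple_swap:
  fixes k a1 a2 a3 b1 b2 b3 m1 m2 m3 :: complex
  assumes "X1 \<Longrightarrow> b1 = k" "X2 \<Longrightarrow> b2 = k" "X3 \<Longrightarrow> b3 = k" "Y1 \<Longrightarrow> a1 = k" "Y2 \<Longrightarrow> a2 = k" "Y3 \<Longrightarrow> a3 = k"
    and "k * k = 1" "a1 * a1 = 1" "a2 * a2 = 1" "a3 * a3 = 1" "b1 * b1 = 1" "b2 * b2 = 1" "b3 * b3 = 1"
  shows "(if X1 then (if Y2 then m3 else 0) + b2 * (if Y3 then m2 else 0) + b2 * b3 * r23 else 0) +
     a1 * (if X2 then (if Y1 then m3 else 0) + b1 * (if Y3 then m1 else 0) + b1 * b3 * r13 else 0) +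
     a1 * a2 * (if X3 then (if Y1 then m2 else 0) + b1 * (if Y2 then m1 else 0) + b1 * b2 * r12 else 0) +
     a1 * a2 * a3 * ((if Y1 then q23 else 0) + b1 * (if Y2 then q13 else 0) + b1 * b2 * (if Y3 then q12 else 0)) =
    k * ((if Y1 then (if X2 then m3 else 0) + a2 * (if X3 then m2 else 0) + a2 * a3 * q23 else 0) +
     b1 * (if Y2 then (if X1 then m3 else 0) + a1 * (if X3 then m1 else 0) + a1 * a3 * q13 else 0) +
     b1 * b2 * (if Y3 then (if X1 then m2 else 0) + a1 * (if X2 then m1 else 0) + a1 * a2 * q12 else 0) +
     b1 * b2 * b3 * ((if X1 then r23 else 0) + a1 * (if X2 then r13 else 0) + a1 * a2 * (if X3 then r12 else 0)))"
proof -
  have sq: "k * (k * c) = c" "a1 * (a1 * c) = c" "a2 * (a2 * c) = c" "a3 * (a3 * c) = c"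
    "b1 * (b1 * c) = c" "b2 * (b2 * c) = c" "b3 * (b3 * c) = c" for c
    using assms(7-) by (simp_all flip: mult.assoc)
  show ?thesis
    using assms
    by (cases X1; cases X2; cases X3; cases Y1; cases Y2; cases Y3; simp add: sq distrib_left mult_ac)
qed

lemma symm_triple_op:
  assumes "symm s"
  shows "symm (triple_op y1 y2 y3 s)"
proof (rule symm_rec[OF linear_op_triple_op _ _ _ assms,
      where E = "triple_head y1 y2 y3" and c = "triple_sign y1 y2 y3"])
  fix s :: fock and u assume s: "symm s"
  show "symm (triple_head y1 y2 y3 u s)"
    by (intro symm_plus symm_scale; cases "lab u = y1"; cases "lab u = y2"; cases "lab u = y3";
        simp add: symm_pair_op[OF s] symm_zero)
next
  fix s :: fock and x y v assume s: "symm s"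
  have k: "lab x = z \<Longrightarrow> kap (gen_of y) (fst z) = akap x y"
    "lab y = z \<Longrightarrow> kap (gen_of x) (fst z) = akap x y" for z
    by (auto simp: gen_of_lab kap_sym)
  show "triple_head y1 y2 y3 x s (y # v) + triple_sign y1 y2 y3 x * triple_head y1 y2 y3 y (ann x s) v =
       akap x y *
       (triple_head y1 y2 y3 y s (x # v) + triple_sign y1 y2 y3 y * triple_head y1 y2 y3 x (ann y s) v)"
    unfolding pair_op.simps add.commute[of "int (lev y)" "int (lev x)"]
    by (rule triple_swap) (simp_all add: k)
qed (simp add: algebra_simps)

section \<open>The currents, their Lie bracket and cobracket, and nilpotency on symmetric
  functions\<close>

section \<open>The current algebra\<close>

text \<open>The pattern \<open>(a, b)\<close>, \<open>(b, e)\<close>, \<open>(e, a)\<close> is what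
  the cyclic trace diagram imposes on the six indices of three matrix entries.\<close>

definition cubic :: "nat \<Rightarrow> gen \<Rightarrow> gen \<Rightarrow> gen \<Rightarrow> fock \<Rightarrow> fock" where
  "cubic n x y z s w = (\<Sum>a<n. \<Sum>b<n. \<Sum>e<n. triple_op (x, a, b) (y, b, e) (z, e, a) s w)"

definition brst :: "nat \<Rightarrow> fock \<Rightarrow> fock" where
  "brst n s w = cubic n Gen_b Gen_c Gen_c s w +
     (cubic n Gen_c Gen_Z1 Gen_Z2 s w - cubic n Gen_c Gen_Z2 Gen_Z1 s w)"

lemma linear_op_brst: "linear_op (brst n)"
proof -
  have c: "linear_op (\<lambda>s w. cubic n x y z s w)" for x y z
    unfolding cubic_def by (intro linear_op_Sum linear_op_triple_op)
  have "linear_op (\<lambda>s w. cubic n Gen_b Gen_c Gen_c s w +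
     (cubic n Gen_c Gen_Z1 Gen_Z2 s w + (- 1) * cubic n Gen_c Gen_Z2 Gen_Z1 s w))"
    by (intro linear_op_plus linear_op_mult c)
  then show ?thesis by (simp add: brst_def[abs_def])
qed

lemma symm_brst:
  assumes "symm s"
  shows "symm (brst n s)"
proof -
  have c: "symm (\<lambda>w. cubic n x y z s w)" for x y z
    unfolding cubic_def by (intro symm_sum symm_triple_op assms)
  have "symm (\<lambda>w. cubic n Gen_b Gen_c Gen_c s w +
     (cubic n Gen_c Gen_Z1 Gen_Z2 s w + (- 1) * cubic n Gen_c Gen_Z2 Gen_Z1 s w))"
    by (intro symm_plus symm_scale c)
  then show ?thesis by (simp add: brst_def[abs_def])
qed

fun par_sign :: "gen \<Rightarrow> complex" where
  "par_sign Gen_c = - 1" | "par_sign Gen_b = - 1" | "par_sign Gen_Z1 = 1" | "par_sign Gen_Z2 = 1"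

text \<open>What is left of the cubic terms of Q when a factor \<open>x\<close> is struck out and
  the other two are rotated to follow the trace. The signs come from moving the struck factor to the
  front and from the rotation.\<close>

fun current_form :: "gen \<Rightarrow> (gen \<Rightarrow> gen \<Rightarrow> complex) \<Rightarrow> complex" where
  "current_form Gen_c F = F Gen_c Gen_b + F Gen_b Gen_c + F Gen_Z1 Gen_Z2 - F Gen_Z2 Gen_Z1"
| "current_form Gen_b F = F Gen_c Gen_c"
| "current_form Gen_Z1 F = F Gen_Z2 Gen_c - F Gen_c Gen_Z2"
| "current_form Gen_Z2 F = F Gen_c Gen_Z1 - F Gen_Z1 Gen_c"

fun current :: "nat \<Rightarrow> atom \<Rightarrow> fock \<Rightarrow> fock" where
  "current n ((x, k), a, b) s w =
     (\<Sum>e<n. current_form x (\<lambda>y z. pair_op (y, b, e) (z, e, a) (int k) s w))"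

fun small :: "nat \<Rightarrow> atom \<Rightarrow> bool" where "small n (y, a, b) \<longleftrightarrow> a < n \<and> b < n"

lemma sum_select:
  fixes f :: "nat \<Rightarrow> 'a::comm_monoid_add"
  assumes "a < n"
  shows "(\<Sum>e<n. if a = e then f e else 0) = f a" "(\<Sum>e<n. if e = a then f e else 0) = f a"
  using assms by (simp_all add: sum.delta sum.delta')

lemma sum_if_const: "(\<Sum>e\<in>I. if P then f e else (0::complex)) = (if P then \<Sum>e\<in>I. f e else 0)"
  by simp

lemma cubic_Cons:
  assumes "symm s" "small n u"
  shows "cubic n x y z s (u # w) =
    (case u of ((x', k), a, b) \<Rightarrow>
      (\<Sum>e<n. if x' = x then pair_op (y, b, e) (z, e, a) (int k) s w else 0) +
      kap x' x * (\<Sum>e<n. if x' = y then kap x z * pair_op (z, b, e) (x, e, a) (int k) s w else 0) +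
      kap x' x * kap x' y * (\<Sum>e<n. if x' = z then pair_op (x, b, e) (y, e, a) (int k) s w else 0)) +
    kap (gen_of u) x * kap (gen_of u) y * kap (gen_of u) z * cubic n x y z (ann u s) w"
proof -
  obtain x' k a' b' where u: "u = ((x', k), a', b')" by (metis surj_pair)
  have s1: "(\<Sum>a<n. \<Sum>b<n. \<Sum>e<n. if lab u = (x, a, b) then f a b e else 0) =
      (\<Sum>e<n. if x' = x then f a' b' e else 0)" for f :: "nat \<Rightarrow> nat \<Rightarrow> nat \<Rightarrow> complex"
  proof -
    have "(\<Sum>e<n. if lab u = (x, a, b) then f a b e else 0) =
       (if a' = a then if b' = b then \<Sum>e<n. if x' = x then f a b e else 0 else 0 else 0)" for a b
      by (auto simp: u)
    then show ?thesis using assms(2) by (simp add: u sum_select sum_if_const)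
  qed
  have s2: "(\<Sum>a<n. \<Sum>b<n. \<Sum>e<n. if lab u = (y, b, e) then f a b e else 0) =
      (\<Sum>a<n. if x' = y then f a a' b' else 0)" for f :: "nat \<Rightarrow> nat \<Rightarrow> nat \<Rightarrow> complex"
  proof -
    have "(\<Sum>e<n. if lab u = (y, b, e) then f a b e else 0) =
       (if a' = b then \<Sum>e<n. if b' = e then if x' = y then f a b e else 0 else 0 else 0)" for a b
      by (auto simp: u intro!: sum.cong)
    then show ?thesis using assms(2) by (simp add: u sum_select sum_if_const)
  qed
  have s3: "(\<Sum>a<n. \<Sum>b<n. \<Sum>e<n. if lab u = (z, e, a) then f a b e else 0) =
      (\<Sum>b<n. if x' = z then f b' b a' else 0)" for f :: "nat \<Rightarrow> nat \<Rightarrow> nat \<Rightarrow> complex"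
  proof -
    have "(\<Sum>b<n. \<Sum>e<n. if lab u = (z, e, a) then f a b e else 0) =
       (if b' = a then \<Sum>b<n. \<Sum>e<n. if a' = e then if x' = z then f a b e else 0 else 0 else 0)" for a
      by (auto simp: u intro!: sum.cong)
    then show ?thesis using assms(2) by (simp add: u sum_select sum_if_const)
  qed
  have "cubic n x y z s (u # w) =
     (\<Sum>a<n. \<Sum>b<n. \<Sum>e<n. if lab u = (x, a, b) then pair_op (y, b, e) (z, e, a) (int (lev u)) s w else 0) +
     kap (gen_of u) x * (\<Sum>a<n. \<Sum>b<n. \<Sum>e<n. if lab u = (y, b, e) then pair_op (x, a, b) (z, e, a) (int (lev u)) s w else 0) +
     kap (gen_of u) x * kap (gen_of u) y *
       (\<Sum>a<n. \<Sum>b<n. \<Sum>e<n. if lab u = (z, e, a) then pair_op (x, a, b) (y, b, e) (int (lev u)) s w else 0) +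
     kap (gen_of u) x * kap (gen_of u) y * kap (gen_of u) z * cubic n x y z (ann u s) w"
    unfolding cubic_def triple_op.simps sum_distrib_left fst_conv by (simp only: sum.distrib)
  then show ?thesis
    unfolding s1 s2 s3
    \<comment> \<open>When the middle factor is struck, the other two stand in the wrong cyclic
      order; exchanging them makes the index path run from \<open>b\<close> over \<open>e\<close> to
      \<open>a\<close>.\<close>
    using pair_op_swap[OF assms(1), of "(x, _, _)" "(z, _, _)"]
    by (simp add: u cong: sum.cong if_cong)
qed

text \<open>All cubic terms have degree 1, so the three signs of passing \<open>u\<close> multiply
  to the parity sign of \<open>u\<close> itself.\<close>

lemma brst_Cons:
  assumes "symm s" "small n u"
  shows "brst n s (u # w) = current n u s w + par_sign (gen_of u) * brst n (ann u s) w"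
proof -
  obtain x k a b where u: "u = ((x, k), a, b)" by (metis surj_pair)
  show ?thesis
    unfolding brst_def cubic_Cons[OF assms] unfolding u
    by (cases x) (simp_all add: sum.distrib sum_subtractf sum_negf algebra_simps)
qed

text \<open>
  The current of an atom \<open>u\<close> has the parity opposite to that of \<open>u\<close>; \<open>sg\<close> is the sign of exchanging a
  current with an atom and \<open>tg\<close> that of exchanging two currents.
\<close>

fun sg :: "gen \<Rightarrow> gen \<Rightarrow> complex" where
  "sg x y = (if par_sign x = 1 \<and> par_sign y = - 1 then - 1 else 1)"

fun tg :: "gen \<Rightarrow> gen \<Rightarrow> complex" where
  "tg x y = (if par_sign x = 1 \<and> par_sign y = 1 then - 1 else 1)"

abbreviation asg :: "atom \<Rightarrow> atom \<Rightarrow> complex" where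
  "asg u v \<equiv> sg (gen_of u) (gen_of v)"

abbreviation atg :: "atom \<Rightarrow> atom \<Rightarrow> complex" where
  "atg u v \<equiv> tg (gen_of u) (gen_of v)"

text \<open>
  The product of the Grassmann algebra with unit \<open>c\<close>, odd generators \<open>Z\<^sub>1\<close>, \<open>Z\<^sub>2\<close> and \<open>b = Z\<^sub>1Z\<^sub>2\<close>, with the
  signs that are due to the shifted parity of the atoms. Together with matrix multiplication and the
  multiplication of the monomials \<open>t\<^sup>k\<close> it gives the bracket of \<open>gl\<^sub>n \<otimes> \<Lambda> \<otimes> \<complex>[t]\<close>. The cobracket below is
  dual to the same product.
\<close>

fun gen_mult :: "gen \<Rightarrow> gen \<Rightarrow> gen" where
  "gen_mult Gen_c y = y"
| "gen_mult x Gen_c = x"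
| "gen_mult x y = Gen_b"

fun gen_coeff :: "gen \<Rightarrow> gen \<Rightarrow> complex" where
  "gen_coeff Gen_c y = 1"
| "gen_coeff Gen_b Gen_c = 1"
| "gen_coeff Gen_Z1 Gen_c = - 1"
| "gen_coeff Gen_Z2 Gen_c = - 1"
| "gen_coeff Gen_Z1 Gen_Z2 = 1"
| "gen_coeff Gen_Z2 Gen_Z1 = - 1"
| "gen_coeff _ _ = 0"

text \<open>The bracket is a linear combination of atoms; it is encoded by the value that a function
  \<open>f\<close> on atoms, extended linearly, takes on it. The two terms are the two orders of the
  matrix product.\<close>

fun bracket :: "atom \<Rightarrow> atom \<Rightarrow> (atom \<Rightarrow> complex) \<Rightarrow> complex" where
  "bracket ((x, k), a, b) ((y, l), c, d) f =
     gen_coeff x y * ((if b = c then f ((gen_mult x y, k + l), a, d) else 0) - (if a = d then f ((gen_mult x y, k + l), c, b) else 0))"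

lemma linear_op_current: "linear_op (current n u)"
proof -
  obtain x k a b where u: "u = ((x, k), a, b)" by (metis surj_pair)
  have "current n u = (\<lambda>s w. \<Sum>e<n. current_form x (\<lambda>y z. pair_op (y, b, e) (z, e, a) (int k) s w))"
    by (intro ext) (simp add: u)
  then show ?thesis
    by (cases x) (simp_all add: linear_op_Sum linear_op_plus linear_op_pair_op
      linear_op_plus[OF _ linear_op_mult[where c = "- 1"], simplified])
qed

lemma symm_current:
  assumes "symm s"
  shows "symm (current n u s)"
proof -
  obtain x k a b where u: "u = ((x, k), a, b)" by (metis surj_pair)
  have m: "symm s \<Longrightarrow> symm t \<Longrightarrow> symm (\<lambda>w. s w - t w)" for s t
    using symm_plus[OF _ symm_scale[where c = "- 1"], of s t] by simp
  have "current n u s = (\<lambda>w. \<Sum>e<n. current_form x (\<lambda>y z. pair_op (y, b, e) (z, e, a) (int k) s w))"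
    by (intro ext) (simp add: u)
  then show ?thesis
    by (cases x) (simp_all add: symm_sum symm_plus symm_pair_op m assms)
qed

lemma mode_nonneg: "mode (x, a, b) (int k + int l) s w = omega x * s (((dual x, k + l), b, a) # w)"
  by (simp add: mode.simps ann_apply nat_add_distrib)

text \<open>If one field of the current created \<open>t\<close>, the other has the mode number
  \<open>k + l\<close>, the sum of the levels of \<open>u\<close> and \<open>t\<close>. This is
  non-negative, so it annihilates, and \<open>t\<close> is replaced by an atom of level
  \<open>k + l\<close>.\<close>

lemma current_Cons:
  assumes "small n t"
  shows "current n u s (t # w) = bracket u t (\<lambda>v. s (v # w)) + asg u t * current n u (ann t s) w"
proof -
  obtain x k a b where u: "u = ((x, k), a, b)" by (metis surj_pair)
  obtain y l c d where t: "t = ((y, l), c, d)" by (metis surj_pair)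
  have cd: "c < n" "d < n" using assms by (simp_all add: t)
  have c1: "(\<Sum>e<n. if b = c \<and> e = d then f e else 0) = (if b = c then f d else 0)"
    "(\<Sum>e<n. if c = b \<and> d = e then f e else 0) = (if b = c then f d else 0)"
    "(\<Sum>e<n. if e = c \<and> a = d then f e else 0) = (if a = d then f c else 0)" 
    "(\<Sum>e<n. if c = e \<and> d = a then f e else 0) = (if a = d then f c else 0)" for f :: "nat \<Rightarrow> complex"
    using cd by (auto simp: sum_select)
  show ?thesis
    by (cases x; cases y; simp add: u t mode_nonneg sum.distrib sum_subtractf sum_negf c1 flip: sum_distrib_left;
      simp add: algebra_simps)
qed

fun cobracket_form :: "gen \<Rightarrow> (gen \<Rightarrow> gen \<Rightarrow> complex) \<Rightarrow> complex" where
  "cobracket_form Gen_c F = F Gen_c Gen_b + F Gen_b Gen_c - F Gen_Z1 Gen_Z2 + F Gen_Z2 Gen_Z1"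
| "cobracket_form Gen_b F = F Gen_b Gen_b"
| "cobracket_form Gen_Z1 F = F Gen_b Gen_Z1 - F Gen_Z1 Gen_b"
| "cobracket_form Gen_Z2 F = F Gen_b Gen_Z2 - F Gen_Z2 Gen_b"

text \<open>On monomials this is the divided difference (t^k - s^k) / (t - s), the sum of all t^j
  s^i with i + j = k - 1. It collects the cases in which both fields of the current annihilate. Like
  the bracket it is encoded by its pairing with a function.\<close>

fun cobracket :: "nat \<Rightarrow> atom \<Rightarrow> (atom \<Rightarrow> atom \<Rightarrow> complex) \<Rightarrow> complex" where
  "cobracket n ((x, k), a, b) F =
     (\<Sum>i<k. \<Sum>e<n. cobracket_form x (\<lambda>y z. F ((y, k - Suc i), a, e) ((z, i), e, b)))"

lemma current_Nil: "current n u s [] = cobracket n u (\<lambda>v w. s [v, w])"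
proof -
  obtain x k a b where u: "u = ((x, k), a, b)" by (metis surj_pair)
  have p: "pair_op (y, b, e) (z, e, a) (int k) s [] =
     (\<Sum>i<k. omega y * omega z * s [((dual z, k - Suc i), a, e), ((dual y, i), e, b)])" for y z e
  proof -
    have "mode (y, b, e) (int i) (mode (z, e, a) (int k - 1 - int i) s) [] =
       omega y * omega z * s [((dual z, k - Suc i), a, e), ((dual y, i), e, b)]" if "i < k" for i
    proof -
      have "int k - 1 - int i = int (k - Suc i)" using that by simp
      then show ?thesis unfolding \<open>int k - 1 - int i = int (k - Suc i)\<close> by (simp add: mode.simps ann_apply)
    qed
    then show ?thesis by simp
  qed
  show ?thesis
    unfolding u current.simps cobracket.simps
    by (subst sum.swap, cases x)
      (simp_all add: p sum.distrib sum_subtractf sum_negf algebra_simps del: pair_op.simps)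
qed

lemma bracket_add: "bracket u t (\<lambda>v. f v + g v) = bracket u t f + bracket u t g"
  by (cases u; cases t; cases "fst u"; cases "fst t") (auto simp: algebra_simps)

lemma linear_op_bracket:
  assumes "linear_op F"
  shows "F (\<lambda>w. bracket u t (\<lambda>v. g v w)) w = bracket u t (\<lambda>v. F (g v) w)"
proof -
  have z: "F (\<lambda>w. 0) w = 0" for w
    using linear_op_scale[OF assms, of 0 "\<lambda>_. 0" w] by simp
  have m: "F (\<lambda>w. s w - t w) w = F s w - F t w" "F (\<lambda>w. - s w) w = - F s w" for s t w
    using linear_op_add[OF assms, of s "\<lambda>w. - 1 * t w" w] linear_op_scale[OF assms, of "- 1" _ w] by simp_all
  obtain x k a b y l c d where u: "u = ((x, k), a, b)" "t = ((y, l), c, d)" by (metis surj_pair)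
  show ?thesis
    by (cases "b = c"; cases "a = d") (simp_all add: u linear_op_scale[OF assms] m z)
qed

lemma bracket_cong:
  assumes "small n u" "small n t" "\<And>v. small n v \<Longrightarrow> f v = g v"
  shows "bracket u t f = bracket u t g"
proof -
  obtain x k a b y l c d where u: "u = ((x, k), a, b)" "t = ((y, l), c, d)" by (metis surj_pair)
  show ?thesis using assms by (simp add: u)
qed

text \<open>Every atom in the bracket has the total parity of \<open>u\<close> and \<open>t\<close>
  plus one, so each of these signs is constant on the bracket. The extra one is the parity shift
  between atoms and currents.\<close>

lemma bracket_signs:
  "bracket u t (\<lambda>a. asg v a * g a) = atg u v * asg v t * bracket u t g"
  "bracket u t (\<lambda>a. asg a v * g a) = asg u v * asg t v * bracket u t g"
  "bracket u t (\<lambda>a. par_sign (gen_of a) * g a) = - par_sign (gen_of u) * par_sign (gen_of t) * bracket u t g"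
proof -
  obtain x k a b y l c d where u: "u = ((x, k), a, b)" "t = ((y, l), c, d)" by (metis surj_pair)
  show "bracket u t (\<lambda>a. asg v a * g a) = atg u v * asg v t * bracket u t g"
    by (cases x; cases y; cases "gen_of v") (simp_all add: u algebra_simps)
  show "bracket u t (\<lambda>a. asg a v * g a) = asg u v * asg t v * bracket u t g"
    by (cases x; cases y; cases "gen_of v") (simp_all add: u algebra_simps)
  show "bracket u t (\<lambda>a. par_sign (gen_of a) * g a) = - par_sign (gen_of u) * par_sign (gen_of t) * bracket u t g"
    by (cases x; cases y) (simp_all add: u algebra_simps)
qed

text \<open>Grassmann, matrix and monomial products are associative. Operators act on functions of
  letters, so applying the current of \<open>v\<close> and then that of \<open>u\<close> brackets
  the letter with \<open>u\<close> first and with \<open>v\<close> afterwards; this reversal is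
  behind the sign on the right.\<close>

lemma bracket_jacobi:
  "bracket u t (\<lambda>a. bracket v a f) - atg u v * bracket v t (\<lambda>a. bracket u a f) =
   - asg u v * bracket u v (\<lambda>a. bracket a t f)"
proof -
  obtain x k a b y l c d z m e h where u: "u = ((x, k), a, b)" "v = ((y, l), c, d)" "t = ((z, m), e, h)"
    by (metis surj_pair)
  have lev: "k + l + m = m + (k + l)" "l + (k + m) = m + (k + l)" "k + (l + m) = m + (k + l)" by simp_all
  show ?thesis
    by (cases x; cases y; cases z) (auto simp: u lev)
qed

lemma cobracket_form_sum: "(\<Sum>i\<in>I. cobracket_form x (G i)) = cobracket_form x (\<lambda>y z. \<Sum>i\<in>I. G i y z)"
  by (cases x) (simp_all add: sum.distrib sum_subtractf sum_negf)

lemma cobracket_form_add: "cobracket_form x (\<lambda>y z. G y z + H y z) = cobracket_form x G + cobracket_form x H"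
  by (cases x) simp_all

lemma cobracket_form_cong: "(\<And>y z. G y z = H y z) \<Longrightarrow> cobracket_form x G = cobracket_form x H"
  by presburger

lemma cobracket_add: "cobracket n u (\<lambda>v w. F v w + G v w) = cobracket n u F + cobracket n u G"
proof -
  obtain x k a b where u: "u = ((x, k), a, b)" by (metis surj_pair)
  show ?thesis by (simp add: u cobracket_form_add sum.distrib)
qed

lemma cobracket_commute: "cobracket n u (\<lambda>a b. cobracket n v (F a b)) = cobracket n v (\<lambda>c d. cobracket n u (\<lambda>a b. F a b c d))"
proof -
  obtain x k a b y l c d where u: "u = ((x, k), a, b)" "v = ((y, l), c, d)" by (metis surj_pair)
  have cc: "cobracket_form x (\<lambda>y1 y2. cobracket_form y (G y1 y2)) = cobracket_form y (\<lambda>z1 z2. cobracket_form x (\<lambda>y1 y2. G y1 y2 z1 z2))" for G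
    by (cases x; cases y) (simp_all add: algebra_simps)
  have sw: "(\<Sum>i<k. \<Sum>e<n. \<Sum>j<l. \<Sum>f<n. G i e j f) = (\<Sum>j<l. \<Sum>f<n. \<Sum>i<k. \<Sum>e<n. G i e j f)" for G :: "nat \<Rightarrow> nat \<Rightarrow> nat \<Rightarrow> nat \<Rightarrow> complex"
  proof -
    have "(\<Sum>e<n. \<Sum>j<l. \<Sum>f<n. G i e j f) = (\<Sum>j<l. \<Sum>f<n. \<Sum>e<n. G i e j f)" for i
      by (subst sum.swap, rule sum.cong[OF refl], rule sum.swap)
    moreover have "(\<Sum>i<k. \<Sum>j<l. \<Sum>f<n. \<Sum>e<n. G i e j f) = (\<Sum>j<l. \<Sum>f<n. \<Sum>i<k. \<Sum>e<n. G i e j f)"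
      by (subst sum.swap, rule sum.cong[OF refl], rule sum.swap)
    ultimately show ?thesis by simp
  qed
  show ?thesis
    unfolding u cobracket.simps cobracket_form_sum[symmetric] sw cc ..
qed

text \<open>The two tensor factors of the cobracket of \<open>u\<close> have total parity opposite
  to that of \<open>u\<close>, so their two signs multiply to the sign of exchanging two
  currents.\<close>

lemma cobracket_signs:
  "cobracket n u (\<lambda>a b. asg v a * (asg v b * F a b)) = atg u v * cobracket n u F"
proof -
  obtain x k a b where u: "u = ((x, k), a, b)" by (metis surj_pair)
  show ?thesis
    by (cases x; cases "gen_of v") (simp_all add: u sum_subtractf sum.distrib sum_negf algebra_simps)
qed

text \<open>The cobracket is a 1-cocycle with values in the graded symmetric square. Terms with a
  Kronecker delta between the indices of \<open>u\<close> and \<open>v\<close> match the cobracket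
  of the bracket; the others cancel among themselves by the symmetry of \<open>F\<close>.\<close>

lemma cobracket_cocycle:
  assumes F: "\<And>a b. F a b = akap a b * F b a"
    and sm: "small n u" "small n v"
  shows "cobracket n u (\<lambda>a b. bracket v a (\<lambda>w. F w b) + asg v a * bracket v b (F a)) -
     atg u v * cobracket n v (\<lambda>a b. bracket u a (\<lambda>w. F w b) + asg u a * bracket u b (F a)) +
     asg u v * bracket u v (\<lambda>w. cobracket n w F) = 0"
proof -
  obtain x k a b x' l c d where u: "u = ((x, k), a, b)" "v = ((x', l), c, d)" by (metis surj_pair)
  have lt: "a < n" "b < n" "c < n" "d < n" using sm by (simp_all add: u)
  \<comment> \<open>Stated for arbitrary atoms so that it serves for both orders of \<open>u\<close>
    and \<open>v\<close>. The index \<open>e\<close> of the cobracket either keeps running, next to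
    a delta, or is fixed by the bracket.\<close>
  have piece: "cobracket n ((x, k), a, b) (\<lambda>p q. bracket ((x', l), c, d) p (\<lambda>w. F w q) + sg x' (gen_of p) * bracket ((x', l), c, d) q (F p)) =
    cobracket_form x (\<lambda>y z. gen_coeff x' y * ((if d = a then \<Sum>i<k. \<Sum>e<n. F ((gen_mult x' y, l + (k - Suc i)), c, e) ((z, i), e, b) else 0) -
       (\<Sum>i<k. F ((gen_mult x' y, l + (k - Suc i)), a, d) ((z, i), c, b))) +
     sg x' y * (gen_coeff x' z * ((\<Sum>i<k. F ((y, k - Suc i), a, d) ((gen_mult x' z, l + i), c, b)) -
       (if c = b then \<Sum>i<k. \<Sum>e<n. F ((y, k - Suc i), a, e) ((gen_mult x' z, l + i), e, d) else 0))))"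
    if "c < n" "d < n" for x k a b x' l c d
  proof -
    have h1: "(\<Sum>e<n. bracket ((x', l), c, d) ((y, k - Suc i), a, e) (\<lambda>w. F w ((z, i), e, b))) =
       gen_coeff x' y * ((if d = a then \<Sum>e<n. F ((gen_mult x' y, l + (k - Suc i)), c, e) ((z, i), e, b) else 0) -
         F ((gen_mult x' y, l + (k - Suc i)), a, d) ((z, i), c, b))"
      and h2: "(\<Sum>e<n. bracket ((x', l), c, d) ((z, i), e, b) (F ((y, k - Suc i), a, e))) =
       gen_coeff x' z * (F ((y, k - Suc i), a, d) ((gen_mult x' z, l + i), c, b) -
         (if c = b then \<Sum>e<n. F ((y, k - Suc i), a, e) ((gen_mult x' z, l + i), e, d) else 0))" for i y z
      using that by (simp_all add: sum_subtractf sum_select sum_if_const flip: sum_distrib_left)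
    show ?thesis
      unfolding cobracket.simps cobracket_form_sum
      by (rule cobracket_form_cong)
        (simp add: h1 h2 sum.distrib sum_subtractf sum_if_const del: bracket.simps sg.simps flip: sum_distrib_left)
  qed
  have sp: "(\<Sum>i<k + l. G i) = (\<Sum>i<l. G i) + (\<Sum>i<k. G (l + i))" for k l and G :: "nat \<Rightarrow> complex"
    using sum.atLeastLessThan_concat[of 0 l "k + l" G] sum.shift_bounds_nat_ivl[of G 0 l k]
    by (simp add: lessThan_atLeast0 add.commute)
  have cong: "(\<Sum>i<k. \<Sum>e<n. F ((y, k + l - Suc (l + i)), p e) (q e i)) = (\<Sum>i<k. \<Sum>e<n. F ((y, k - Suc i), p e) (q e i))"
    "(\<Sum>i<k. \<Sum>e<n. F ((y, k + l - Suc i), p e) (q e i)) = (\<Sum>i<k. \<Sum>e<n. F ((y, l + (k - Suc i)), p e) (q e i))"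
    for k l y p q
  proof -
    show "(\<Sum>i<k. \<Sum>e<n. F ((y, k + l - Suc (l + i)), p e) (q e i)) = (\<Sum>i<k. \<Sum>e<n. F ((y, k - Suc i), p e) (q e i))"
      by simp
    have "k + l - Suc i = l + (k - Suc i)" if "i < k" for i using that by simp
    then show "(\<Sum>i<k. \<Sum>e<n. F ((y, k + l - Suc i), p e) (q e i)) = (\<Sum>i<k. \<Sum>e<n. F ((y, l + (k - Suc i)), p e) (q e i))"
      by (intro sum.cong[OF refl]) (simp only: lessThan_iff)
  qed
  \<comment> \<open>The cobracket at level \<open>k + l\<close> is cut into the part where the first
    tensor factor has absorbed \<open>k\<close> and the part where the second has absorbed
    \<open>l\<close>.\<close>
  have W: "(\<Sum>i<k + l. \<Sum>e<n. F ((y, k + l - Suc i), p e) ((z, i), q e)) =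
      (\<Sum>i<l. \<Sum>e<n. F ((y, k + (l - Suc i)), p e) ((z, i), q e)) + (\<Sum>i<k. \<Sum>e<n. F ((y, k - Suc i), p e) ((z, l + i), q e))"
    for y z p q and k l :: nat
    unfolding sp[of "\<lambda>i. \<Sum>e<n. F ((y, k + l - Suc i), p e) ((z, i), q e)"]
    using cong(1)[of y k l p "\<lambda>e i. ((z, l + i), q e)"] cong(2)[of y l k p "\<lambda>e i. ((z, i), q e)"]
    by (simp add: add.commute)
  \<comment> \<open>Terms without a delta, in which all four matrix indices stay open.\<close>
  define S1 where "S1 y z = (\<Sum>i<k. F ((y, l + (k - Suc i)), a, d) ((z, i), c, b))" for y z
  define S2 where "S2 y z = (\<Sum>i<k. F ((y, k - Suc i), a, d) ((z, l + i), c, b))" for y z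
  define S3 where "S3 y z = (\<Sum>i<l. F ((y, k + (l - Suc i)), c, b) ((z, i), a, d))" for y z
  define S4 where "S4 y z = (\<Sum>i<l. F ((y, l - Suc i), c, b) ((z, k + i), a, d))" for y z
  \<comment> \<open>\<open>T\<close> lists the splittings of the total level
    \<open>k + l - 1\<close>. The four sums are its segments cut at \<open>k\<close> and at
    \<open>l\<close>, two of them after exchanging the arguments of \<open>F\<close>; both cuts give
    the same total.\<close>
  have S: "S4 y z = kap y z * S1 z y + S3 y z - kap y z * S2 z y" for y z
  proof -
    define T where "T i = F ((y, k + l - Suc i), c, b) ((z, i), a, d)" for i
    have "S4 y z = (\<Sum>i<l. T (k + i))" unfolding S4_def T_def by (intro sum.cong) auto
    moreover have "S3 y z = (\<Sum>i<l. T i)" unfolding S3_def T_def by (intro sum.cong) auto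
    moreover have "kap y z * S1 z y = (\<Sum>i<k. T (l + (k - Suc i)))"
      unfolding S1_def T_def sum_distrib_left
      by (intro sum.cong refl) (subst (2) F, auto simp: kap_sym intro!: arg_cong2[where f = F])
    moreover have "\<dots> = (\<Sum>i<k. T (l + i))"
      by (rule sum.nat_diff_reindex[of "\<lambda>i. T (l + i)"])
    moreover have "kap y z * S2 z y = (\<Sum>i<k. T (k - Suc i))"
      unfolding S2_def T_def sum_distrib_left
      by (intro sum.cong refl) (subst (2) F, auto simp: kap_sym intro!: arg_cong2[where f = F])
    moreover have "\<dots> = (\<Sum>i<k. T i)"
      by (rule sum.nat_diff_reindex)
    ultimately show ?thesis
      using sp[of T k l] sp[of T l k] by (simp add: add.commute)
  qed
  \<comment> \<open>Terms with a delta between \<open>u\<close> and \<open>v\<close>: the outer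
    indices are those of the matrix product, and \<open>e\<close> still runs.\<close>
  define R1 where "R1 y z = (\<Sum>i<k. \<Sum>e<n. F ((y, l + (k - Suc i)), c, e) ((z, i), e, b))" for y z
  define R2 where "R2 y z = (\<Sum>i<k. \<Sum>e<n. F ((y, k - Suc i), a, e) ((z, l + i), e, d))" for y z
  define R3 where "R3 y z = (\<Sum>i<l. \<Sum>e<n. F ((y, k + (l - Suc i)), a, e) ((z, i), e, d))" for y z
  define R4 where "R4 y z = (\<Sum>i<l. \<Sum>e<n. F ((y, l - Suc i), c, e) ((z, k + i), e, b))" for y z
  have B: "bracket u v (\<lambda>w. cobracket n w F) = gen_coeff x x' * ((if b = c then cobracket_form (gen_mult x x') (\<lambda>y z. R3 y z + R2 y z) else 0) -
       (if a = d then cobracket_form (gen_mult x x') (\<lambda>y z. R1 y z + R4 y z) else 0))"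
  proof -
    have "cobracket n ((X, k + l), a, d) F = cobracket_form X (\<lambda>y z. R3 y z + R2 y z)" for X
      unfolding cobracket.simps cobracket_form_sum R3_def R2_def W ..
    moreover have "cobracket n ((X, k + l), c, b) F = cobracket_form X (\<lambda>y z. R1 y z + R4 y z)" for X
      unfolding cobracket.simps cobracket_form_sum R1_def R4_def add.commute[of k l] W ..
    ultimately show ?thesis by (simp add: u)
  qed
  show ?thesis
    unfolding B unfolding u gen_of.simps piece[OF lt(3,4)] piece[OF lt(1,2)]
      S1_def[symmetric] S2_def[symmetric] S3_def[symmetric] S4_def[symmetric]
      R1_def[symmetric] R2_def[symmetric] R3_def[symmetric] R4_def[symmetric] S
    by (cases x; cases x') (auto simp: algebra_simps)
qed

lemma sum_triangle:
  fixes f :: "nat \<Rightarrow> nat \<Rightarrow> complex"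
  shows "(\<Sum>i<k. \<Sum>j<i. f (i - Suc j) j) = (\<Sum>i<k. \<Sum>j<k - Suc i. f j i)"
proof -
  have "(\<Sum>i<k. \<Sum>j<i. f (i - Suc j) j) = (\<Sum>(i, j)\<in>(SIGMA i:{..<k}. {..<i}). f (i - Suc j) j)"
    by (rule sum.Sigma) auto
  also have "\<dots> = (\<Sum>(i, j)\<in>(SIGMA i:{..<k}. {..<k - Suc i}). f j i)"
    by (rule sum.reindex_bij_witness[where i = "\<lambda>(i, j). (Suc (i + j), i)" and j = "\<lambda>(i, j). (j, i - Suc j)"]) auto
  also have "\<dots> = (\<Sum>i<k. \<Sum>j<k - Suc i. f j i)"
    by (rule sum.Sigma[symmetric]) auto
  finally show ?thesis .
qed

text \<open>The two terms with \<open>b\<close> and \<open>c\<close> cancel those with \<open>Z\<^sub>1\<close> and \<open>Z\<^sub>2\<close>: this is why the currents have no central term.\<close>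

lemma cobracket_bracket: "cobracket n u (\<lambda>a b. bracket a b g) = 0"
proof -
  obtain x k a b where u: "u = ((x, k), a, b)" by (metis surj_pair)
  show ?thesis
    by (cases x; cases "a = b") (simp_all add: u)
qed

text \<open>Splitting \<open>u\<close> and then either factor leads to the same triple sum, over
  levels of total \<open>k - 2\<close>. The hypothesis on \<open>H\<close> moves the untouched
  factor past the two new ones; the parity shift makes the two ways of splitting cancel instead of
  agree.\<close>

lemma cobracket_coassoc:
  assumes H: "\<And>a b c. H c a b = akap c a * akap c b * H a b c"
  shows "cobracket n u (\<lambda>a b. asg a b * cobracket n a (\<lambda>c d. H b c d) +
     par_sign (gen_of a) * cobracket n b (\<lambda>c d. H a c d)) = 0"
proof -
  obtain x k a b where u: "u = ((x, k), a, b)" by (metis surj_pair)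
  define T where "T y1 y2 y3 = (\<Sum>i<k. \<Sum>j<k - Suc i. \<Sum>e<n. \<Sum>f<n.
     H ((y1, k - Suc (Suc (i + j))), a, f) ((y2, j), f, e) ((y3, i), e, b))" for y1 y2 y3
  have 1: "(\<Sum>i<k. \<Sum>e<n. cobracket n ((y, k - Suc i), a, e) (H ((z, i), e, b))) =
      cobracket_form y (\<lambda>y1 y2. kap z y1 * kap z y2 * T y1 y2 z)" for y z
  proof -
    have "(\<Sum>i<k. \<Sum>e<n. cobracket n ((y, k - Suc i), a, e) (H ((z, i), e, b))) =
      cobracket_form y (\<lambda>y1 y2. \<Sum>i<k. \<Sum>e<n. \<Sum>j<k - Suc i. \<Sum>f<n. kap z y1 * kap z y2 *
        H ((y1, k - Suc (Suc (i + j))), a, f) ((y2, j), f, e) ((z, i), e, b))"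
      unfolding cobracket.simps cobracket_form_sum by (subst H) simp
    also have "\<dots> = cobracket_form y (\<lambda>y1 y2. kap z y1 * kap z y2 * T y1 y2 z)"
      unfolding T_def sum_distrib_left
      by (intro cobracket_form_cong, rule sum.cong[OF refl], rule sum.swap)
    finally show ?thesis .
  qed
  have 2: "(\<Sum>i<k. \<Sum>e<n. cobracket n ((z, i), e, b) (H ((y, k - Suc i), a, e))) =
      cobracket_form z (\<lambda>z1 z2. T y z1 z2)" for y z
  proof -
    have "(\<Sum>i<k. \<Sum>e<n. \<Sum>j<i. \<Sum>f<n. H ((y, k - Suc i), a, e) ((z1, i - Suc j), e, f) ((z2, j), f, b)) = T y z1 z2" for z1 z2
    proof -
      have "(\<Sum>i<k. \<Sum>e<n. \<Sum>j<i. \<Sum>f<n. H ((y, k - Suc i), a, e) ((z1, i - Suc j), e, f) ((z2, j), f, b)) =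
        (\<Sum>i<k. \<Sum>j<i. \<Sum>e<n. \<Sum>f<n. H ((y, k - Suc i), a, e) ((z1, i - Suc j), e, f) ((z2, j), f, b))"
        by (rule sum.cong[OF refl], rule sum.swap)
      also have "\<dots> = (\<Sum>i<k. \<Sum>j<i. \<Sum>f<n. \<Sum>e<n. H ((y, k - Suc (Suc (i - Suc j + j))), a, e) ((z1, i - Suc j), e, f) ((z2, j), f, b))"
      proof (rule sum.cong[OF refl], rule sum.cong[OF refl])
        fix i j :: nat assume "j \<in> {..<i}"
        then have "Suc (Suc (i - Suc j + j)) = Suc i" by simp
        then show "(\<Sum>e<n. \<Sum>f<n. H ((y, k - Suc i), a, e) ((z1, i - Suc j), e, f) ((z2, j), f, b)) =
          (\<Sum>f<n. \<Sum>e<n. H ((y, k - Suc (Suc (i - Suc j + j))), a, e) ((z1, i - Suc j), e, f) ((z2, j), f, b))"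
          by (subst sum.swap) simp
      qed
      also have "\<dots> = T y z1 z2"
        unfolding T_def
        by (subst sum_triangle[of "\<lambda>p q. \<Sum>f<n. \<Sum>e<n. H ((y, k - Suc (Suc (p + q))), a, e) ((z1, p), e, f) ((z2, q), f, b)"])
          (simp add: add.commute)
      finally show ?thesis .
    qed
    then show ?thesis unfolding cobracket.simps cobracket_form_sum by simp
  qed
  have "cobracket n u (\<lambda>a b. asg a b * cobracket n a (\<lambda>c d. H b c d) +
     par_sign (gen_of a) * cobracket n b (\<lambda>c d. H a c d)) =
    cobracket_form x (\<lambda>y z. sg y z * cobracket_form y (\<lambda>y1 y2. kap z y1 * kap z y2 * T y1 y2 z) + par_sign y * cobracket_form z (\<lambda>z1 z2. T y z1 z2))"
    unfolding u cobracket.simps(1)[of n x] cobracket_form_sum gen_of.simps sum.distrib 1[symmetric] 2[symmetric] sum_distrib_left ..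
  then show ?thesis
    by (cases x) simp_all
qed

lemma cobracket_cong:
  assumes "small n u" "\<And>a b. small n a \<Longrightarrow> small n b \<Longrightarrow> F a b = G a b"
  shows "cobracket n u F = cobracket n u G"
proof -
  obtain x k a b where u: "u = ((x, k), a, b)" by (metis surj_pair)
  have "(\<Sum>i<k. \<Sum>e<n. F ((y, k - Suc i), a, e) ((z, i), e, b)) = (\<Sum>i<k. \<Sum>e<n. G ((y, k - Suc i), a, e) ((z, i), e, b))" for y z
    using assms by (intro sum.cong refl) (simp add: u)
  then show ?thesis unfolding u cobracket.simps cobracket_form_sum by simp
qed

text \<open>Each pair of factors has total parity opposite to its atom, so passing one pair through
  the other costs the sign of two exchanged currents.\<close>

lemma cobracket_kap:
  "cobracket n v (\<lambda>c d. cobracket n u (\<lambda>a b. akap c a * akap c b * akap d a * akap d b * F c d a b)) =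
   atg u v * cobracket n v (\<lambda>c d. cobracket n u (F c d))"
proof -
  obtain x k a b y l c d where u: "u = ((x, k), a, b)" "v = ((y, l), c, d)" by (metis surj_pair)
  show ?thesis
    unfolding u cobracket.simps cobracket_form_sum
    by (cases x; cases y) (simp_all add: sum_subtractf sum.distrib sum_negf algebra_simps)
qed

lemma ann_current:
  assumes "small n t"
  shows "ann t (current n u s) =
    (\<lambda>w. bracket u t (\<lambda>v. s (v # w)) + asg u t * current n u (ann t s) w)"
  using current_Cons[OF assms] by (simp add: ann_apply fun_eq_iff del: current.simps split_paired_All)

text \<open>On a non-empty word the new terms form the Jacobi identity. On the empty word each term
  reads two or four letters of \<open>s\<close>: the four-letter terms agree after exchanging the
  two cobrackets, and the two-letter terms form the cocycle condition.\<close>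

lemma current_current:
  assumes "symm s" "small n u" "small n v" "list_all (small n) w"
  shows "current n u (current n v s) w - atg u v * current n v (current n u s) w +
    asg u v * bracket u v (\<lambda>a. current n a s w) = 0"
  using assms(1,4)
proof (induction w arbitrary: s)
  case Nil
  have H: "s [c, d, a, b] = akap a c * akap a d * akap b c * akap b d * s [a, b, c, d]" for a b c d
  proof -
    have "s [c, d, a, b] = akap d a * s [c, a, d, b]"
      using symmD[OF Nil(1), of "[c]" d a "[b]"] by simp
    also have "s [c, a, d, b] = akap c a * s [a, c, d, b]"
      using symmD[OF Nil(1), of "[]" c a "[d, b]"] by simp
    also have "s [a, c, d, b] = akap d b * s [a, c, b, d]"
      using symmD[OF Nil(1), of "[a, c]" d b "[]"] by simp
    also have "s [a, c, b, d] = akap c b * s [a, b, c, d]"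
      using symmD[OF Nil(1), of "[a]" c b "[d]"] by simp
    finally show ?thesis by (simp add: kap_sym)
  qed
  have F: "s [a, b] = akap a b * s [b, a]" for a b
    using symm_swap[OF Nil(1), of a b "[]"] .
  have E: "current n u (current n v s) [] =
    cobracket n u (\<lambda>a b. bracket v a (\<lambda>w. s [w, b]) + asg v a * bracket v b (\<lambda>w. s [a, w])) +
    atg u v * cobracket n u (\<lambda>a b. cobracket n v (\<lambda>c d. s [a, b, c, d]))"
    if "small n u" "small n v" for u v
  proof -
    have "current n u (current n v s) [] = cobracket n u (\<lambda>a b. current n v s [a, b])"
      by (rule current_Nil)
    also have "\<dots> = cobracket n u (\<lambda>a b. (bracket v a (\<lambda>w. s [w, b]) + asg v a * bracket v b (\<lambda>w. s [a, w])) +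
        asg v a * (asg v b * cobracket n v (\<lambda>c d. s [a, b, c, d])))"
    proof (rule cobracket_cong[OF that(1)])
      fix a b assume "small n a" "small n b"
      then show "current n v s [a, b] = (bracket v a (\<lambda>w. s [w, b]) + asg v a * bracket v b (\<lambda>w. s [a, w])) +
        asg v a * (asg v b * cobracket n v (\<lambda>c d. s [a, b, c, d]))"
        by (simp only: current_Cons current_Nil ann_apply distrib_left add.assoc)
    qed
    finally show ?thesis unfolding cobracket_add cobracket_signs .
  qed
  have "cobracket n u (\<lambda>a b. cobracket n v (\<lambda>c d. s [a, b, c, d])) = atg u v * cobracket n v (\<lambda>c d. cobracket n u (\<lambda>a b. s [c, d, a, b]))"
  proof -
    have "cobracket n u (\<lambda>a b. cobracket n v (\<lambda>c d. s [a, b, c, d])) = cobracket n v (\<lambda>c d. cobracket n u (\<lambda>a b. s [a, b, c, d]))"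
      by (rule cobracket_commute)
    also have "\<dots> = cobracket n v (\<lambda>c d. cobracket n u (\<lambda>a b. akap c a * akap c b * akap d a * akap d b * s [c, d, a, b]))"
      by (subst H) (rule refl)
    also have "\<dots> = atg u v * cobracket n v (\<lambda>c d. cobracket n u (\<lambda>a b. s [c, d, a, b]))"
      by (rule cobracket_kap)
    finally show ?thesis .
  qed
  moreover have "atg v u = atg u v" "atg u v * atg u v = 1"
    by auto
  moreover have "bracket u v (\<lambda>a. current n a s []) = bracket u v (\<lambda>a. cobracket n a (\<lambda>c d. s [c, d]))"
    unfolding current_Nil ..
  moreover have "cobracket n u (\<lambda>a b. bracket v a (\<lambda>w. s [w, b]) + asg v a * bracket v b (\<lambda>w. s [a, w])) -
     atg u v * cobracket n v (\<lambda>a b. bracket u a (\<lambda>w. s [w, b]) + asg u a * bracket u b (\<lambda>w. s [a, w])) +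
     asg u v * bracket u v (\<lambda>w. cobracket n w (\<lambda>c d. s [c, d])) = 0"
    using cobracket_cocycle[of "\<lambda>a b. s [a, b]", OF F assms(2,3)] by simp
  ultimately show ?case
    unfolding E[OF assms(2,3)] E[OF assms(3,2)] by algebra
next
  case (Cons t w)
  then have t: "small n t" and w: "list_all (small n) w" by simp_all
  have E: "current n u (current n v s) (t # w) =
      bracket u t (\<lambda>a. bracket v a (\<lambda>b. s (b # w))) +
      atg u v * asg v t * bracket u t (\<lambda>a. current n v (ann a s) w) +
      asg u t * (bracket v t (\<lambda>a. current n u (ann a s) w) +
        asg v t * current n u (current n v (ann t s)) w)"
    if "small n u" "small n v" for u v
  proof -
    have "bracket u t (\<lambda>a. current n v s (a # w)) =
      bracket u t (\<lambda>a. bracket v a (\<lambda>b. s (b # w)) + asg v a * current n v (ann a s) w)"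
      by (rule bracket_cong[OF that(1) t]) (rule current_Cons)
    moreover have "current n u (ann t (current n v s)) w =
       bracket v t (\<lambda>a. current n u (ann a s) w) + asg v t * current n u (current n v (ann t s)) w"
      unfolding ann_current[OF t] linear_op_add[OF linear_op_current] linear_op_scale[OF linear_op_current]
        linear_op_bracket[OF linear_op_current] unfolding ann_def ..
    ultimately show ?thesis
      unfolding current_Cons[OF t, of u "current n v s"] bracket_add bracket_signs by simp
  qed
  have B: "bracket u v (\<lambda>a. current n a s (t # w)) = bracket u v (\<lambda>a. bracket a t (\<lambda>b. s (b # w))) +
     asg u t * asg v t * bracket u v (\<lambda>a. current n a (ann t s) w)"
    unfolding current_Cons[OF t] bracket_add bracket_signs ..
  have IH: "current n u (current n v (ann t s)) w - atg u v * current n v (current n u (ann t s)) w +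
    asg u v * bracket u v (\<lambda>a. current n a (ann t s) w) = 0"
    by (rule Cons.IH) (use Cons.prems w in simp_all)
  have J: "bracket u t (\<lambda>a. bracket v a (\<lambda>b. s (b # w))) - atg u v * bracket v t (\<lambda>a. bracket u a (\<lambda>b. s (b # w))) =
     - asg u v * bracket u v (\<lambda>a. bracket a t (\<lambda>b. s (b # w)))"
    by (rule bracket_jacobi)
  have "atg v u = atg u v" "atg u v * atg u v = 1"
    by auto
  with IH J show ?case
    unfolding E[OF assms(2,3)] E[OF assms(3,2)] B by algebra
qed

lemma ann_brst:
  assumes "symm s" "small n u"
  shows "ann u (brst n s) = (\<lambda>w. current n u s w + par_sign (gen_of u) * brst n (ann u s) w)"
  using brst_Cons[OF assms] by (simp add: ann_apply fun_eq_iff)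

lemma brst_Nil: "brst n s [] = 0"
  by (simp add: brst_def cubic_def)

text \<open>The displayed decomposition is a certificate: the first hypothesis enters with the
  factor \<open>x * q\<close>, the second with \<open>x\<close>, and the sign relations absorb the
  remaining multiples of \<open>y\<close> and \<open>z\<close>.\<close>

lemma current_brst_aux:
  fixes x y z t p q r c d :: complex
  assumes "r + p * d = 0" "c - t * z + x * y = 0" "t * x = - p" "x * x = 1"
  shows "y + - p * q * e + x * (c + q * r) + p * (z + q * (e + x * d)) = 0"
proof -
  have "y + - p * q * e + x * (c + q * r) + p * (z + q * (e + x * d)) =
      x * q * (r + p * d) + x * (c - t * z + x * y) + (1 - x * x) * y + (t * x + p) * z"
    by (simp add: algebra_simps)
  then show ?thesis using assms by simp
qed

text \<open>The current has parity opposite to \<open>v\<close> and \<open>brst\<close> is odd, so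
  this is their graded commutator. On the empty word the one-letter terms are the bracket of the
  cobracket and the three-letter terms are coassociativity. In the induction step, reading
  \<open>t\<close> off \<open>brst\<close> produces the current of \<open>t\<close>, so the relation
  between two currents enters.\<close>

lemma current_brst:
  assumes "symm s" "small n v" "list_all (small n) w"
  shows "current n v (brst n s) w + par_sign (gen_of v) * brst n (current n v s) w = 0"
  using assms(1,3)
proof (induction w arbitrary: s)
  case Nil
  have "current n v (brst n s) [] = cobracket n v (\<lambda>a b. brst n s [a, b])"
    by (rule current_Nil)
  also have "\<dots> = cobracket n v (\<lambda>a b. bracket a b (\<lambda>c. s [c]) + (asg a b * cobracket n a (\<lambda>c d. s [b, c, d]) +
      par_sign (gen_of a) * cobracket n b (\<lambda>c d. s [a, c, d])))"
  proof (rule cobracket_cong[OF assms(2)])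
    fix a b assume "small n a" "small n b"
    then show "brst n s [a, b] = bracket a b (\<lambda>c. s [c]) + (asg a b * cobracket n a (\<lambda>c d. s [b, c, d]) +
      par_sign (gen_of a) * cobracket n b (\<lambda>c d. s [a, c, d]))"
      by (simp only: brst_Cons[OF Nil(1)] brst_Cons[OF symm_ann[OF Nil(1)]] current_Cons current_Nil ann_apply brst_Nil
          mult_zero_right add_0_right add.assoc)
  qed
  also have "\<dots> = 0"
  proof -
    have H: "s [c, a, b] = akap c a * akap c b * s [a, b, c]" for a b c
      using symmD[OF Nil(1), of "[]" c a "[b]"] symmD[OF Nil(1), of "[a]" c b "[]"] by simp
    show ?thesis
      using cobracket_coassoc[of "\<lambda>a b c. s [a, b, c]" n v, OF H] unfolding cobracket_add cobracket_bracket by (simp only: add_0_left)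
  qed
  finally show ?case by (simp add: brst_Nil)
next
  case (Cons t w)
  then have t: "small n t" and w: "list_all (small n) w" by simp_all
  note sc = symm_current[OF Cons.prems(1)]
  have 1: "current n v (brst n s) (t # w) = bracket v t (\<lambda>a. current n a s w + par_sign (gen_of a) * brst n (ann a s) w) +
      asg v t * (current n v (current n t s) w + par_sign (gen_of t) * current n v (brst n (ann t s)) w)"
  proof -
    have "bracket v t (\<lambda>a. brst n s (a # w)) = bracket v t (\<lambda>a. current n a s w + par_sign (gen_of a) * brst n (ann a s) w)"
      by (rule bracket_cong[OF assms(2) t]) (rule brst_Cons[OF Cons.prems(1)])
    then show ?thesis
      unfolding current_Cons[OF t, of v "brst n s"] ann_brst[OF Cons.prems(1) t]
        linear_op_add[OF linear_op_current] linear_op_scale[OF linear_op_current] by simp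
  qed
  have 2: "brst n (current n v s) (t # w) = current n t (current n v s) w +
      par_sign (gen_of t) * (bracket v t (\<lambda>a. brst n (ann a s) w) + asg v t * brst n (current n v (ann t s)) w)"
    unfolding brst_Cons[OF sc t] ann_current[OF t] linear_op_add[OF linear_op_brst] linear_op_scale[OF linear_op_brst]
      linear_op_bracket[OF linear_op_brst] unfolding ann_def ..
  have 3: "bracket v t (\<lambda>a. par_sign (gen_of a) * brst n (ann a s) w) = - par_sign (gen_of v) * par_sign (gen_of t) * bracket v t (\<lambda>a. brst n (ann a s) w)"
    by (rule bracket_signs)
  have IH: "current n v (brst n (ann t s)) w + par_sign (gen_of v) * brst n (current n v (ann t s)) w = 0"
    by (rule Cons.IH) (use Cons.prems w in simp_all)
  have C: "current n v (current n t s) w - atg v t * current n t (current n v s) w +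
    asg v t * bracket v t (\<lambda>a. current n a s w) = 0"
    by (rule current_current[OF Cons.prems(1) assms(2) t w])
  have S: "atg v t * asg v t = - par_sign (gen_of v)" "asg v t * asg v t = 1"
    by (cases "gen_of v"; cases "gen_of t"; simp)+
  show ?case
    unfolding 1 2 bracket_add 3 by (rule current_brst_aux[OF IH C S])
qed

text \<open>Reading a letter \<open>u\<close> off the square leaves the graded commutator of
  \<open>brst\<close> with the current of \<open>u\<close>, and the square on a shorter
  word.\<close>

lemma brst_brst:
  assumes "symm s" "list_all (small n) w"
  shows "brst n (brst n s) w = 0"
  using assms
proof (induction w arbitrary: s)
  case (Cons u w)
  then have u: "small n u" and w: "list_all (small n) w" by simp_all
  have p: "par_sign (gen_of u) * par_sign (gen_of u) = 1" by (cases "gen_of u") simp_all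
  have "brst n (brst n s) (u # w) = current n u (brst n s) w +
      par_sign (gen_of u) * (brst n (current n u s) w + par_sign (gen_of u) * brst n (brst n (ann u s)) w)"
    unfolding brst_Cons[OF symm_brst[OF Cons.prems(1)] u] ann_brst[OF Cons.prems(1) u]
      linear_op_add[OF linear_op_brst] linear_op_scale[OF linear_op_brst] ..
  also have "brst n (brst n (ann u s)) w = 0"
    by (rule Cons.IH) (use Cons.prems w in simp_all)
  finally show ?case
    using current_brst[OF Cons.prems(1) u w] by simp
qed (simp add: brst_Nil)

section \<open>Koszul signs of permutations and symmetrized words\<close>

section \<open>Symmetrization\<close>

definition psgn :: "(nat \<Rightarrow> nat) \<Rightarrow> atom list \<Rightarrow> complex" where
  "psgn \<pi> w = (\<Prod>(i, j) \<in> {(i, j). i < j \<and> j < length w \<and> \<pi> i > \<pi> j}. kap (gen_of (w ! i)) (gen_of (w ! j)))"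

definition plist :: "(nat \<Rightarrow> nat) \<Rightarrow> 'a list \<Rightarrow> 'a list" where
  "plist \<pi> w = map (\<lambda>j. w ! inv \<pi> j) [0..<length w]"

lemma length_plist [simp]: "length (plist \<pi> w) = length w"
  by (simp add: plist_def)

lemma nth_plist: "\<pi> permutes {..<length w} \<Longrightarrow> i < length w \<Longrightarrow> plist \<pi> w ! \<pi> i = w ! i"
  using permutes_in_image[of \<pi> "{..<length w}" i] by (simp add: plist_def permutes_inverses(2))

lemma inv_lt: "\<pi> permutes {..<m} \<Longrightarrow> i < m \<Longrightarrow> inv \<pi> i < m"
  using permutes_in_image[OF permutes_inv, of \<pi> "{..<m}" i] by simp

lemma plist_comp:
  assumes "\<pi> permutes {..<length w}" "\<sigma> permutes {..<length w}"
  shows "plist (\<pi> \<circ> \<sigma>) w = plist \<pi> (plist \<sigma> w)"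
proof (rule nth_equalityI)
  fix j assume j: "j < length (plist (\<pi> \<circ> \<sigma>) w)"
  have "inv (\<pi> \<circ> \<sigma>) j = inv \<sigma> (inv \<pi> j)"
    using o_inv_distrib[OF permutes_bij[OF assms(1)] permutes_bij[OF assms(2)]] by simp
  then show "plist (\<pi> \<circ> \<sigma>) w ! j = plist \<pi> (plist \<sigma> w) ! j"
    using j inv_lt[OF assms(1)] by (simp add: plist_def)
qed simp

lemma plist_id [simp]: "plist id w = w"
  by (simp add: plist_def map_nth)

definition pairs :: "nat \<Rightarrow> (nat \<times> nat) set" where
  "pairs m = {(i, j). i < j \<and> j < m}"

lemma finite_pairs [simp]: "finite (pairs m)"
  by (rule finite_subset[of _ "{..<m} \<times> {..<m}"]) (auto simp: pairs_def)

lemma psgn_pairs: "psgn \<pi> w = (\<Prod>(i, j)\<in>pairs (length w). if \<pi> j < \<pi> i then kap (gen_of (w ! i)) (gen_of (w ! j)) else 1)"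
proof -
  have "{(i, j). i < j \<and> j < length w \<and> \<pi> i > \<pi> j} = {p \<in> pairs (length w). \<pi> (snd p) < \<pi> (fst p)}"
    by (auto simp: pairs_def)
  then show ?thesis
    unfolding psgn_def by (simp add: prod.inter_filter case_prod_beta)
qed

text \<open>A pair is inverted by the composite exactly when one but not both of the permutations
  inverts it, and a sign occurring twice is 1. The positions of the permuted word are pulled back
  along \<open>\<sigma>\<close>, with \<open>min\<close> and \<open>max\<close> restoring their
  order.\<close>

lemma psgn_comp:
  assumes \<pi>: "\<pi> permutes {..<length w}" and \<sigma>: "\<sigma> permutes {..<length w}"
  shows "psgn (\<pi> \<circ> \<sigma>) w = psgn \<sigma> w * psgn \<pi> (plist \<sigma> w)"
proof -
  let ?m = "length w" and ?v = "plist \<sigma> w"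
  let ?f = "\<lambda>(i, j). (min (\<sigma> i) (\<sigma> j), max (\<sigma> i) (\<sigma> j))" and ?b = "\<lambda>(a, b). (min (inv \<sigma> a) (inv \<sigma> b), max (inv \<sigma> a) (inv \<sigma> b))"
  define k where "k i j = kap (gen_of (w ! i)) (gen_of (w ! j))" for i j
  let ?g = "\<lambda>(i, j). if (\<sigma> i < \<sigma> j) \<noteq> (\<pi> (\<sigma> i) < \<pi> (\<sigma> j)) then k i j else 1"
  have inj: "\<sigma> i = \<sigma> j \<longleftrightarrow> i = j" "\<pi> i = \<pi> j \<longleftrightarrow> i = j" for i j
    using permutes_inj[OF \<sigma>] permutes_inj[OF \<pi>] by (auto dest: injD)
  have lt: "\<sigma> i < ?m \<longleftrightarrow> i < ?m" for i using permutes_in_image[OF \<sigma>, of i] by simp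
  have "psgn \<pi> ?v = (\<Prod>p\<in>pairs ?m. ?g p)"
    unfolding psgn_pairs length_plist
  proof (rule sym, rule prod.reindex_bij_witness[where i = ?b and j = ?f])
    fix p assume p: "p \<in> pairs ?m"
    obtain i j where ij: "p = (i, j)" "i < j" "j < ?m" using p by (auto simp: pairs_def)
    have ne: "\<sigma> i \<noteq> \<sigma> j" using ij inj by simp
    have iv: "inv \<sigma> (\<sigma> x) = x" for x by (rule permutes_inverses(2)[OF \<sigma>])
    show "(?b (?f p)) = p"
      using ij iv by (auto simp: min_def max_def)
    show "(?f p) \<in> pairs ?m"
      using ij ne lt by (auto simp: pairs_def min_def max_def)
    have n: "?v ! \<sigma> i = w ! i" "?v ! \<sigma> j = w ! j" using nth_plist[OF \<sigma>] ij by auto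
    show "(case ?f p of (i, j) \<Rightarrow> if \<pi> j < \<pi> i then kap (gen_of (?v ! i)) (gen_of (?v ! j)) else 1) =
      (?g p)"
    proof (cases "\<sigma> i < \<sigma> j")
      case True
      moreover have "\<pi> (\<sigma> j) < \<pi> (\<sigma> i) \<longleftrightarrow> \<not> \<pi> (\<sigma> i) < \<pi> (\<sigma> j)" using inj ij by (metis linorder_neqE_nat not_less_iff_gr_or_eq)
      ultimately show ?thesis by (simp add: ij n k_def min_def max_def)
    next
      case False
      with ne have "\<sigma> j < \<sigma> i" by simp
      then show ?thesis using n by (simp add: ij k_def min_def max_def kap_sym)
    qed
  next
    fix p assume "p \<in> pairs ?m"
    then obtain a b where ab: "p = (a, b)" "a < b" "b < ?m" by (auto simp: pairs_def)
    have vi: "\<sigma> (inv \<sigma> x) = x" for x by (rule permutes_inverses(1)[OF \<sigma>])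
    have ne: "inv \<sigma> a \<noteq> inv \<sigma> b" using ab vi by (metis less_irrefl)
    show "(?f (?b p)) = p"
      using ab vi by (auto simp: min_def max_def)
    show "(?b p) \<in> pairs ?m"
      using ab ne inv_lt[OF \<sigma>, of a] inv_lt[OF \<sigma>, of b] by (auto simp: pairs_def min_def max_def)
  qed
  moreover have "psgn (\<pi> \<circ> \<sigma>) w = (\<Prod>p\<in>pairs ?m. (case p of (i, j) \<Rightarrow> if \<sigma> j < \<sigma> i then k i j else 1) *
     (?g p))"
    unfolding psgn_pairs
  proof (rule prod.cong[OF refl])
    fix p assume "p \<in> pairs ?m"
    then obtain i j where ij: "p = (i, j)" "i < j" by (auto simp: pairs_def)
    then have "\<sigma> j < \<sigma> i \<longleftrightarrow> \<not> \<sigma> i < \<sigma> j" "\<pi> (\<sigma> j) < \<pi> (\<sigma> i) \<longleftrightarrow> \<not> \<pi> (\<sigma> i) < \<pi> (\<sigma> j)"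
      using inj[of i j] inj(2)[of "\<sigma> i" "\<sigma> j"] by linarith+
    then show "(case p of (i, j) \<Rightarrow> if (\<pi> \<circ> \<sigma>) j < (\<pi> \<circ> \<sigma>) i then kap (gen_of (w ! i)) (gen_of (w ! j)) else 1) =
      (case p of (i, j) \<Rightarrow> if \<sigma> j < \<sigma> i then k i j else 1) *
      (?g p)"
      by (simp add: ij k_def)
  qed
  ultimately show ?thesis
    unfolding prod.distrib psgn_pairs[of \<sigma>] k_def by simp
qed

lemma psgn_sq: "psgn \<pi> w * psgn \<pi> w = 1"
proof -
  have "psgn \<pi> w * psgn \<pi> w = (\<Prod>p\<in>pairs (length w). 1)"
    unfolding psgn_pairs prod.distrib[symmetric] by (intro prod.cong refl) auto
  then show ?thesis by simp
qed

lemma psgn_id [simp]: "psgn id w = 1"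
  unfolding psgn_pairs by (intro prod.neutral) (auto simp: pairs_def)

lemma transpose_permutes: "i < m \<Longrightarrow> j < m \<Longrightarrow> transpose i j permutes {..<m}"
  by (rule permutes_swap_id) simp_all

lemma plist_adjacent:
  "plist (transpose (length p) (Suc (length p))) (p @ x # y # v) = p @ y # x # v"
proof (rule nth_equalityI)
  fix i assume i: "i < length (plist (transpose (length p) (Suc (length p))) (p @ x # y # v))"
  have inv: "inv (transpose (length p) (Suc (length p))) = transpose (length p) (Suc (length p))"
    by (rule inv_equality) (simp_all add: transpose_def)
  consider "i < length p" | "i = length p" | "i = Suc (length p)" | k where "i = Suc (Suc (length p + k))"
    by (metis add_Suc_right less_imp_Suc_add linorder_neqE_nat not_less_eq)
  then show "plist (transpose (length p) (Suc (length p))) (p @ x # y # v) ! i = (p @ y # x # v) ! i"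
    using i by cases (auto simp: plist_def inv nth_append transpose_def simp del: upt_Suc)
qed simp

lemma psgn_adjacent:
  "psgn (transpose (length p) (Suc (length p))) (p @ x # y # v) = akap x y"
proof -
  have "{(i, j). i < j \<and> j < length (p @ x # y # v) \<and> transpose (length p) (Suc (length p)) i > transpose (length p) (Suc (length p)) j}
      = {(length p, Suc (length p))}"
    by (auto simp: transpose_def split: if_splits)
  then show ?thesis unfolding psgn_def by (simp add: nth_append)
qed

definition psymm :: "fock \<Rightarrow> bool" where
  "psymm s \<longleftrightarrow> (\<forall>w \<pi>. \<pi> permutes {..<length w} \<longrightarrow> s (plist \<pi> w) = psgn \<pi> w * s w)"

lemma psymm_symm: "psymm s \<Longrightarrow> symm s"
proof (rule symmI)
  fix p x y v assume "psymm s"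
  then have "s (plist (transpose (length p) (Suc (length p))) (p @ y # x # v)) =
      psgn (transpose (length p) (Suc (length p))) (p @ y # x # v) * s (p @ y # x # v)"
    unfolding psymm_def using transpose_permutes[of "length p" _ "Suc (length p)"] by simp
  then show "s (p @ x # y # v) = akap x y * s (p @ y # x # v)"
    unfolding plist_adjacent psgn_adjacent by (simp add: kap_sym)
qed

text \<open>The permutations obeying the sign rule are closed under composition and contain the
  adjacent transpositions. A longer transposition is a conjugate of a shorter one by an adjacent
  one, and transpositions generate everything.\<close>

lemma symm_psymm:
  assumes "symm s"
  shows "psymm s"
proof -
  define good where "good m \<pi> \<longleftrightarrow> \<pi> permutes {..<m} \<and> (\<forall>w. length w = m \<longrightarrow> s (plist \<pi> w) = psgn \<pi> w * s w)" for m \<pi>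
  have id: "good m id" for m by (simp add: good_def permutes_id)
  have comp: "good m (\<pi> \<circ> \<sigma>)" if "good m \<pi>" "good m \<sigma>" for m \<pi> \<sigma>
    using that by (auto simp: good_def permutes_compose plist_comp psgn_comp)
  have adj: "good m (transpose i (Suc i))" if "Suc i < m" for i m
  proof -
    have "s (plist (transpose i (Suc i)) w) = psgn (transpose i (Suc i)) w * s w" if l: "length w = m" for w
    proof -
      obtain p x y v where w: "w = p @ x # y # v" "length p = i"
      proof
        show "w = take i w @ w ! i # w ! Suc i # drop (Suc (Suc i)) w"
          using \<open>Suc i < m\<close> l by (simp add: Cons_nth_drop_Suc)
        show "length (take i w) = i" using \<open>Suc i < m\<close> l by simp
      qed
      show ?thesis
        unfolding w(1) using symmD[OF assms, of p y x v]
        unfolding plist_adjacent[of p x y v, unfolded w(2)] psgn_adjacent[of p x y v, unfolded w(2)]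
        by (simp add: kap_sym)
    qed
    then show ?thesis using that by (simp add: good_def transpose_permutes)
  qed
  have "good m (transpose i (i + Suc d))" if "i + Suc d < m" for i d m
    using that
  proof (induction d)
    case 0
    then show ?case using adj[of i m] by simp
  next
    case (Suc d)
    have "transpose i (i + Suc (Suc d)) = transpose (i + Suc d) (Suc (i + Suc d)) \<circ> (transpose i (i + Suc d) \<circ> transpose (i + Suc d) (Suc (i + Suc d)))"
      by (auto simp: transpose_def fun_eq_iff)
    moreover have "good m (transpose (i + Suc d) (Suc (i + Suc d)) \<circ> (transpose i (i + Suc d) \<circ> transpose (i + Suc d) (Suc (i + Suc d))))"
      by (intro comp adj Suc.IH) (use Suc.prems in simp_all)
    ultimately show ?case by (simp only:)
  qed
  then have tr: "good m (transpose i j)" if "i < m" "j < m" for i j m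
    using that
  proof (induction i j rule: linorder_wlog)
    case (le i j)
    show ?case
    proof (cases "i = j")
      case False
      with le obtain d where "j = i + Suc d" by (metis less_imp_Suc_add add_Suc_right le_neq_implies_less)
      with le show ?thesis by simp
    qed (simp add: id[unfolded id_def])
  next
    case (sym i j)
    then show ?case by (simp add: transpose_commute)
  qed
  have "good m \<pi>" if "\<pi> permutes {..<m}" for m \<pi>
    using that finite_lessThan[of m]
  proof (induction rule: permutes_induct)
    case (swap a b p)
    then show ?case by (intro comp tr) simp_all
  qed (simp_all add: id[unfolded id_def])
  then show ?thesis by (simp add: psymm_def good_def)
qed

text \<open>The function attached to the symmetrized basis tensor \<open>w\<close>: the denominator
  in the symmetrizer is cancelled by the factorial in the normalization of coefficients.\<close>

definition psum :: "atom list \<Rightarrow> fock" where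
  "psum w v = (\<Sum>\<pi> | \<pi> permutes {..<length w}. psgn \<pi> w * of_bool (plist \<pi> w = v))"

lemma psum_length: "length v \<noteq> length w \<Longrightarrow> psum w v = 0"
  unfolding psum_def by (intro sum.neutral) (auto dest: arg_cong[where f = length])

lemma plist_inj:
  assumes "\<pi> permutes {..<length w}" "length v = length w" "plist \<pi> w = plist \<pi> v"
  shows "w = v"
proof (rule nth_equalityI)
  fix i assume "i < length w"
  then show "w ! i = v ! i" using assms nth_plist[of \<pi> w i] nth_plist[of \<pi> v i] by simp
qed (simp add: assms)

lemma psymm_psum: "psymm (psum w)"
  unfolding psymm_def
proof (intro allI impI)
  fix v :: "atom list" and \<sigma> assume \<sigma>: "\<sigma> permutes {..<length v}"
  show "psum w (plist \<sigma> v) = psgn \<sigma> v * psum w v"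
  proof (cases "length v = length w")
    case True
    with \<sigma> have \<sigma>': "\<sigma> permutes {..<length w}" by simp
    have "psum w (plist \<sigma> v) = (\<Sum>\<pi> | \<pi> permutes {..<length w}. psgn (\<sigma> \<circ> \<pi>) w * of_bool (plist (\<sigma> \<circ> \<pi>) w = plist \<sigma> v))"
      unfolding psum_def by (rule setum_permutations_compose_left[OF \<sigma>'])
    also have "\<dots> = (\<Sum>\<pi> | \<pi> permutes {..<length w}. psgn \<sigma> v * (psgn \<pi> w * of_bool (plist \<pi> w = v)))"
    proof (intro sum.cong refl)
      fix \<pi> assume "\<pi> \<in> {\<pi>. \<pi> permutes {..<length w}}"
      then have \<pi>: "\<pi> permutes {..<length w}" by simp
      have "plist \<sigma> (plist \<pi> w) = plist \<sigma> v \<longleftrightarrow> plist \<pi> w = v"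
        using plist_inj[of \<sigma> "plist \<pi> w" v] \<sigma>' True by auto
      then show "psgn (\<sigma> \<circ> \<pi>) w * of_bool (plist (\<sigma> \<circ> \<pi>) w = plist \<sigma> v) = psgn \<sigma> v * (psgn \<pi> w * of_bool (plist \<pi> w = v))"
        by (auto simp: psgn_comp[OF \<sigma>' \<pi>] plist_comp[OF \<sigma>' \<pi>])
    qed
    finally show ?thesis by (simp add: psum_def sum_distrib_left)
  qed (simp add: psum_length)
qed

text \<open>Inverting permutations exchanges the roles of \<open>w\<close> and \<open>v\<close> and
  preserves the sign, which is its own inverse.\<close>

lemma psum_commute: "psum w v = psum v w"
proof (cases "length v = length w")
  case True
  have "psum w v = (\<Sum>\<pi> | \<pi> permutes {..<length w}. psgn (inv \<pi>) w * of_bool (plist (inv \<pi>) w = v))"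
    unfolding psum_def by (rule sum_permutations_inverse)
  also have "\<dots> = (\<Sum>\<pi> | \<pi> permutes {..<length w}. psgn \<pi> v * of_bool (plist \<pi> v = w))"
  proof (intro sum.cong refl)
    fix \<pi> assume "\<pi> \<in> {\<pi>. \<pi> permutes {..<length w}}"
    then have p: "\<pi> permutes {..<length w}" "inv \<pi> permutes {..<length w}" by (simp_all add: permutes_inv)
    have c: "\<pi> \<circ> inv \<pi> = id" "inv \<pi> \<circ> \<pi> = id" using permutes_inv_o[OF p(1)] by simp_all
    show "psgn (inv \<pi>) w * of_bool (plist (inv \<pi>) w = v) = psgn \<pi> v * of_bool (plist \<pi> v = w)"
    proof (cases "plist (inv \<pi>) w = v")
      case eq: True
      then have "plist \<pi> v = w" using plist_comp[OF p] c by simp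
      moreover have "1 = psgn (inv \<pi>) w * psgn \<pi> v" using psgn_comp[OF p] c eq by simp
      then have "psgn (inv \<pi>) w * (psgn \<pi> v * psgn \<pi> v) = psgn \<pi> v" by (simp flip: mult.assoc)
      then have "psgn (inv \<pi>) w = psgn \<pi> v" by (simp add: psgn_sq)
      ultimately show ?thesis using eq by simp
    next
      case False
      moreover have "plist \<pi> v \<noteq> w"
      proof
        assume "plist \<pi> v = w"
        moreover have "plist (inv \<pi> \<circ> \<pi>) v = plist (inv \<pi>) (plist \<pi> v)"
          by (rule plist_comp) (simp_all only: True p)
        ultimately have "v = plist (inv \<pi>) w" unfolding c by simp
        with False show False by simp
      qed
      ultimately show ?thesis by simp
    qed
  qed
  finally show ?thesis by (simp add: psum_def True)
qed (simp add: psum_length)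

text \<open>Each permutation contributes \<open>s w\<close>, because its sign occurs twice. Up to
  the factorial, \<open>psum\<close> is a reproducing kernel for symmetric functions.\<close>

lemma sum_psum:
  assumes "symm s" "finite V" "\<And>\<pi>. \<pi> permutes {..<length w} \<Longrightarrow> plist \<pi> w \<in> V"
  shows "(\<Sum>v\<in>V. psum w v * s v) = fact (length w) * s w"
proof -
  have "(\<Sum>v\<in>V. psum w v * s v) = (\<Sum>\<pi> | \<pi> permutes {..<length w}. \<Sum>v\<in>V. psgn \<pi> w * of_bool (plist \<pi> w = v) * s v)"
    unfolding psum_def sum_distrib_right by (rule sum.swap)
  also have "\<dots> = (\<Sum>\<pi> | \<pi> permutes {..<length w}. s w)"
  proof (intro sum.cong refl)
    fix \<pi> assume "\<pi> \<in> {\<pi>. \<pi> permutes {..<length w}}"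
    then have p: "\<pi> permutes {..<length w}" by simp
    have "(\<Sum>v\<in>V. psgn \<pi> w * of_bool (plist \<pi> w = v) * s v) = (\<Sum>v\<in>V. if v = plist \<pi> w then psgn \<pi> w * s v else 0)"
      by (intro sum.cong refl) auto
    also have "\<dots> = psgn \<pi> w * s (plist \<pi> w)" using assms(2,3) p by simp
    also have "\<dots> = s w"
      using symm_psymm[OF assms(1)] p psgn_sq[of \<pi> w] by (simp add: psymm_def flip: mult.assoc)
    finally show "(\<Sum>v\<in>V. psgn \<pi> w * of_bool (plist \<pi> w = v) * s v) = s w" .
  qed
  also have "\<dots> = fact (length w) * s w"
    by (simp add: card_permutations[of _ "length w"])
  finally show ?thesis .
qed

lemma set_plist: "\<pi> permutes {..<length w} \<Longrightarrow> set (plist \<pi> w) \<subseteq> set w"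
  using inv_lt[of \<pi> "length w"] by (auto simp: plist_def)

definition words :: "'a set \<Rightarrow> nat \<Rightarrow> 'a list set" where
  "words L m = {v. set v \<subseteq> L \<and> length v = m}"

lemma finite_words: "finite L \<Longrightarrow> finite (words L m)"
  unfolding words_def by (rule finite_lists_length_eq)

lemma sum_words_Suc:
  fixes f :: "'a list \<Rightarrow> complex"
  shows "(\<Sum>v\<in>words L (Suc m). f v) = (\<Sum>x\<in>L. \<Sum>v\<in>words L m. f (x # v))"
proof -
  have "words L (Suc m) = (\<lambda>(x, v). x # v) ` (L \<times> words L m)"
    by (auto simp: words_def length_Suc_conv image_iff)
  then have "(\<Sum>v\<in>words L (Suc m). f v) = (\<Sum>p\<in>L \<times> words L m. f (fst p # snd p))"
    by (simp add: sum.reindex inj_on_def case_prod_beta o_def)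
  then show ?thesis by (simp add: sum.cartesian_product case_prod_beta)
qed

text \<open>Creators and prefix operators are adjoint up to a factor: \<open>u\<close> can be
  inserted at \<open>m + 1\<close> positions, and the symmetry of \<open>G\<close> moves it to the
  front with a sign that cancels the one in \<open>cre\<close>.\<close>

lemma sum_cre:
  assumes "finite L" "u \<in> L" "symm G"
  shows "(\<Sum>v\<in>words L (Suc m). G v * cre u s v) = of_nat (Suc m) * (\<Sum>v\<in>words L m. G (u # v) * s v)"
  using assms(3)
proof (induction m arbitrary: G s)
  case 0
  have "words L 0 = {[]}" by (auto simp: words_def)
  then have "(\<Sum>v\<in>words L (Suc 0). G v * cre u s v) = (\<Sum>x\<in>L. if u = x then G [x] * s [] else 0)"
    unfolding sum_words_Suc by (intro sum.cong refl) auto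
  then show ?case using assms \<open>words L 0 = {[]}\<close> by simp
next
  case (Suc m)
  have "(\<Sum>v\<in>words L (Suc (Suc m)). G v * cre u s v) =
    (\<Sum>x\<in>L. \<Sum>v\<in>words L (Suc m). if u = x then G (x # v) * s v else 0) +
    (\<Sum>x\<in>L. akap u x * (\<Sum>v\<in>words L (Suc m). ann x G v * cre u (ann x s) v))"
    unfolding sum_words_Suc[of _ L "Suc m"] sum_distrib_left sum.distrib[symmetric]
    by (intro sum.cong refl) (simp add: algebra_simps ann_apply)
  also have "(\<Sum>x\<in>L. \<Sum>v\<in>words L (Suc m). if u = x then G (x # v) * s v else 0) = (\<Sum>v\<in>words L (Suc m). G (u # v) * s v)"
    unfolding sum_if_const using assms(1,2) by simp
  also have "(\<Sum>x\<in>L. akap u x * (\<Sum>v\<in>words L (Suc m). ann x G v * cre u (ann x s) v)) =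
     of_nat (Suc m) * (\<Sum>v\<in>words L (Suc m). G (u # v) * s v)"
  proof -
    have "akap u x * (\<Sum>v\<in>words L (Suc m). ann x G v * cre u (ann x s) v) =
       of_nat (Suc m) * (\<Sum>v\<in>words L m. G (u # x # v) * s (x # v))" for x
      unfolding Suc.IH[OF symm_ann[OF Suc.prems]]
      using symm_swap[OF Suc.prems, of x u]
      by (simp add: ann_apply sum_distrib_left kap_sym algebra_simps)
    then show ?thesis unfolding sum_words_Suc[of _ L m] by (simp add: sum_distrib_left)
  qed
  finally show ?case by (simp add: algebra_simps)
qed

lemma cre_length:
  assumes "\<And>v. Suc (length v) = length w \<Longrightarrow> s v = 0"
  shows "cre u s w = 0"
  using assms by (induction w arbitrary: s) (simp_all add: ann_apply)

text \<open>Both sides are symmetric, so they can be compared by pairing with the kernel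
  \<open>psum v\<close>. Adjointness replaces the creator by a prefix, which avoids decomposing
  permutations of the longer word.\<close>

lemma cre_psum: "cre u (psum w) = psum (u # w)"
proof
  fix v
  show "cre u (psum w) v = psum (u # w) v"
  proof (cases "length v = Suc (length w)")
    case False
    then have "cre u (psum w) v = 0" by (intro cre_length psum_length) auto
    then show ?thesis using False by (simp add: psum_length)
  next
    case True
    define L where "L = insert u (set v \<union> set w)"
    have L: "finite L" "u \<in> L" by (simp_all add: L_def)
    have s1: "symm (psum x)" for x by (rule psymm_symm[OF psymm_psum])
    have "fact (length v) * cre u (psum w) v = (\<Sum>x\<in>words L (length v). psum v x * cre u (psum w) x)"
    proof (rule sum_psum[symmetric, OF symm_cre[OF s1] finite_words[OF L(1)]])
      fix \<pi> assume "\<pi> permutes {..<length v}"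
      then show "plist \<pi> v \<in> words L (length v)" using set_plist[of \<pi> v] by (auto simp: words_def L_def)
    qed
    also have "\<dots> = of_nat (length v) * (\<Sum>x\<in>words L (length w). psum w x * psum v (u # x))"
      unfolding True sum_cre[OF L s1] by (simp add: mult.commute)
    also have "(\<Sum>x\<in>words L (length w). psum w x * psum v (u # x)) = fact (length w) * psum v (u # w)"
    proof (rule sum_psum[OF symm_ann[OF s1, unfolded ann_def] finite_words[OF L(1)]])
      fix \<pi> assume "\<pi> permutes {..<length w}"
      then show "plist \<pi> w \<in> words L (length w)" using set_plist[of \<pi> w] by (auto simp: words_def L_def)
    qed
    finally have "fact (length v) * cre u (psum w) v = fact (length v) * psum (u # w) v"
      by (simp add: True psum_commute[of v])
    then show ?thesis by simp
  qed
qed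

section \<open>Dictionary between matrices of diagrams and operators on functions\<close>

section \<open>Coefficients of columns\<close>

text \<open>A word of atoms separates into the summand of the tensor algebra that it belongs to,
  \<open>tix\<close>, and its list of matrix indices, \<open>ixs\<close>, which runs parallel to the
  letters of \<open>tword\<close>.\<close>

definition tix :: "atom list \<Rightarrow> tidx" where "tix w = map fst w"

definition ixs :: "atom list \<Rightarrow> nat list" where "ixs w = concat (map (\<lambda>u. [fst (snd u), snd (snd u)]) w)"

lemma tix_simps [simp]: "tix [] = []" "tix (u # w) = fst u # tix w" "tix (w @ w') = tix w @ tix w'" "length (tix w) = length w"
  by (simp_all add: tix_def)

lemma ixs_simps [simp]: "ixs [] = []" "ixs (u # w) = [fst (snd u), snd (snd u)] @ ixs w" "ixs (w @ w') = ixs w @ ixs w'"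
  by (simp_all add: ixs_def)

lemma length_ixs [simp]: "length (ixs w) = 2 * length w"
  by (induction w) simp_all

lemma tword_simps [simp]: "tword [] = []" "tword (y # l) = adj @ tword l" "tword (l @ l') = tword l @ tword l'"
  "length (tword l) = 2 * length l"
  by (simp_all add: tword_def replicate_add adj_def sum_list_replicate length_concat)

lemma length_adj [simp]: "length adj = 2"
  by (simp add: adj_def)

lemma atom_eqI: "tix w = tix v \<Longrightarrow> ixs w = ixs v \<Longrightarrow> w = v"
  by (induction w arbitrary: v; case_tac v) (auto simp: prod_eq_iff)

lemma tix_ixs_eq: "length (tix w) = length (tix v) \<Longrightarrow> tix w = tix v \<and> ixs w = ixs v \<longleftrightarrow> w = v"
  using atom_eqI by blast

abbreviation smalls :: "nat \<Rightarrow> atom list \<Rightarrow> bool" where "smalls n w \<equiv> list_all (small n) w"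

definition atoms :: "nat \<Rightarrow> tidx \<Rightarrow> atom list set" where
  "atoms n l = {w. tix w = l \<and> smalls n w}"

lemma ixs_idx: "smalls n w \<Longrightarrow> ixs w \<in> idx n (2 * length w)"
  by (induction w) (auto simp: idx_def)

lemma bij_ixs: "bij_betw ixs (atoms n l) (idx n (2 * length l))"
proof (rule bij_betwI')
  fix w v assume "w \<in> atoms n l" "v \<in> atoms n l"
  then show "(ixs w = ixs v) = (w = v)" by (auto simp: atoms_def intro: atom_eqI)
next
  fix w assume "w \<in> atoms n l"
  then show "ixs w \<in> idx n (2 * length l)" using ixs_idx[of n w] by (auto simp: atoms_def)
next
  fix i assume "i \<in> idx n (2 * length l)"
  then show "\<exists>w\<in>atoms n l. i = ixs w"
  proof (induction l arbitrary: i)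
    case Nil
    then show ?case by (intro bexI[of _ "[]"]) (simp_all add: idx_def atoms_def)
  next
    case (Cons y l)
    then obtain a b i' where i: "i = a # b # i'" "a < n" "b < n" "i' \<in> idx n (2 * length l)"
      by (auto simp: idx_def length_Suc_conv)
    from Cons.IH[OF i(4)] obtain w where "w \<in> atoms n l" "i' = ixs w" by blast
    then show ?case
      by (intro bexI[of _ "(y, a, b) # w"]) (use i in \<open>simp_all add: atoms_def\<close>)
  qed
qed

lemma sum_idx_atoms: "(\<Sum>i\<in>idx n (2 * length l). F i) = (\<Sum>w\<in>atoms n l. F (ixs w))"
  using sum.reindex_bij_betw[OF bij_ixs, of F n l] by simp

lemma finite_atoms [simp]: "finite (atoms n l)"
  using bij_betw_finite[OF bij_ixs, of n l] by simp

lemma sum_idx_append: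
  "(\<Sum>i\<in>idx n (k + l). F i) = (\<Sum>i\<in>idx n k. \<Sum>j\<in>idx n l. F (i @ j))"
proof -
  have "(\<Sum>i\<in>idx n (k + l). F i) = (\<Sum>(i, j)\<in>idx n k \<times> idx n l. F (i @ j))"
  proof (rule sum.reindex_bij_witness[where i = "\<lambda>(i, j). i @ j" and j = "\<lambda>i. (take k i, drop k i)"])
    fix i assume "i \<in> idx n (k + l)"
    then show "(take k i, drop k i) \<in> idx n k \<times> idx n l"
      by (auto simp: idx_def dest: in_set_takeD in_set_dropD)
  qed (auto simp: idx_def)
  then show ?thesis by (simp add: sum.cartesian_product)
qed

definition cf :: "nat \<Rightarrow> tidx col \<Rightarrow> nat list \<Rightarrow> fock" where
  "cf n f i w = ev n (lookup f (tix w)) i (ixs w)"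

lemma cf_zero [simp]: "cf n 0 i w = 0"
  by (simp add: cf_def)

lemma cf_sum: "cf n (\<Sum>x\<in>X. f x) i w = (\<Sum>x\<in>X. cf n (f x) i w)"
  by (simp add: cf_def lookup_sum ev_sum)

lemma cf_add: "cf n (f + g) i w = cf n f i w + cf n g i w"
  by (simp add: cf_def lookup_add ev_add)

text \<open>Well-typedness of a column, \<open>W\<close> being additional letters in the target. It
  is the condition under which evaluation respects composition.\<close>

definition tcol :: "word \<Rightarrow> word \<Rightarrow> tidx col \<Rightarrow> bool" where
  "tcol u W f \<longleftrightarrow> (\<forall>l. lookup f l \<in> Hom0 u (W @ tword l))"

definition tmat :: "word \<Rightarrow> (tidx, tidx) mat \<Rightarrow> bool" where
  "tmat W G \<longleftrightarrow> (\<forall>l. tcol (W @ tword l) [] (G l))"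

lemma lookup_post_comp: "lookup (post_comp G f) l' = (\<Sum>l\<in>keys f. lookup (G l) l' \<circ>\<^sub>m lookup f l)"
  unfolding post_comp_def by (simp add: lookup_sum lookup_map)

lemma lookup_pre_comp: "lookup (pre_comp f h) l = lookup f l \<circ>\<^sub>m h"
  unfolding pre_comp_def by (simp add: lookup_map)

lemma lookup_whisker: "lookup (whisker w f) l = mor_tensor w w (mor_id w) (lookup f l)"
  unfolding whisker_def by (simp add: lookup_map)

lemma tcol_post_comp: "tcol u W f \<Longrightarrow> tmat W G \<Longrightarrow> tcol u [] (post_comp G f)"
  unfolding tcol_def tmat_def lookup_post_comp by (auto intro!: Hom0_sum Hom0_comp)

lemma tcol_whisker: "tcol u [] f \<Longrightarrow> tcol (W @ u) W (whisker W f)"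
  unfolding tcol_def lookup_whisker using Hom0_tensor[OF Hom0_id] by auto

lemma tcol_pre_comp: "tcol u W f \<Longrightarrow> h \<in> Hom0 v u \<Longrightarrow> tcol v W (pre_comp f h)"
  unfolding tcol_def lookup_pre_comp by (auto intro: Hom0_comp)

lemma tcol_zero [simp]: "tcol u W 0"
  by (simp add: tcol_def)

lemma tcol_sum: "(\<And>x. x \<in> X \<Longrightarrow> tcol u W (f x)) \<Longrightarrow> tcol u W (\<Sum>x\<in>X. f x)"
  unfolding tcol_def lookup_sum by (auto intro: Hom0_sum)

lemma tcol_add: "tcol u W f \<Longrightarrow> tcol u W g \<Longrightarrow> tcol u W (f + g)"
  unfolding tcol_def lookup_add by (auto intro: Hom0_add)

lemma tcol_single: "f \<in> Hom0 u (W @ tword l) \<Longrightarrow> tcol u W (single l f)"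
  unfolding tcol_def lookup_single by (auto simp: when_def)

section \<open>Operators realizing matrices\<close>

definition fock_vec :: "nat \<Rightarrow> fock \<Rightarrow> bool" where
  "fock_vec n s \<longleftrightarrow> symm s \<and> (\<forall>w. \<not> smalls n w \<longrightarrow> s w = 0)"

definition fock_op :: "nat \<Rightarrow> (fock \<Rightarrow> fock) \<Rightarrow> bool" where
  "fock_op n F \<longleftrightarrow> linear_op F \<and> (\<forall>s. fock_vec n s \<longrightarrow> fock_vec n (F s))"

lemma smalls_plist: "\<pi> permutes {..<length w} \<Longrightarrow> smalls n w \<Longrightarrow> smalls n (plist \<pi> w)"
  using set_plist[of \<pi> w] by (auto simp: list_all_iff simp del: split_paired_All)

lemma fock_vec_psum:
  assumes "smalls n w"
  shows "fock_vec n (psum w)"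
proof -
  have "psum w v = 0" if "\<not> smalls n v" for v
    unfolding psum_def using smalls_plist[OF _ assms] that by (intro sum.neutral) auto
  then show ?thesis unfolding fock_vec_def using psymm_symm[OF psymm_psum] by blast
qed

lemma fock_vec_zero: "fock_vec n (\<lambda>_. 0)"
  by (simp add: fock_vec_def symm_zero)

lemma fock_vec_plus: "fock_vec n s \<Longrightarrow> fock_vec n t \<Longrightarrow> fock_vec n (\<lambda>w. s w + t w)"
  unfolding fock_vec_def by (metis symm_plus add_0)

lemma fock_vec_scale: "fock_vec n s \<Longrightarrow> fock_vec n (\<lambda>w. c * s w)"
  unfolding fock_vec_def by (metis symm_scale mult_zero_right)

lemma fock_op_id: "fock_op n (\<lambda>s. s)"
  by (simp add: fock_op_def linear_op_id)

lemma fock_op_zero: "fock_op n (\<lambda>s w. 0)"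
  by (simp add: fock_op_def linear_op_zero fock_vec_zero)

lemma fock_op_comp: "fock_op n F \<Longrightarrow> fock_op n G \<Longrightarrow> fock_op n (\<lambda>s. F (G s))"
  by (simp add: fock_op_def linear_op_comp)

lemma fock_op_plus: "fock_op n F \<Longrightarrow> fock_op n G \<Longrightarrow> fock_op n (\<lambda>s w. F s w + G s w)"
  by (simp add: fock_op_def linear_op_plus fock_vec_plus)

lemma fock_op_mult: "fock_op n F \<Longrightarrow> fock_op n (\<lambda>s w. c * F s w)"
  by (simp add: fock_op_def linear_op_mult fock_vec_scale)

lemma fock_op_Sum: "finite I \<Longrightarrow> (\<And>i. i \<in> I \<Longrightarrow> fock_op n (F i)) \<Longrightarrow> fock_op n (\<lambda>s w. \<Sum>i\<in>I. F i s w)"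
  by (induction I rule: finite_induct) (simp_all add: fock_op_zero fock_op_plus)

text \<open>
  In the normalization above, \<open>G\<close> acts on symmetric functions as \<open>F j\<close>, where \<open>j\<close> lists the indices of
  the additional letters \<open>W\<close> of the source.
\<close>

definition impl :: "nat \<Rightarrow> word \<Rightarrow> (tidx, tidx) mat \<Rightarrow> (nat list \<Rightarrow> fock \<Rightarrow> fock) \<Rightarrow> bool" where
  "impl n W G F \<longleftrightarrow> tmat W G \<and> (\<forall>j\<in>idx n (length W). fock_op n (F j) \<and>
     (\<forall>w w'. smalls n w \<longrightarrow> smalls n w' \<longrightarrow> fact (length w') * cf n (G (tix w)) (j @ ixs w) w' = F j (psum w) w'))"

lemma implD:
  assumes "impl n W G F"
  shows "tmat W G" "j \<in> idx n (length W) \<Longrightarrow> fock_op n (F j)"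
    "j \<in> idx n (length W) \<Longrightarrow> smalls n w \<Longrightarrow> smalls n w' \<Longrightarrow> fact (length w') * cf n (G (tix w)) (j @ ixs w) w' = F j (psum w) w'"
  using assms unfolding impl_def by blast+

lemma cf_post_comp:
  assumes "tmat W G" "tcol u W f" "i \<in> idx n (length u)" "smalls n w'"
  shows "cf n (post_comp G f) i w' = (\<Sum>l\<in>keys f. \<Sum>j\<in>idx n (length W). \<Sum>w\<in>atoms n l.
     ev n (lookup f (tix w)) i (j @ ixs w) * cf n (G (tix w)) (j @ ixs w) w')"
proof -
  have "ev n (lookup (G l) (tix w') \<circ>\<^sub>m lookup f l) i (ixs w') = (\<Sum>j\<in>idx n (length W). \<Sum>w\<in>atoms n l.
     ev n (lookup f (tix w)) i (j @ ixs w) * cf n (G (tix w)) (j @ ixs w) w')" for l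
  proof -
    have "ev n (lookup (G l) (tix w') \<circ>\<^sub>m lookup f l) i (ixs w') =
      (\<Sum>k\<in>idx n (length (W @ tword l)). ev n (lookup f l) i k * ev n (lookup (G l) (tix w')) k (ixs w'))"
    proof (rule ev_comp[where w = u and w'' = "tword (tix w')"])
      show "lookup f l \<in> Hom0 u (W @ tword l)" "lookup (G l) (tix w') \<in> Hom0 (W @ tword l) (tword (tix w'))"
        using assms(1,2) by (simp_all add: tcol_def tmat_def)
      show "ixs w' \<in> idx n (length (tword (tix w')))" using ixs_idx[OF assms(4)] by simp
    qed fact
    also have "\<dots> = (\<Sum>j\<in>idx n (length W). \<Sum>w\<in>atoms n l. ev n (lookup f l) i (j @ ixs w) * ev n (lookup (G l) (tix w')) (j @ ixs w) (ixs w'))"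
      by (simp add: sum_idx_append sum_idx_atoms)
    also have "\<dots> = (\<Sum>j\<in>idx n (length W). \<Sum>w\<in>atoms n l.
       ev n (lookup f (tix w)) i (j @ ixs w) * cf n (G (tix w)) (j @ ixs w) w')"
      by (intro sum.cong refl) (simp add: cf_def atoms_def)
    finally show ?thesis .
  qed
  then show ?thesis by (simp add: cf_def[of n "post_comp G f"] lookup_post_comp ev_sum)
qed

text \<open>The reproducing property read as an expansion in symmetrized words. The rearrangements
  of \<open>x\<close> are adjoined to \<open>V\<close> so that it applies at the point
  \<open>x\<close>.\<close>

lemma psum_expand:
  assumes "fock_vec n s" "finite V" "\<And>v. smalls n v \<Longrightarrow> v \<notin> V \<Longrightarrow> s v = 0"
  shows "(\<lambda>x. \<Sum>v\<in>V. s v / fact (length v) * psum v x) = s"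
proof
  fix x :: "atom list"
  let ?P = "(\<lambda>\<pi>. plist \<pi> x) ` {\<pi>. \<pi> permutes {..<length x}}"
  have fP: "finite ?P" by (simp add: finite_permutations)
  have "(\<Sum>v\<in>V. s v / fact (length v) * psum v x) = (\<Sum>v\<in>V \<union> ?P. s v / fact (length v) * psum v x)"
  proof (rule sum.mono_neutral_left)
    show "\<forall>v\<in>(V \<union> ?P) - V. s v / fact (length v) * psum v x = 0"
      using assms(1,3) by (auto simp: fock_vec_def)
  qed (use assms fP in auto)
  also have "\<dots> = (\<Sum>v\<in>V \<union> ?P. psum x v * s v) / fact (length x)"
    unfolding sum_divide_distrib
  proof (intro sum.cong refl)
    fix v show "s v / fact (length v) * psum v x = psum x v * s v / fact (length x)"
      by (cases "length v = length x") (simp_all add: psum_commute[of v x] psum_length)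
  qed
  also have "(\<Sum>v\<in>V \<union> ?P. psum x v * s v) = fact (length x) * s x"
    by (rule sum_psum) (use assms fP in \<open>auto simp: fock_vec_def\<close>)
  finally show "(\<Sum>v\<in>V. s v / fact (length v) * psum v x) = s x" by simp
qed

text \<open>An operator is known only on symmetrized words, so the evaluated column is expanded in
  these and linearity does the rest. The sum over \<open>j\<close> is the contraction of the
  additional letters \<open>W\<close>.\<close>

lemma cf_post_comp_impl:
  assumes G: "impl n W G F" and f: "tcol u W f" and i: "i \<in> idx n (length u)" and w': "smalls n w'"
    and S: "\<And>j. j \<in> idx n (length W) \<Longrightarrow> fock_vec n (S j)"
    and Sf: "\<And>j v. j \<in> idx n (length W) \<Longrightarrow> smalls n v \<Longrightarrow> S j v = fact (length v) * ev n (lookup f (tix v)) i (j @ ixs v)"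
  shows "fact (length w') * cf n (post_comp G f) i w' = (\<Sum>j\<in>idx n (length W). F j (S j) w')"
proof -
  define V where "V = (\<Union>l\<in>keys f. atoms n l)"
  have fV: "finite V" by (simp add: V_def)
  have V: "lookup f (tix v) = 0" if "smalls n v" "v \<notin> V" for v
    using that by (auto simp: V_def atoms_def in_keys_iff)
  have "fact (length w') * cf n (post_comp G f) i w' = (\<Sum>j\<in>idx n (length W). \<Sum>l\<in>keys f. \<Sum>w\<in>atoms n l.
     ev n (lookup f (tix w)) i (j @ ixs w) * (fact (length w') * cf n (G (tix w)) (j @ ixs w) w'))"
    unfolding cf_post_comp[OF implD(1)[OF G] f i w'] sum_distrib_left
    by (subst sum.swap) (simp add: mult_ac)
  also have "\<dots> = (\<Sum>j\<in>idx n (length W). F j (S j) w')"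
  proof (rule sum.cong[OF refl])
    fix j assume j: "j \<in> idx n (length W)"
    have op: "linear_op (F j)" using implD(2)[OF G j] by (simp add: fock_op_def)
    have "(\<Sum>l\<in>keys f. \<Sum>w\<in>atoms n l. ev n (lookup f (tix w)) i (j @ ixs w) * (fact (length w') * cf n (G (tix w)) (j @ ixs w) w')) =
      (\<Sum>l\<in>keys f. \<Sum>w\<in>atoms n l. S j w / fact (length w) * F j (psum w) w')"
    proof (intro sum.cong refl)
      fix l w assume "w \<in> atoms n l"
      then have "smalls n w" by (simp add: atoms_def)
      then show "ev n (lookup f (tix w)) i (j @ ixs w) * (fact (length w') * cf n (G (tix w)) (j @ ixs w) w') =
          S j w / fact (length w) * F j (psum w) w'"
        using implD(3)[OF G j _ w'] Sf[OF j] by simp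
    qed
    also have "\<dots> = (\<Sum>w\<in>V. S j w / fact (length w) * F j (psum w) w')"
      unfolding V_def by (rule sum.UNION_disjoint[symmetric], simp, simp, auto simp: atoms_def)
    also have "\<dots> = F j (\<lambda>x. \<Sum>w\<in>V. S j w / fact (length w) * psum w x) w'"
      by (rule linear_op_sum[OF op fV, symmetric])
    also have "(\<lambda>x. \<Sum>w\<in>V. S j w / fact (length w) * psum w x) = S j"
      by (rule psum_expand[OF S[OF j] fV]) (simp add: V Sf[OF j])
    finally show "(\<Sum>l\<in>keys f. \<Sum>w\<in>atoms n l. ev n (lookup f (tix w)) i (j @ ixs w) * (fact (length w') * cf n (G (tix w)) (j @ ixs w) w')) = F j (S j) w'" .
  qed
  finally show ?thesis .
qed

lemma sum_idx_delta: "i \<in> idx n k \<Longrightarrow> (\<Sum>j\<in>idx n k. if i = j then f j else 0) = (f i :: complex)"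
  by (simp add: sum.delta)

lemma cf_whisker_comp:
  assumes G: "tmat W G" and f: "tcol u [] f" and j: "j \<in> idx n (length W)" and i: "i \<in> idx n (length u)" and w': "smalls n w'"
  shows "cf n (post_comp G (whisker W f)) (j @ i) w' =
    (\<Sum>v\<in>(\<Union>l\<in>keys f. atoms n l). cf n f i v * cf n (G (tix v)) (j @ ixs v) w')"
proof -
  let ?f = "whisker W f"
  have fl: "ev n (lookup ?f (tix v)) (j @ i) (j' @ ixs v) = of_bool (j = j') * cf n f i v" if "j' \<in> idx n (length W)" for j' v
    unfolding lookup_whisker cf_def
    by (subst ev_tensor[OF Hom0_id]) (use that j in \<open>simp_all add: ev_id idx_def\<close>)
  have ks: "keys ?f \<subseteq> keys f"
    by (auto simp: in_keys_iff lookup_whisker)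
  have "cf n (post_comp G ?f) (j @ i) w' = (\<Sum>l\<in>keys ?f. \<Sum>j'\<in>idx n (length W). \<Sum>v\<in>atoms n l.
        ev n (lookup ?f (tix v)) (j @ i) (j' @ ixs v) * cf n (G (tix v)) (j' @ ixs v) w')"
    by (rule cf_post_comp[OF G tcol_whisker[OF f] _ w']) (use i j in \<open>auto simp: idx_def\<close>)
  also have "\<dots> = (\<Sum>l\<in>keys f. \<Sum>j'\<in>idx n (length W). \<Sum>v\<in>atoms n l.
        ev n (lookup ?f (tix v)) (j @ i) (j' @ ixs v) * cf n (G (tix v)) (j' @ ixs v) w')"
    by (rule sum.mono_neutral_left) (use ks in \<open>auto simp: atoms_def in_keys_iff intro!: sum.neutral\<close>)
  also have "\<dots> = (\<Sum>l\<in>keys f. \<Sum>j'\<in>idx n (length W).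
        if j = j' then \<Sum>v\<in>atoms n l. cf n f i v * cf n (G (tix v)) (j' @ ixs v) w' else 0)"
    by (intro sum.cong refl) (simp add: fl)
  also have "\<dots> = (\<Sum>l\<in>keys f. \<Sum>v\<in>atoms n l. cf n f i v * cf n (G (tix v)) (j @ ixs v) w')"
    unfolding sum_idx_delta[OF j] ..
  also have "\<dots> = (\<Sum>v\<in>(\<Union>l\<in>keys f. atoms n l). cf n f i v * cf n (G (tix v)) (j @ ixs v) w')"
    by (rule sum.UNION_disjoint[symmetric], simp, simp, auto simp: atoms_def)
  finally show ?thesis .
qed

text \<open>Whiskering by an identity only carries the indices of \<open>W\<close> along, so the
  operators compose and the index list is cut at \<open>length W\<close>.\<close>

lemma impl_comp:
  assumes G: "impl n W G FG" and H: "impl n U H FH"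
  shows "impl n (W @ U) (\<lambda>l. post_comp G (whisker W (H l)))
    (\<lambda>j s. FG (take (length W) j) (FH (drop (length W) j) s))"
  unfolding impl_def
proof (intro conjI ballI allI impI)
  have th: "tcol (U @ tword l) [] (H l)" for l
    using implD(1)[OF H] by (simp add: tmat_def)
  show "tmat (W @ U) (\<lambda>l. post_comp G (whisker W (H l)))"
    unfolding tmat_def append_assoc using tcol_post_comp[OF tcol_whisker[OF th] implD(1)[OF G]] by blast
  fix j assume j: "j \<in> idx n (length (W @ U))"
  define j1 j2 where "j1 = take (length W) j" and "j2 = drop (length W) j"
  have jj: "j = j1 @ j2" "j1 \<in> idx n (length W)" "j2 \<in> idx n (length U)"
    using j by (auto simp: j1_def j2_def idx_def dest: in_set_takeD in_set_dropD)
  note opG = implD(2)[OF G jj(2)] and opH = implD(2)[OF H jj(3)]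
  show "fock_op n (\<lambda>s. FG (take (length W) j) (FH (drop (length W) j) s))"
    unfolding j1_def[symmetric] j2_def[symmetric] by (rule fock_op_comp[OF opG opH])
  fix w w' assume w: "smalls n w" and w': "smalls n w'"
  let ?V = "\<Union>l\<in>keys (H (tix w)). atoms n l" and ?s = "FH j2 (psum w)"
  have s: "?s v = fact (length v) * cf n (H (tix w)) (j2 @ ixs w) v" if "smalls n v" for v
    using implD(3)[OF H jj(3) w that] by simp
  have i: "j2 @ ixs w \<in> idx n (length (U @ tword (tix w)))"
    using jj(3) ixs_idx[OF w] by (auto simp: idx_def)
  have "fact (length w') * cf n (post_comp G (whisker W (H (tix w)))) (j1 @ (j2 @ ixs w)) w' =
     (\<Sum>v\<in>?V. ?s v / fact (length v) * FG j1 (psum v) w')"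
    unfolding cf_whisker_comp[OF implD(1)[OF G] th jj(2) i w'] sum_distrib_left
    by (intro sum.cong refl) (use s implD(3)[OF G jj(2) _ w'] in \<open>auto simp: atoms_def simp flip: implD(3)[OF G jj(2) _ w']\<close>)
  also have "\<dots> = FG j1 (\<lambda>x. \<Sum>v\<in>?V. ?s v / fact (length v) * psum v x) w'"
    using opG by (intro linear_op_sum[symmetric]) (simp_all add: fock_op_def)
  also have "(\<lambda>x. \<Sum>v\<in>?V. ?s v / fact (length v) * psum v x) = ?s"
  proof (rule psum_expand)
    show "fock_vec n ?s" using opH fock_vec_psum[OF w] by (simp add: fock_op_def)
    show "?s v = 0" if "smalls n v" "v \<notin> ?V" for v
      using that s[OF that(1)] by (auto simp: atoms_def in_keys_iff cf_def)
  qed simp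
  finally show "fact (length w') * cf n (post_comp G (whisker W (H (tix w)))) (j @ ixs w) w' =
     FG (take (length W) j) (FH (drop (length W) j) (psum w)) w'"
    unfolding j1_def[symmetric] j2_def[symmetric] by (simp add: jj(1))
qed

lemma ev_braid_comp:
  assumes "f \<in> Hom0 (w' @ w @ v) z" "i \<in> idx n (length w)" "i' \<in> idx n (length w')" "i'' \<in> idx n (length v)" "k \<in> idx n (length z)"
  shows "ev n (f \<circ>\<^sub>m mor_tensor (w @ w') (w' @ w) (scale_mor c (mor_braid w w')) (mor_id v)) (i @ i' @ i'') k =
    poly c (of_nat n) * ev n f (i' @ i @ i'') k"
proof -
  have hom: "mor_tensor (w @ w') (w' @ w) (scale_mor c (mor_braid w w')) (mor_id v) \<in> Hom0 (w @ w' @ v) (w' @ w @ v)"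
    using Hom0_tensor[OF Hom0_scale[OF Hom0_braid[of w w']] Hom0_id[of v]] by simp
  have "ev n (f \<circ>\<^sub>m mor_tensor (w @ w') (w' @ w) (scale_mor c (mor_braid w w')) (mor_id v)) (i @ i' @ i'') k =
    (\<Sum>m\<in>idx n (length (w' @ w @ v)). ev n (mor_tensor (w @ w') (w' @ w) (scale_mor c (mor_braid w w')) (mor_id v)) (i @ i' @ i'') m * ev n f m k)"
    by (rule ev_comp[OF hom assms(1) _ assms(5)]) (use assms in \<open>auto simp: idx_def\<close>)
  also have "\<dots> = (\<Sum>m\<in>idx n (length (w' @ w @ v)). if i' @ i @ i'' = m then poly c (of_nat n) * ev n f m k else 0)"
  proof (intro sum.cong refl)
    fix m assume "m \<in> idx n (length (w' @ w @ v))"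
    then obtain m1 m2 m3 where m: "m = m1 @ m2 @ m3" "length m1 = length w'" "length m2 = length w" "length m3 = length v"
      by (intro that[of "take (length w') m" "take (length w) (drop (length w') m)" "drop (length w) (drop (length w') m)"])
        (auto simp: idx_def simp del: drop_drop)
    have "ev n (mor_tensor (w @ w') (w' @ w) (scale_mor c (mor_braid w w')) (mor_id v)) ((i @ i') @ i'') ((m1 @ m2) @ m3) =
       ev n (scale_mor c (mor_braid w w')) (i @ i') (m1 @ m2) * ev n (mor_id v) i'' m3"
      by (rule ev_tensor[OF Hom0_scale[OF Hom0_braid]]) (use assms m in \<open>auto simp: idx_def\<close>)
    also have "\<dots> = poly c (of_nat n) * of_bool (i = m2 \<and> i' = m1 \<and> i'' = m3)"
      using assms m by (simp add: ev_braid ev_id idx_def)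
    finally show "ev n (mor_tensor (w @ w') (w' @ w) (scale_mor c (mor_braid w w')) (mor_id v)) (i @ i' @ i'') m * ev n f m k =
       (if i' @ i @ i'' = m then poly c (of_nat n) * ev n f m k else 0)"
      using assms m by (auto simp: idx_def)
  qed
  also have "\<dots> = poly c (of_nat n) * ev n f (i' @ i @ i'') k"
    by (rule sum_idx_delta) (use assms in \<open>auto simp: idx_def\<close>)
  finally show ?thesis .
qed

text \<open>The counterpart of \<open>symm_rec\<close> for supports. Prefixing by an atom with
  indices out of range gives the zero function, on which a linear operator vanishes.\<close>

lemma supp_rec:
  assumes lin: "linear_op F"
    and rec: "\<And>s u w. symm s \<Longrightarrow> F s (u # w) = E u s w + c u * F (ann u s) w"
    and E: "\<And>s u w. fock_vec n s \<Longrightarrow> \<not> smalls n (u # w) \<Longrightarrow> E u s w = 0"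
    and s: "fock_vec n s" and w: "\<not> smalls n w"
  shows "F s w = 0"
  using s w
proof (induction w arbitrary: s)
  case (Cons u w)
  then have sy: "symm s" by (simp add: fock_vec_def)
  have "F (ann u s) w = 0"
  proof (cases "small n u")
    case True
    with Cons.prems have "\<not> smalls n w" "fock_vec n (ann u s)" by (auto simp: fock_vec_def ann_apply)
    then show ?thesis by (rule Cons.IH[rotated])
  next
    case False
    then have "ann u s = (\<lambda>w. 0 * 0)" using Cons.prems(1) by (auto simp: fock_vec_def ann_def)
    then show ?thesis using linear_op_scale[OF lin, of 0 "\<lambda>_. 0" w] by simp
  qed
  then show ?case using rec[OF sy] E[OF Cons.prems] by simp
qed simp

lemma fock_vec_ann: "small n u \<Longrightarrow> fock_vec n s \<Longrightarrow> fock_vec n (ann u s)"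
  by (auto simp: fock_vec_def ann_apply)

fun small_label :: "nat \<Rightarrow> label \<Rightarrow> bool" where "small_label n (x, a, b) \<longleftrightarrow> a < n \<and> b < n"

lemma small_lab: "small_label n (lab u) = small n u"
  by (cases u rule: lab.cases) (auto split: prod.split)

lemma fock_op_cre:
  assumes "small n u"
  shows "fock_op n (cre u)"
proof -
  have "cre u s w = 0" if "fock_vec n s" "\<not> smalls n w" for s w
  proof (rule supp_rec[OF linear_op_cre _ _ that, where E = "\<lambda>v s w. if u = v then s w else 0" and c = "\<lambda>v. akap u v"])
    show "fock_vec n s \<Longrightarrow> \<not> smalls n (v # w) \<Longrightarrow> (if u = v then s w else 0) = 0" for s v w
      using assms by (auto simp: fock_vec_def)
  qed simp
  then show ?thesis by (auto simp: fock_op_def linear_op_cre symm_cre fock_vec_def)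
qed

lemma fock_op_ann: "small n u \<Longrightarrow> fock_op n (ann u)"
  by (simp add: fock_op_def linear_op_ann fock_vec_ann)

lemma fock_op_mode:
  assumes "small_label n y"
  shows "fock_op n (mode y m)"
proof -
  obtain x a b where y: "y = (x, a, b)" by (cases y)
  have "mode y m = (if m < 0 then cre ((x, nat (- m - 1)), a, b)
      else (\<lambda>s w. omega x * ann ((dual x, nat m), b, a) s w))"
    by (intro ext) (simp add: y mode.simps)
  then show ?thesis using assms by (simp add: y fock_op_cre fock_op_mult fock_op_ann)
qed

lemma fock_op_pair_op:
  assumes "small_label n y1" "small_label n y2"
  shows "fock_op n (pair_op y1 y2 m)"
proof -
  have m: "fock_vec n s \<Longrightarrow> \<not> smalls n w \<Longrightarrow> mode y1 r s w = 0" "fock_vec n s \<Longrightarrow> \<not> smalls n w \<Longrightarrow> mode y2 r s w = 0" for s w r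
    using fock_op_mode[OF assms(1)] fock_op_mode[OF assms(2)] unfolding fock_op_def fock_vec_def by blast+
  have "pair_op y1 y2 m s w = 0" if "fock_vec n s" "\<not> smalls n w" for s w
  proof (rule supp_rec[OF linear_op_pair_op _ _ that, where
        E = "pair_head y1 y2 m" and c = "\<lambda>u. kap (gen_of u) (fst y1) * kap (gen_of u) (fst y2)"])
    fix s u w assume "fock_vec n s" "\<not> smalls n (u # w)"
    then show "pair_head y1 y2 m u s w = 0"
      using m assms small_lab[of n u] by auto
  qed simp
  then show ?thesis by (simp add: fock_op_def linear_op_pair_op symm_pair_op fock_vec_def)
qed

lemma fock_op_triple_op:
  assumes "small_label n y1" "small_label n y2" "small_label n y3"
  shows "fock_op n (triple_op y1 y2 y3)"
proof -
  have m: "fock_vec n s \<Longrightarrow> \<not> smalls n w \<Longrightarrow> pair_op y z r s w = 0" if "small_label n y" "small_label n z" for s w r y z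
    using fock_op_pair_op[OF that, of r] unfolding fock_op_def fock_vec_def by blast
  have "triple_op y1 y2 y3 s w = 0" if "fock_vec n s" "\<not> smalls n w" for s w
  proof (rule supp_rec[OF linear_op_triple_op _ _ that, where E = "triple_head y1 y2 y3" and c = "triple_sign y1 y2 y3"])
    fix s u w assume "fock_vec n s" "\<not> smalls n (u # w)"
    then show "triple_head y1 y2 y3 u s w = 0"
      using m[OF assms(2,3)] m[OF assms(1,3)] m[OF assms(1,2)] assms small_lab[of n u] by auto
  qed simp
  then show ?thesis by (simp add: fock_op_def linear_op_triple_op symm_triple_op fock_vec_def)
qed

section \<open>Evaluation of the symmetrizer\<close>

section \<open>The symmetrizer\<close>

lemma nth_tword: "x < 2 * length l \<Longrightarrow> tword l ! x = adj ! (x mod 2)"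
proof (induction l arbitrary: x)
  case (Cons y l)
  show ?case
  proof (cases "x < 2")
    case False
    with Cons.prems have "tword l ! (x - 2) = adj ! ((x - 2) mod 2)" by (intro Cons.IH) simp
    moreover have "(x - 2) mod 2 = x mod 2" using False by (simp add: le_mod_geq)
    ultimately show ?thesis using False by (simp add: nth_append)
  qed (simp add: nth_append)
qed simp

lemma nth_ixs: "i < length w \<Longrightarrow> ixs w ! (2 * i) = fst (snd (w ! i)) \<and> ixs w ! Suc (2 * i) = snd (snd (w ! i))"
proof (induction w arbitrary: i)
  case (Cons u w)
  then show ?case by (cases i) auto
qed simp

lemma gen_of_fst: "gen_of u = fst (fst u)"
  by (cases u rule: gen_of.cases) simp

lemma perm_sign_psgn: "perm_sign \<pi> (tix w) = psgn \<pi> w"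
  unfolding perm_sign_def psgn_def kap_def
  by (intro prod.cong) (auto simp: tix_def gen_of_fst)

text \<open>The effect on letters of a permutation of tensor factors, each of which is a block of
  two letters.\<close>

definition blockmap :: "(nat \<Rightarrow> nat) \<Rightarrow> nat \<Rightarrow> nat" where
  "blockmap \<pi> x = 2 * \<pi> (x div 2) + x mod 2"

lemma perm_diagram_through: "perm_diagram \<pi> k = through (2 * k) (blockmap \<pi>)"
proof -
  have "\<exists>i a. e = {Inl (2 * i + a), Inr (2 * \<pi> i + a)} \<and> i < k \<and> a < 2"
    if "x < 2 * k" "e = {Inl x, Inr (blockmap \<pi> x)}" for e :: "(nat + nat) set" and x
    using that by (intro exI[of _ "x div 2"] exI[of _ "x mod 2"]) (auto simp: blockmap_def)
  moreover have "\<exists>x<2 * k. e = {Inl x, Inr (blockmap \<pi> x)}"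
    if "e = {Inl (2 * i + a), Inr (2 * \<pi> i + a)}" "i < k" "a < 2" for e :: "(nat + nat) set" and i a
    using that by (intro exI[of _ "2 * i + a"]) (auto simp: blockmap_def)
  ultimately show ?thesis
    unfolding perm_diagram_def through_def by blast
qed

lemma bij_blockmap:
  assumes "\<pi> permutes {..<k}"
  shows "bij_betw (blockmap \<pi>) {..<2 * k} {..<2 * k}"
proof (rule bij_betw_byWitness[where f' = "blockmap (inv \<pi>)"])
  have lt: "blockmap \<sigma> x < 2 * k" if "\<sigma> permutes {..<k}" "x < 2 * k" for \<sigma> x
  proof -
    have "\<sigma> (x div 2) < k" using permutes_in_image[OF that(1), of "x div 2"] that(2) by simp
    moreover have "x mod 2 < 2" by simp
    ultimately show ?thesis unfolding blockmap_def by linarith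
  qed
  show "blockmap \<pi> ` {..<2 * k} \<subseteq> {..<2 * k}" "blockmap (inv \<pi>) ` {..<2 * k} \<subseteq> {..<2 * k}"
    using lt[OF assms] lt[OF permutes_inv[OF assms]] by auto
qed (auto simp: blockmap_def permutes_inverses[OF assms])

lemma perm_idx_plist: "perm_idx \<pi> l = plist \<pi> l"
  by (simp add: perm_idx_def plist_def)

lemma perm_diagram_diagrams:
  assumes "\<pi> permutes {..<length l}"
  shows "perm_diagram \<pi> (length l) \<in> diagrams (tword l) (tword (perm_idx \<pi> l))"
proof -
  have len: "length (perm_idx \<pi> l) = length l" by (simp add: perm_idx_plist)
  have bij: "bij_betw (blockmap \<pi>) {..<2 * length l} {..<2 * length l}" by (rule bij_blockmap[OF assms])
  have "through (length (tword l)) (blockmap \<pi>) \<in> diagrams (tword l) (tword (perm_idx \<pi> l))"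
  proof (rule through_diagrams)
    fix i assume "i < length (tword l)"
    then have i: "i < 2 * length l" by simp
    then have "blockmap \<pi> i < 2 * length l" using bij by (auto simp: bij_betw_def)
    then show "tword (perm_idx \<pi> l) ! blockmap \<pi> i = tword l ! i"
      using i len by (simp add: nth_tword) (simp add: blockmap_def)
  qed (use bij len in simp)
  then show ?thesis by (simp add: perm_diagram_through)
qed

lemma tcol_symmetrizer: "tcol (tword l) [] (symmetrizer l)"
  unfolding symmetrizer_def
  by (intro tcol_sum tcol_single) (auto intro!: Hom0_scale Hom0_mor_of perm_diagram_diagrams)

lemma sat_perm_diagram:
  assumes p: "\<pi> permutes {..<length w}" and l: "length w' = length w"
  shows "perm_idx \<pi> (tix w) = tix w' \<and> sat (ixs w) (ixs w') (perm_diagram \<pi> (length w)) \<longleftrightarrow> plist \<pi> w = w'"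
proof -
  have pl: "plist \<pi> v = v' \<longleftrightarrow> (\<forall>i<length w. v ! i = v' ! \<pi> i)" if "length v = length w" "length v' = length w" for v v' :: "'b list"
  proof
    assume "plist \<pi> v = v'"
    then show "\<forall>i<length w. v ! i = v' ! \<pi> i" using nth_plist[of \<pi> v] p that by auto
  next
    assume *: "\<forall>i<length w. v ! i = v' ! \<pi> i"
    show "plist \<pi> v = v'"
      using that inv_lt[OF p] * by (auto intro!: nth_equalityI simp: plist_def permutes_inverses[OF p])
  qed
  have pi: "\<pi> i < length w" if "i < length w" for i using permutes_in_image[OF p, of i] that by simp
  have "sat (ixs w) (ixs w') (perm_diagram \<pi> (length w)) \<longleftrightarrow> (\<forall>i<length w. snd (w ! i) = snd (w' ! \<pi> i))"
  proof -
    have "(\<forall>x<2 * length w. ixs w ! x = ixs w' ! blockmap \<pi> x) \<longleftrightarrow>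
       (\<forall>i<length w. ixs w ! (2 * i) = ixs w' ! (2 * \<pi> i) \<and> ixs w ! Suc (2 * i) = ixs w' ! Suc (2 * \<pi> i))" (is "?L \<longleftrightarrow> ?R")
    proof
      assume L: ?L
      show ?R
      proof (intro allI impI)
        fix i assume "i < length w"
        then show "ixs w ! (2 * i) = ixs w' ! (2 * \<pi> i) \<and> ixs w ! Suc (2 * i) = ixs w' ! Suc (2 * \<pi> i)"
          using L[rule_format, of "2 * i"] L[rule_format, of "Suc (2 * i)"] by (simp add: blockmap_def)
      qed
    next
      assume R: ?R
      show ?L
      proof (intro allI impI)
        fix x assume "x < 2 * length w"
        then have "x div 2 < length w" by simp
        note r = R[rule_format, OF this]
        show "ixs w ! x = ixs w' ! blockmap \<pi> x"
        proof (cases "even x")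
          case True
          then show ?thesis using r by (simp add: blockmap_def)
        next
          case False
          then have "Suc (2 * (x div 2)) = x" "x mod 2 = 1" by presburger+
          then show ?thesis using r by (simp add: blockmap_def)
        qed
      qed
    qed
    then show ?thesis
      unfolding perm_diagram_through sat_through using l pi by (auto simp: nth_ixs prod_eq_iff)
  qed
  moreover have "perm_idx \<pi> (tix w) = tix w' \<longleftrightarrow> (\<forall>i<length w. fst (w ! i) = fst (w' ! \<pi> i))"
    unfolding perm_idx_plist using l pi by (subst pl) (simp_all add: tix_def)
  ultimately show ?thesis
    unfolding pl[OF refl l] by (auto simp: prod_eq_iff)
qed

text \<open>A permutation diagram is satisfied exactly when it carries the atoms of \<open>w\<close>
  to those of \<open>w'\<close>, so the entries count permutations with their Koszul signs.\<close>

lemma cf_symmetrizer: "fact (length w') * cf n (symmetrizer (tix w)) (ixs w) w' = psum w w'"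
proof (cases "length w' = length w")
  case True
  have "cf n (symmetrizer (tix w)) (ixs w) w' =
     (\<Sum>\<pi> | \<pi> permutes {..<length w}. psgn \<pi> w * of_bool (plist \<pi> w = w') / fact (length w))"
    unfolding cf_def symmetrizer_def lookup_sum ev_sum
  proof (rule sum.cong)
    fix \<pi> assume "\<pi> \<in> {\<pi>. \<pi> permutes {..<length w}}"
    then have p: "\<pi> permutes {..<length w}" by simp
    show "ev n (lookup (single (perm_idx \<pi> (tix w)) (scale_mor [:perm_sign \<pi> (tix w) / fact (length (tix w)):] (mor_of (perm_diagram \<pi> (length (tix w)))))) (tix w')) (ixs w) (ixs w') =
       psgn \<pi> w * of_bool (plist \<pi> w = w') / fact (length w)"
      using sat_perm_diagram[OF p True] by (auto simp: lookup_single when_def perm_sign_psgn)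
  qed simp
  then show ?thesis by (simp add: psum_def True sum_divide_distrib[symmetric])
next
  case False
  have "lookup (symmetrizer (tix w)) (tix w') = 0"
    unfolding symmetrizer_def lookup_sum
  proof (rule sum.neutral, rule ballI)
    fix \<pi>
    have "perm_idx \<pi> (tix w) \<noteq> tix w'"
      using False by (metis length_plist perm_idx_plist tix_simps(4))
    then show "lookup (single (perm_idx \<pi> (tix w)) (scale_mor [:perm_sign \<pi> (tix w) / fact (length (tix w)):] (mor_of (perm_diagram \<pi> (length (tix w)))))) (tix w') = 0"
      by (simp add: lookup_single)
  qed
  then show ?thesis using False by (simp add: cf_def psum_length)
qed

lemma impl_symmetrizer: "impl n [] symmetrizer (\<lambda>_ s. s)"
  unfolding impl_def tmat_def
  by (auto simp: tcol_symmetrizer fock_op_id cf_symmetrizer idx_def)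

section \<open>Modes\<close>

lemma koszul_add: "koszul p (q + r) = koszul p q * koszul p r"
  by (auto simp: koszul_def)

lemma koszul_tdeg: "koszul (gen_deg x) (tdeg (tix u)) = (\<Prod>v\<leftarrow>u. kap x (gen_of v))"
  by (induction u) (simp_all add: tdeg_def koszul_add kap_def gen_of_fst, simp add: koszul_def)

lemma symm_move: "symm s \<Longrightarrow> s (p @ u # q) = (\<Prod>v\<leftarrow>p. akap u v) * s (u # p @ q)"
proof (induction p arbitrary: s)
  case (Cons v p)
  have "s ((v # p) @ u # q) = (\<Prod>v\<leftarrow>p. akap u v) * s (v # u # p @ q)"
    using Cons.IH[OF symm_ann[OF Cons.prems, of v]] by (simp add: ann_apply)
  then show ?case using symm_swap[OF Cons.prems, of v u "p @ q"] by (simp add: kap_sym)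
qed simp

abbreviation cap :: diagram where "cap \<equiv> {{Inl 0, Inl 3}, {Inl 1, Inl 2}}"

lemma cap_diagrams: "cap \<in> diagrams (adj @ adj) []"
proof (rule diagramsI)
  have o: "outp (adj @ adj) [] (Inl 0)" "\<not> outp (adj @ adj) [] (Inl 1)" "outp (adj @ adj) [] (Inl 2)" "\<not> outp (adj @ adj) [] (Inl 3)"
    by (simp_all add: outp_def adj_def eval_nat_numeral)
  have pt: "points (adj @ adj) [] = {Inl 0, Inl 1, Inl 2, Inl 3}"
    by (auto simp: points_def adj_def lessThan_Suc eval_nat_numeral)
  fix e assume "e \<in> cap"
  then consider "e = {Inl 0, Inl 3}" | "e = {Inl 2, Inl 1}" by auto
  then show "\<exists>p q. e = {p, q} \<and> p \<in> points (adj @ adj) [] \<and> q \<in> points (adj @ adj) [] \<and> outp (adj @ adj) [] p \<and> \<not> outp (adj @ adj) [] q"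
    by cases (use o pt in blast)+
next
  fix p assume "p \<in> points (adj @ adj) []"
  then have "p \<in> {Inl 0, Inl 1, Inl 2, Inl 3}" by (auto simp: points_def adj_def lessThan_Suc eval_nat_numeral)
  then consider "p = Inl 0 \<or> p = Inl 3" | "p = Inl 1 \<or> p = Inl 2" by blast
  then show "\<exists>!e. e \<in> cap \<and> p \<in> e"
  proof cases
    case 1
    then show ?thesis by (intro ex1I[of _ "{Inl 0, Inl 3}"]) auto
  next
    case 2
    then show ?thesis by (intro ex1I[of _ "{Inl 1, Inl 2}"]) auto
  qed
qed

lemma Hom0_Omega: "Omega x y \<in> Hom0 (adj @ adj) []"
  unfolding Omega_def by (intro Hom0_scale Hom0_mor_of cap_diagrams)

lemma ev_Omega: "ev n (Omega x y) [a, b, c, d] [] = Omega_coeff x y * of_bool (a = d \<and> b = c)"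
proof -
  have "sat [a, b, c, d] [] cap \<longleftrightarrow> a = d \<and> b = c"
    by (simp add: sat_insert sat_empty vals_def numeral_eq_Suc)
  then show ?thesis by (simp add: Omega_def)
qed

definition contraction_term :: "gen \<Rightarrow> tidx \<Rightarrow> nat \<Rightarrow> mor" where
  "contraction_term x l j = (let u = take j l; v = drop (Suc j) l in
       mor_tensor (tword u) (tword u) (mor_id (tword u))
          (mor_tensor (adj @ adj) [] (Omega x (fst (l ! j))) (mor_id (tword v)))
        \<circ>\<^sub>m mor_tensor (adj @ tword u) (tword u @ adj)
             (graded_braid [(x, 0)] u) (mor_id (tword (drop j l))))"

lemma contraction_eq:
  "contraction x n l = (\<Sum>j | j < length l \<and> snd (l ! j) = n.
     single (take j l @ drop (Suc j) l) (contraction_term x l j))"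
  by (simp add: contraction_def contraction_term_def Let_def)

lemma Hom0_contract:
  assumes "j < length l"
  shows "mor_tensor (tword (take j l)) (tword (take j l)) (mor_id (tword (take j l)))
      (mor_tensor (adj @ adj) [] (Omega x y) (mor_id (tword (drop (Suc j) l)))) \<in>
    Hom0 (tword (take j l) @ adj @ tword (drop j l)) (tword (take j l @ drop (Suc j) l))"
proof -
  have "tword (drop j l) = adj @ tword (drop (Suc j) l)"
    using assms by (simp flip: Cons_nth_drop_Suc)
  then show ?thesis
    using Hom0_tensor[OF Hom0_id[of "tword (take j l)"] Hom0_tensor[OF Hom0_Omega[of x y] Hom0_id[of "tword (drop (Suc j) l)"]]]
    by simp
qed

lemma Hom0_contraction_term:
  assumes "j < length l"
  shows "contraction_term x l j \<in> Hom0 (adj @ tword l) (tword (take j l @ drop (Suc j) l))"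
proof -
  have "tword l = tword (take j l) @ tword (drop j l)" by (simp flip: tword_simps(3))
  moreover have "mor_tensor (adj @ tword (take j l)) (tword (take j l) @ adj)
     (graded_braid [(x, 0)] (take j l)) (mor_id (tword (drop j l))) \<in>
     Hom0 ((adj @ tword (take j l)) @ tword (drop j l)) ((tword (take j l) @ adj) @ tword (drop j l))"
    unfolding graded_braid_def using Hom0_braid[of adj "tword (take j l)"]
    by (intro Hom0_tensor Hom0_scale Hom0_id) simp
  ultimately show ?thesis
    unfolding contraction_term_def Let_def
    using Hom0_comp[OF _ Hom0_contract[OF assms]] by simp
qed

lemma tmat_contraction: "tmat adj (contraction x n)"
  unfolding tmat_def contraction_eq
  by (intro allI tcol_sum tcol_single) (simp add: Hom0_contraction_term del: tword_simps(3))

text \<open>The braiding past \<open>p\<close> gives the Koszul sign, the pairing diagram forces the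
  removed atom to carry the transposed indices, and the identities force the other atoms to agree
  with \<open>w'\<close>.\<close>

lemma ev_contraction_term:
  assumes ab: "a < n" "b < n" and v: "smalls n (p @ y # q)" and w': "smalls n w'" and t: "tix (p @ q) = tix w'"
  shows "ev n (contraction_term x (tix (p @ y # q)) (length p)) ([a, b] @ ixs (p @ y # q)) (ixs w') =
    (\<Prod>v\<leftarrow>p. kap x (gen_of v)) * Omega_coeff x (gen_of y) * of_bool (snd y = (b, a)) * of_bool (p @ q = w')"
proof -
  let ?l = "tix (p @ y # q)"
  let ?N = "mor_tensor (adj @ adj) [] (Omega x (fst (fst y))) (mor_id (tword (tix q)))"
  let ?M = "mor_tensor (tword (tix p)) (tword (tix p)) (mor_id (tword (tix p))) ?N"
  have l: "take (length p) ?l = tix p" "drop (length p) ?l = tix (y # q)" "drop (Suc (length p)) ?l = tix q" "?l ! length p = fst y"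
    by (simp_all add: tix_def nth_append)
  have yi: "ixs (y # q) = [fst (snd y), snd (snd y)] @ ixs q" by simp
  obtain p' q' where w: "w' = p' @ q'" "tix p' = tix p" "tix q' = tix q"
  proof
    show "w' = take (length p) w' @ drop (length p) w'" by simp
    show "tix (take (length p) w') = tix p" "tix (drop (length p) w') = tix q"
      using t by (simp_all add: tix_def take_map[symmetric] drop_map[symmetric]) (simp_all flip: t[unfolded tix_def])
  qed
  then have lens: "length p' = length p" "length q' = length q" by (metis tix_simps(4))+
  have "ev n (contraction_term x ?l (length p)) ([a, b] @ ixs (p @ y # q)) (ixs w') =
    poly [:koszul (gen_deg x) (tdeg (tix p)):] (of_nat n) * ev n ?M
      (ixs p @ [a, b] @ ixs (y # q)) (ixs w')"
  proof -
    have h: "?M \<in>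
      Hom0 (tword (tix p) @ adj @ tword (tix (y # q))) (tword (tix w'))"
      using Hom0_contract[of "length p" ?l x "fst (fst y)"] unfolding l by (simp add: t[symmetric])
    have g: "graded_braid [(x, 0)] (tix p) = scale_mor [:koszul (gen_deg x) (tdeg (tix p)):] (mor_braid adj (tword (tix p)))"
      by (simp add: graded_braid_def tdeg_def)
    show ?thesis
      unfolding contraction_term_def Let_def l g ixs_simps(3)
      by (rule ev_braid_comp[OF h]) (use ab v w' ixs_idx[of n p] ixs_idx[of n "y # q"] ixs_idx[of n w'] in \<open>auto simp: idx_def simp del: ixs_simps(2)\<close>)
  qed
  also have "ev n ?M
      (ixs p @ [a, b] @ ixs (y # q)) (ixs w') =
      of_bool (ixs p = ixs p') * (Omega_coeff x (gen_of y) * of_bool (a = snd (snd y) \<and> b = fst (snd y)) * of_bool (ixs q = ixs q'))"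
  proof -
    have "ev n ?N ([a, b, fst (snd y), snd (snd y)] @ ixs q) ([] @ ixs q') =
       Omega_coeff x (gen_of y) * of_bool (a = snd (snd y) \<and> b = fst (snd y)) * of_bool (ixs q = ixs q')"
      by (subst ev_tensor[OF Hom0_Omega]) (use lens in \<open>simp_all add: ev_Omega ev_id gen_of_fst\<close>)
    moreover have "ev n ?M
      (ixs p @ [a, b, fst (snd y), snd (snd y)] @ ixs q) (ixs p' @ ixs q') =
      ev n (mor_id (tword (tix p))) (ixs p) (ixs p') *
      ev n ?N ([a, b, fst (snd y), snd (snd y)] @ ixs q) (ixs q')"
      by (rule ev_tensor) (use lens in simp_all)
    ultimately show ?thesis using lens by (simp add: w(1) ev_id)
  qed
  also have "poly [:koszul (gen_deg x) (tdeg (tix p)):] (of_nat n) = (\<Prod>v\<leftarrow>p. kap x (gen_of v))"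
    by (simp add: koszul_tdeg)
  finally show ?thesis
    using tix_ixs_eq[of p p'] tix_ixs_eq[of q q'] w lens by (auto simp: prod_eq_iff)
qed

lemma Omega_coeff_dual: "Omega_coeff x y = (if y = dual x then omega x else 0)"
  by (cases x; cases y) simp_all

text \<open>Removal is read backwards: the sum over positions removed from \<open>v\<close> becomes
  a sum over the positions of \<open>w'\<close> where inserting the dual atom gives
  \<open>v\<close>.\<close>

lemma cf_contraction:
  assumes ab: "a < n" "b < n" and v: "smalls n v" and w': "smalls n w'"
  shows "cf n (contraction x k (tix v)) ([a, b] @ ixs v) w' =
    (\<Sum>j\<le>length w'. of_bool (v = take j w' @ ((dual x, k), b, a) # drop j w') * (omega x * (\<Prod>u\<leftarrow>take j w'. kap x (gen_of u))))"
proof -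
  let ?y = "((dual x, k), b, a)"
  let ?f = "\<lambda>j. ev n (lookup (single (take j (tix v) @ drop (Suc j) (tix v)) (contraction_term x (tix v) j)) (tix w')) ([a, b] @ ixs v) (ixs w')"
  let ?g = "\<lambda>j. of_bool (v = take j w' @ ?y # drop j w') * (omega x * (\<Prod>u\<leftarrow>take j w'. kap x (gen_of u)))"
  have split: "v = take j v @ v ! j # drop (Suc j) v" if "j < length v" for j
    using that by (simp add: Cons_nth_drop_Suc)
  have "cf n (contraction x k (tix v)) ([a, b] @ ixs v) w' = (\<Sum>j | j < length v \<and> snd (fst (v ! j)) = k.
     ?f j)"
    unfolding cf_def contraction_eq lookup_sum ev_sum by (intro sum.cong) (auto simp: tix_def)
  also have "\<dots> = (\<Sum>j | j < length v \<and> snd (fst (v ! j)) = k.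
     ?g j)"
  proof (rule sum.cong[OF refl])
    fix j assume "j \<in> {j. j < length v \<and> snd (fst (v ! j)) = k}"
    then have j: "j < length v" "snd (fst (v ! j)) = k" by simp_all
    define p y q where "p = take j v" and "y = v ! j" and "q = drop (Suc j) v"
    have v_eq: "v = p @ y # q" and lp: "length p = j" using split[OF j(1)] j(1) by (simp_all add: p_def y_def q_def)
    have tt: "take j (tix v) @ drop (Suc j) (tix v) = tix (p @ q)" by (simp add: v_eq lp[symmetric] tix_def)
    have y: "fst y = (gen_of y, k)" using j(2) by (simp add: y_def gen_of_fst prod_eq_iff)
    have iff: "v = take j w' @ ?y # drop j w' \<longleftrightarrow> p @ q = w' \<and> y = ?y"
    proof
      assume *: "v = take j w' @ ?y # drop j w'"
      have "length v = Suc (length w')" unfolding * by simp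
      then have "length (take j w') = length p" using lp j by simp
      then show "p @ q = w' \<and> y = ?y" using * unfolding v_eq by (metis append_eq_append_conv append_take_drop_id list.inject)
    next
      assume "p @ q = w' \<and> y = ?y"
      then show "v = take j w' @ ?y # drop j w'" unfolding v_eq lp[symmetric] by auto
    qed
    show "?f j =
      ?g j"
    proof (cases "tix (p @ q) = tix w'")
      case True
      have "ev n (contraction_term x (tix v) j) ([a, b] @ ixs v) (ixs w') =
        (\<Prod>v\<leftarrow>p. kap x (gen_of v)) * Omega_coeff x (gen_of y) * of_bool (snd y = (b, a)) * of_bool (p @ q = w')"
        using ev_contraction_term[OF ab _ w' True, of y x] v unfolding v_eq lp[symmetric] by blast
      also have "\<dots> = of_bool (p @ q = w' \<and> y = ?y) * (omega x * (\<Prod>v\<leftarrow>p. kap x (gen_of v)))"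
        using y by (auto simp: Omega_coeff_dual prod_eq_iff)
      also have "\<dots> = ?g j"
        unfolding iff using lp by auto
      finally show ?thesis unfolding tt using True by simp
    next
      case False
      then have "p @ q \<noteq> w'" by auto
      then show ?thesis using False unfolding tt iff by (simp add: lookup_single)
    qed
  qed
  also have "\<dots> = (\<Sum>j\<le>length w'. ?g j)"
  proof (rule sum.mono_neutral_cong)
    fix j assume "j \<in> {..length w'} - {j. j < length v \<and> snd (fst (v ! j)) = k}"
    then have "v \<noteq> take j w' @ ?y # drop j w'" by (auto simp: nth_append)
    then show "?g j = 0" by simp
  next
    fix j assume j: "j \<in> {j. j < length v \<and> snd (fst (v ! j)) = k} - {..length w'}"
    have "v \<noteq> take j w' @ ?y # drop j w'"
    proof
      assume "v = take j w' @ ?y # drop j w'"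
      then have "length v = length (take j w' @ ?y # drop j w')" by (rule arg_cong)
      with j show False by (auto simp: min_def)
    qed
    then show "?g j = 0" by simp
  qed simp_all
  finally show ?thesis .
qed

lemma tmat_gen_mode: "tmat adj (gen_mode x m)"
proof (cases "m < 0")
  case True
  then show ?thesis unfolding tmat_def gen_mode_def
    using tcol_symmetrizer[of "(x, nat (- m - 1)) # l" for l] by simp
next
  case False
  have "tcol (adj @ tword l) adj (whisker adj (symmetrizer l))" for l
    by (rule tcol_whisker[OF tcol_symmetrizer])
  then show ?thesis unfolding tmat_def gen_mode_def
    using tcol_post_comp[OF _ tmat_contraction] False by simp
qed

text \<open>A creating mode is the symmetrizer on a longer word, so \<open>cre_psum\<close> applies.
  For an annihilating mode all \<open>length w' + 1\<close> insertions contribute equally, their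
  Koszul signs occurring twice, and this number turns the factorial of the longer word into that of
  \<open>w'\<close>.\<close>

lemma impl_gen_mode: "impl n adj (gen_mode x m) (\<lambda>j. mode (x, j ! 0, j ! 1) m)"
  unfolding impl_def
proof (intro conjI ballI allI impI)
  show "tmat adj (gen_mode x m)" by (rule tmat_gen_mode)
  fix j assume "j \<in> idx n (length adj)"
  then obtain a b where j: "j = [a, b]" "a < n" "b < n"
    by (auto simp: idx_def length_Suc_conv numeral_2_eq_2)
  then show "fock_op n (mode (x, j ! 0, j ! 1) m)" by (intro fock_op_mode) simp
  fix w w' assume w: "smalls n w" and w': "smalls n w'"
  show "fact (length w') * cf n (gen_mode x m (tix w)) (j @ ixs w) w' = mode (x, j ! 0, j ! 1) m (psum w) w'"
  proof (cases "m < 0")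
    case True
    have "fact (length w') * cf n (symmetrizer (tix (((x, nat (- m - 1)), a, b) # w))) (ixs (((x, nat (- m - 1)), a, b) # w)) w' =
        psum (((x, nat (- m - 1)), a, b) # w) w'"
      by (rule cf_symmetrizer)
    then show ?thesis using True by (simp add: gen_mode_def j mode.simps cre_psum)
  next
    case False
    let ?k = "nat m" and ?V = "\<Union>l\<in>keys (symmetrizer (tix w)). atoms n l"
    let ?y = "((dual x, ?k), b, a)" 
    let ?t = "\<lambda>i. take i w' @ ?y # drop i w'" and ?k' = "\<lambda>i. \<Prod>u\<leftarrow>take i w'. kap x (gen_of u)"
    have "cf n (post_comp (contraction x ?k) (whisker adj (symmetrizer (tix w)))) ([a, b] @ ixs w) w' =
      (\<Sum>v\<in>?V. cf n (symmetrizer (tix w)) (ixs w) v * cf n (contraction x ?k (tix v)) ([a, b] @ ixs v) w')"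
      by (rule cf_whisker_comp[OF tmat_contraction tcol_symmetrizer _ _ w']) (use ixs_idx[OF w] j in \<open>simp_all add: idx_def\<close>)
    also have "\<dots> = (\<Sum>v\<in>?V. \<Sum>i\<le>length w'. if v = ?t i then psum w v / fact (length v) * (omega x * ?k' i) else 0)"
    proof (rule sum.cong[OF refl])
      fix v assume "v \<in> ?V"
      then have v: "smalls n v" by (auto simp: atoms_def)
      have s: "cf n (symmetrizer (tix w)) (ixs w) v = psum w v / fact (length v)"
        using cf_symmetrizer[of v n w] by (simp add: field_simps)
      show "cf n (symmetrizer (tix w)) (ixs w) v * cf n (contraction x ?k (tix v)) ([a, b] @ ixs v) w' =
        (\<Sum>i\<le>length w'. if v = ?t i then psum w v / fact (length v) * (omega x * ?k' i) else 0)"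
        unfolding s cf_contraction[OF j(2,3) v w'] sum_distrib_left by (intro sum.cong refl) simp
    qed
    also have "\<dots> = (\<Sum>i\<le>length w'. \<Sum>v\<in>?V. if v = ?t i then psum w v / fact (length v) * (omega x * ?k' i) else 0)"
      by (rule sum.swap)
    also have "\<dots> = (\<Sum>i\<le>length w'. omega x * psum w (?y # w') / fact (Suc (length w')))"
    proof (rule sum.cong[OF refl])
      fix i assume "i \<in> {..length w'}"
      let ?v = "?t i"
      have "smalls n (take i w' @ drop i w')" using w' by simp
      then have sv: "smalls n ?v" using j unfolding list_all_append by simp
      have "psum w ?v = 0" if "?v \<notin> ?V"
      proof -
        have "tix ?v \<notin> keys (symmetrizer (tix w))" using that sv unfolding atoms_def by blast
        then have "cf n (symmetrizer (tix w)) (ixs w) ?v = 0" by (simp only: cf_def in_keys_iff not_not ev_zero)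
        then show ?thesis using cf_symmetrizer[of ?v n w] by simp
      qed
      then have "(\<Sum>v\<in>?V. if v = ?v then psum w v / fact (length v) * (omega x * ?k' i) else 0) =
         psum w ?v / fact (length ?v) * (omega x * ?k' i)"
        by (subst sum.delta) auto
      also have "psum w ?v = ?k' i * psum w (?y # w')"
        using symm_move[OF psymm_symm[OF psymm_psum], of w "take i w'" ?y "drop i w'"] by simp
      also have "length ?v = Suc (length w')" by simp
      also have "?k' i * psum w (?y # w') / fact (Suc (length w')) * (omega x * ?k' i) =
        omega x * psum w (?y # w') / fact (Suc (length w'))"
      proof -
        have "(\<Prod>u\<leftarrow>z. kap x (gen_of u)) * (\<Prod>u\<leftarrow>z. kap x (gen_of u)) = 1" for z
          by (induction z) (simp_all add: mult_ac)
        then show ?thesis by (simp add: mult_ac)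
      qed
      finally show "(\<Sum>v\<in>?V. if v = ?v then psum w v / fact (length v) * (omega x * ?k' i) else 0) =
        omega x * psum w (?y # w') / fact (Suc (length w'))" .
    qed
    also have "fact (length w') * \<dots> = omega x * psum w (?y # w')"
      by (simp add: field_simps del: of_nat_Suc)
    finally show ?thesis using False by (simp add: gen_mode_def j mode.simps ann_apply)
  qed
qed

section \<open>Normally ordered products as sums of modes, matched with the recursions\<close>

section \<open>Normally ordered products\<close>

lemma mode_zero: "mode y m (\<lambda>_. 0) w = 0"
  using linear_op_scale[OF linear_op_mode[of y m], of 0 "\<lambda>_. 0" w] by simp

lemma mode_neg_Nil: "p < 0 \<Longrightarrow> mode y p s [] = 0"
  by (cases y) (simp add: mode.simps)

lemma mode_mode_Nil:
  assumes "symm s" "p \<ge> 0" "q \<ge> 0"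
  shows "mode y1 p (mode y2 q s) [] = kap (fst y1) (fst y2) * mode y2 q (mode y1 p s) []"
proof -
  obtain x1 a1 b1 x2 a2 b2 where y: "y1 = (x1, a1, b1)" "y2 = (x2, a2, b2)"
    by (metis surj_pair)
  show ?thesis
    using symm_swap[OF assms(1), of "((dual x2, nat q), b2, a2)" "((dual x1, nat p), b1, a1)" "[]"] assms(2,3)
    by (simp add: y mode.simps ann_apply kap_sym)
qed

lemma ann_mode:
  assumes "symm s"
  shows "ann u (mode y m s) = (\<lambda>w. (if lab u = y \<and> m = - int (lev u) - 1 then s w else 0) +
           kap (gen_of u) (fst y) * mode y m (ann u s) w)"
  using mode_Cons[OF assms] by (auto simp: ann_apply fun_eq_iff simp del: split_paired_All)

text \<open>Summation over all modes without a topology: on each word the finite sums become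
  constant. The set \<open>R\<close> depends on the word but not on \<open>s\<close>, so an
  induction on the word can pass from \<open>s\<close> to \<open>ann u s\<close>.\<close>

definition sums_to :: "(int \<Rightarrow> fock \<Rightarrow> fock) \<Rightarrow> (fock \<Rightarrow> fock) \<Rightarrow> bool" where
  "sums_to F G \<longleftrightarrow> (\<forall>w. \<exists>R. finite R \<and>
     (\<forall>R' s. finite R' \<longrightarrow> R \<subseteq> R' \<longrightarrow> symm s \<longrightarrow> (\<Sum>p\<in>R'. F p s w) = G s w))"

lemma sums_toE:
  assumes "sums_to F G"
  obtains R where "finite R" "\<And>R' s. finite R' \<Longrightarrow> R \<subseteq> R' \<Longrightarrow> symm s \<Longrightarrow> (\<Sum>p\<in>R'. F p s w) = G s w"
proof -
  from assms obtain R where "finite R"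
    and "\<forall>R' s. finite R' \<longrightarrow> R \<subseteq> R' \<longrightarrow> symm s \<longrightarrow> (\<Sum>p\<in>R'. F p s w) = G s w"
    unfolding sums_to_def by (elim allE[of _ w] exE conjE) (rule that)
  then show ?thesis using that by blast
qed

definition ordered2 :: "label \<Rightarrow> label \<Rightarrow> int \<Rightarrow> int \<Rightarrow> fock \<Rightarrow> fock" where
  "ordered2 y1 y2 m p s w = (if p < 0 then mode y1 p (mode y2 (m - p - 1) s) w
     else kap (fst y1) (fst y2) * mode y2 (m - p - 1) (mode y1 p s) w)"

text \<open>The first letter is created by \<open>y1\<close> for \<open>p = - lev u - 1\<close>, and
  by \<open>y2\<close> when its mode \<open>m - p - 1\<close> has that value, that is for
  \<open>p = m + lev u\<close>.\<close>

lemma ordered2_Cons: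
  assumes s: "symm s"
  shows "ordered2 y1 y2 m p s (u # w) =
    (if p = - int (lev u) - 1 then if lab u = y1 then mode y2 (m + int (lev u)) s w else 0 else 0) +
    (if p = m + int (lev u) then kap (gen_of u) (fst y1) * (if lab u = y2 then mode y1 (m + int (lev u)) s w else 0) else 0) +
    kap (gen_of u) (fst y1) * kap (gen_of u) (fst y2) * ordered2 y1 y2 m p (ann u s) w"
proof -
  have l: "mode y p (\<lambda>w. (if P then s w else 0) + c * t w) w = (if P then mode y p s w else 0) + c * mode y p t w" for y p P c t w
    unfolding linear_op_add[OF linear_op_mode] linear_op_scale[OF linear_op_mode] by (simp add: mode_zero)
  have e: "m - p - 1 = - int (lev u) - 1 \<longleftrightarrow> p = m + int (lev u)" by auto
  show ?thesis
  proof (cases "p < 0")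
    case True
    then show ?thesis
      unfolding ordered2_def mode_Cons[OF symm_mode[OF s]] ann_mode[OF s] l e
      by (auto simp: algebra_simps)
  next
    case False
    then have "p \<noteq> - int (lev u) - 1" by simp
    with False show ?thesis
      unfolding ordered2_def mode_Cons[OF symm_mode[OF s]] ann_mode[OF s] l e
      by (auto simp: gen_of_lab kap_sym algebra_simps)
  qed
qed

lemma sum_ordered2: "sums_to (ordered2 y1 y2 m) (pair_op y1 y2 m)"
  unfolding sums_to_def
proof (rule allI)
  fix w show "\<exists>R. finite R \<and> (\<forall>R' s. finite R' \<longrightarrow> R \<subseteq> R' \<longrightarrow> symm s \<longrightarrow> (\<Sum>p\<in>R'. ordered2 y1 y2 m p s w) = pair_op y1 y2 m s w)"
  proof (induction w)
  case Nil
  show ?case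
  \<comment> \<open>A creating mode gives 0 on the empty word, so \<open>p\<close> and
    \<open>m - p - 1\<close> must both be non-negative.\<close>
  proof (intro exI[of _ "{0..<m}"] conjI allI impI)
    fix R' and s :: fock assume R': "finite R'" "{0..<m} \<subseteq> R'" and s: "symm s"
    have "(\<Sum>p\<in>R'. ordered2 y1 y2 m p s []) = (\<Sum>p\<in>{0..<m}. ordered2 y1 y2 m p s [])"
    proof (rule sum.mono_neutral_right[OF R'])
      show "\<forall>p\<in>R' - {0..<m}. ordered2 y1 y2 m p s [] = 0"
        by (auto simp: ordered2_def mode_neg_Nil)
    qed
    also have "\<dots> = (\<Sum>p\<in>{0..<m}. mode y1 p (mode y2 (m - p - 1) s) [])"
    proof (rule sum.cong[OF refl])
      fix p assume "p \<in> {0..<m}"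
      then show "ordered2 y1 y2 m p s [] = mode y1 p (mode y2 (m - p - 1) s) []"
        using mode_mode_Nil[OF s, of p "m - p - 1" y1 y2] by (simp add: ordered2_def)
    qed
    also have "\<dots> = (\<Sum>q<nat m. mode y1 (int q) (mode y2 (m - 1 - int q) s) [])"
      by (rule sum.reindex_bij_witness[where i = int and j = nat]) (auto simp: algebra_simps)
    finally show "(\<Sum>p\<in>R'. ordered2 y1 y2 m p s []) = pair_op y1 y2 m s []" by simp
  qed simp
next
  case (Cons u w)
  then obtain R where R: "finite R" "\<And>R' s. finite R' \<Longrightarrow> R \<subseteq> R' \<Longrightarrow> symm s \<Longrightarrow> (\<Sum>p\<in>R'. ordered2 y1 y2 m p s w) = pair_op y1 y2 m s w"
    by blast
  show ?case
  proof (intro exI[of _ "R \<union> {- int (lev u) - 1, m + int (lev u)}"] conjI allI impI)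
    fix R' and s :: fock assume R': "finite R'" "R \<union> {- int (lev u) - 1, m + int (lev u)} \<subseteq> R'" and s: "symm s"
    have "(\<Sum>p\<in>R'. ordered2 y1 y2 m p (ann u s) w) = pair_op y1 y2 m (ann u s) w"
      using R(2)[OF R'(1)] R'(2) s by simp
    then show "(\<Sum>p\<in>R'. ordered2 y1 y2 m p s (u # w)) = pair_op y1 y2 m s (u # w)"
      using R' by (simp add: ordered2_Cons[OF s] sum.distrib flip: sum_distrib_left)
  qed (use R(1) in simp)
  qed
qed

definition ordered3 :: "label \<Rightarrow> label \<Rightarrow> label \<Rightarrow> int \<Rightarrow> fock \<Rightarrow> fock" where
  "ordered3 y1 y2 y3 p s w = (if p < 0 then mode y1 p (pair_op y2 y3 (- p - 1) s) w
     else kap (fst y1) (fst y2) * kap (fst y1) (fst y3) * pair_op y2 y3 (- p - 1) (mode y1 p s) w)"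

lemma ann_pair_op:
  "ann u (pair_op y1 y2 m s) = (\<lambda>w. (if lab u = y1 then mode y2 (m + int (lev u)) s w else 0) +
     kap (gen_of u) (fst y1) * (if lab u = y2 then mode y1 (m + int (lev u)) s w else 0) +
     kap (gen_of u) (fst y1) * kap (gen_of u) (fst y2) * pair_op y1 y2 m (ann u s) w)"
  by (simp add: ann_apply fun_eq_iff del: split_paired_All)

lemma ordered3_Cons:
  assumes s: "symm s"
  shows "ordered3 y1 y2 y3 p s (u # w) =
    (if p = - int (lev u) - 1 then if lab u = y1 then pair_op y2 y3 (int (lev u)) s w else 0 else 0) +
    kap (gen_of u) (fst y1) * (if lab u = y2 then ordered2 y1 y3 (int (lev u)) p s w else 0) +
    kap (gen_of u) (fst y1) * kap (gen_of u) (fst y2) * (if lab u = y3 then ordered2 y1 y2 (int (lev u)) p s w else 0) +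
    kap (gen_of u) (fst y1) * kap (gen_of u) (fst y2) * kap (gen_of u) (fst y3) * ordered3 y1 y2 y3 p (ann u s) w"
proof -
  have e: "- p - 1 + int (lev u) = int (lev u) - p - 1" by simp
  show ?thesis
  proof (cases "p < 0")
    case True
    have l: "mode y1 p (\<lambda>w. (if P then a w else 0) + c * (if P' then b w else 0) + d * t w) w =
      (if P then mode y1 p a w else 0) + c * (if P' then mode y1 p b w else 0) + d * mode y1 p t w" for P P' a b c d t w
      unfolding linear_op_add[OF linear_op_mode] linear_op_scale[OF linear_op_mode] by (simp add: mode_zero)
    have i: "(if lab u = y1 \<and> p = - int (lev u) - 1 then pair_op y2 y3 (- p - 1) s w else 0) =
       (if p = - int (lev u) - 1 then if lab u = y1 then pair_op y2 y3 (int (lev u)) s w else 0 else 0)"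
      by simp
    show ?thesis
      using True
      unfolding ordered3_def ordered2_def mode_Cons[OF symm_pair_op[OF s]] ann_pair_op l e i
      by (simp add: algebra_simps)
  next
    case False
    then have np: "p \<noteq> - int (lev u) - 1" by simp
    then have a: "ann u (mode y1 p s) = (\<lambda>w. kap (gen_of u) (fst y1) * mode y1 p (ann u s) w)"
      by (simp add: ann_mode[OF s])
    show ?thesis
      using False np
      unfolding ordered3_def ordered2_def pair_op.simps a linear_op_scale[OF linear_op_pair_op] e
      by (auto simp: gen_of_lab kap_sym algebra_simps)
  qed
qed

lemma sum_ordered3: "sums_to (ordered3 y1 y2 y3) (triple_op y1 y2 y3)"
  unfolding sums_to_def
proof (rule allI)
  fix w show "\<exists>R. finite R \<and> (\<forall>R' s. finite R' \<longrightarrow> R \<subseteq> R' \<longrightarrow> symm s \<longrightarrow> (\<Sum>p\<in>R'. ordered3 y1 y2 y3 p s w) = triple_op y1 y2 y3 s w)"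
  proof (induction w)
  case Nil
  show ?case
    \<comment> \<open>For \<open>p < 0\<close> the outer mode creates; otherwise the pair has the
      negative mode \<open>- p - 1\<close>, and its sum on the empty word is empty. Every term
      vanishes.\<close>
    by (intro exI[of _ "{}"] conjI allI impI) (auto intro!: sum.neutral simp: ordered3_def mode_neg_Nil)
next
  case (Cons u w)
  then obtain R where R: "finite R" "\<And>R' s. finite R' \<Longrightarrow> R \<subseteq> R' \<Longrightarrow> symm s \<Longrightarrow> (\<Sum>p\<in>R'. ordered3 y1 y2 y3 p s w) = triple_op y1 y2 y3 s w"
    by blast
  obtain R3 where R3: "finite R3" "\<And>R' s. finite R' \<Longrightarrow> R3 \<subseteq> R' \<Longrightarrow> symm s \<Longrightarrow> (\<Sum>p\<in>R'. ordered2 y1 y3 (int (lev u)) p s w) = pair_op y1 y3 (int (lev u)) s w"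
    by (rule sums_toE[OF sum_ordered2]) blast
  obtain R2 where R2: "finite R2" "\<And>R' s. finite R' \<Longrightarrow> R2 \<subseteq> R' \<Longrightarrow> symm s \<Longrightarrow> (\<Sum>p\<in>R'. ordered2 y1 y2 (int (lev u)) p s w) = pair_op y1 y2 (int (lev u)) s w"
    by (rule sums_toE[OF sum_ordered2]) blast
  show ?case
  proof (intro exI[of _ "R \<union> R2 \<union> R3 \<union> {- int (lev u) - 1}"] conjI allI impI)
    fix R' and s :: fock assume R': "finite R'" "R \<union> R2 \<union> R3 \<union> {- int (lev u) - 1} \<subseteq> R'" and s: "symm s"
    have "(\<Sum>p\<in>R'. ordered3 y1 y2 y3 p (ann u s) w) = triple_op y1 y2 y3 (ann u s) w"
      using R(2)[OF R'(1)] R'(2) s by simp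
    moreover have "(\<Sum>p\<in>R'. ordered2 y1 y3 (int (lev u)) p s w) = pair_op y1 y3 (int (lev u)) s w"
      using R3(2)[OF R'(1)] R'(2) s by simp
    moreover have "(\<Sum>p\<in>R'. ordered2 y1 y2 (int (lev u)) p s w) = pair_op y1 y2 (int (lev u)) s w"
      using R2(2)[OF R'(1)] R'(2) s by simp
    ultimately show "(\<Sum>p\<in>R'. ordered3 y1 y2 y3 p s (u # w)) = triple_op y1 y2 y3 s (u # w)"
      using R' by (simp add: ordered3_Cons[OF s] sum.distrib sum_if_const flip: sum_distrib_left)
  qed (use R(1) R2(1) R3(1) in simp)
  qed
qed

section \<open>Realization of the vertex operators of up to three generators\<close>

section \<open>Vertex operators\<close>

lemma deriv_mode_zero: "deriv_mode (x, 0) = gen_mode x"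
proof (intro ext)
  fix m l
  have "scale_mor [:1:] f = f" for f by (rule poly_mapping_eqI) (simp add: one_pCons[symmetric])
  then show "deriv_mode (x, 0) m l = gen_mode x m l"
    by (intro poly_mapping_eqI) (simp add: deriv_mode_def lookup_map)
qed

lemma post_comp_zero [simp]: "post_comp G 0 = 0"
  by (simp add: post_comp_def)

lemma post_comp_eq_zero: "(\<And>l. l \<in> keys f \<Longrightarrow> G l = 0) \<Longrightarrow> post_comp G f = 0"
  unfolding post_comp_def by (intro sum.neutral ballI poly_mapping_eqI) (simp add: lookup_map)

lemma whisker_zero [simp]: "whisker W 0 = 0"
  by (intro poly_mapping_eqI) (simp add: lookup_whisker)

lemma pre_comp_zero [simp]: "pre_comp 0 h = 0"
  by (intro poly_mapping_eqI) (simp add: lookup_pre_comp)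

lemma keys_whisker: "keys (whisker W f) \<subseteq> keys f"
  by (auto simp: in_keys_iff lookup_whisker)

text \<open>A column of the symmetrizer has finitely many entries, hence bounded levels, and a
  higher annihilating mode finds no partner.\<close>

lemma gen_mode_vanish: "\<exists>P\<ge>0. \<forall>p\<ge>P. gen_mode x p l = 0"
proof -
  define B where "B = (\<Union>l'\<in>keys (symmetrizer l). snd ` set l')"
  have "finite B" by (simp add: B_def)
  then obtain M where M: "\<And>b. b \<in> B \<Longrightarrow> b < M" by (auto simp: finite_nat_set_iff_bounded)
  have "gen_mode x p l = 0" if "p \<ge> int M" for p
  proof -
    have "contraction x (nat p) l' = 0" if "l' \<in> keys (whisker adj (symmetrizer l))" for l'
    proof -
      have "l' \<in> keys (symmetrizer l)" by (rule subsetD[OF keys_whisker that])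
      then have "snd (l' ! j) < M" if "j < length l'" for j using that by (intro M) (auto simp: B_def intro!: bexI[of _ l'])
      then have "{j. j < length l' \<and> snd (l' ! j) = nat p} = {}" using \<open>p \<ge> int M\<close> by force
      then show ?thesis unfolding contraction_eq by (simp only: sum.empty)
    qed
    then show ?thesis using that by (simp add: gen_mode_def post_comp_eq_zero)
  qed
  then show ?thesis by (intro exI[of _ "int M"]) simp
qed

definition vertex_term :: "gen \<times> nat \<Rightarrow> tidx \<Rightarrow> int \<Rightarrow> int \<Rightarrow> (tidx, tidx) mat" where
  "vertex_term y ys m p l = (if p < 0 then
       post_comp (deriv_mode y p) (whisker adj (vertex_op ys (m - p - 1) l))
     else
       pre_comp
         (post_comp (vertex_op ys (m - p - 1)) (whisker (tword ys) (deriv_mode y p l)))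
         (mor_tensor (adj @ tword ys) (tword ys @ adj)
            (graded_braid [y] ys) (mor_id (tword l))))"

lemma vertex_op_Cons: "vertex_op (y # ys) m l = Sum_any (\<lambda>p. vertex_term y ys m p l)"
  by (simp add: vertex_term_def)

abbreviation plain :: "gen list \<Rightarrow> tidx" where "plain xs \<equiv> map (\<lambda>x. (x, 0)) xs"

text \<open>The bound for \<open>x # xs\<close> must be uniform over the words produced by the
  annihilating modes of \<open>x\<close>. There are finitely many of them: \<open>P\<close> bounds
  these modes and \<open>M\<close> the bounds for their results.\<close>

lemma vertex_op_vanish: "\<exists>B. \<forall>q\<ge>B. vertex_op (plain xs) q l = 0"
proof (induction xs arbitrary: l)
  case Nil
  show ?case by (rule exI[of _ 0]) simp
next
  case (Cons x xs)
  obtain B1 where B1: "\<And>q. q \<ge> B1 \<Longrightarrow> vertex_op (plain xs) q l = 0" using Cons.IH by blast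
  obtain P where P: "P \<ge> 0" "\<And>p. p \<ge> P \<Longrightarrow> gen_mode x p l = 0" using gen_mode_vanish by blast
  define L where "L = (\<Union>p\<in>{0..<P}. keys (gen_mode x p l))"
  have fL: "finite L" by (simp add: L_def)
  obtain Bf where Bf: "\<And>l' q. q \<ge> Bf l' \<Longrightarrow> vertex_op (plain xs) q l' = 0" using Cons.IH by metis
  define M where "M = Max (insert 0 (Bf ` L))"
  have M: "Bf l' \<le> M" if "l' \<in> L" for l' using that fL by (simp add: M_def)
  have "vertex_term (x, 0) (plain xs) q p l = 0" if q: "q \<ge> max B1 (M + P)" for q p
  proof (cases "p < 0")
    case True
    then have "vertex_op (plain xs) (q - p - 1) l = 0" using q by (intro B1) simp
    then show ?thesis using True by (simp add: vertex_term_def)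
  next
    case False
    have "post_comp (vertex_op (plain xs) (q - p - 1)) (whisker (tword (plain xs)) (gen_mode x p l)) = 0"
    proof (cases "p \<ge> P")
      case True
      then show ?thesis using P(2) by simp
    next
      case p: False
      show ?thesis
      proof (rule post_comp_eq_zero)
        fix l' assume "l' \<in> keys (whisker (tword (plain xs)) (gen_mode x p l))"
        then have "l' \<in> L" using keys_whisker False p unfolding L_def by fastforce
        with M[OF this] p q show "vertex_op (plain xs) (q - p - 1) l' = 0" by (intro Bf) simp
      qed
    qed
    then show ?thesis using False by (simp add: vertex_term_def deriv_mode_zero)
  qed
  then show ?case
    by (intro exI[of _ "max B1 (M + P)"]) (simp add: vertex_op_Cons del: vertex_op.simps(2))
qed

text \<open>\<open>Sum_any\<close> is 0 on an infinite support, so finiteness is what makes it the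
  actual sum. Very negative \<open>p\<close> push the other factors to modes that vanish, and large
  \<open>p\<close> make the mode of \<open>x\<close> vanish.\<close>

lemma finite_vertex_term: "finite {p. vertex_term (x, 0) (plain xs) m p l \<noteq> 0}"
proof -
  obtain B where B: "\<And>q. q \<ge> B \<Longrightarrow> vertex_op (plain xs) q l = 0" using vertex_op_vanish by blast
  obtain P where P: "P \<ge> 0" "\<And>p. p \<ge> P \<Longrightarrow> gen_mode x p l = 0" using gen_mode_vanish by blast
  have "vertex_term (x, 0) (plain xs) m p l = 0" if "p \<notin> {min 0 (m - B)..<P}" for p
  proof (cases "p < 0")
    case True
    with that P(1) have "m - p - 1 \<ge> B" by auto
    then show ?thesis using B True by (simp add: vertex_term_def)
  next
    case False
    with that have "p \<ge> P" by auto
    then show ?thesis using P(2) False by (simp add: vertex_term_def deriv_mode_zero)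
  qed
  then have "{p. vertex_term (x, 0) (plain xs) m p l \<noteq> 0} \<subseteq> {min 0 (m - B)..<P}" by blast
  then show ?thesis by (rule finite_subset) simp
qed

lemma tmat_Sum_any:
  assumes "\<And>p. tmat W (T p)"
  shows "tmat W (\<lambda>l. Sum_any (\<lambda>p. T p l))"
  using assms unfolding tmat_def Sum_any.expand_set by (blast intro: tcol_sum)

lemma impl_Sum_any:
  assumes T: "\<And>p. impl n W (T p) (F p)"
    and fin: "\<And>l. finite {p. T p l \<noteq> 0}"
    and op: "\<And>j. j \<in> idx n (length W) \<Longrightarrow> fock_op n (G j)"
    and sum: "\<And>j. j \<in> idx n (length W) \<Longrightarrow> sums_to (\<lambda>p. F p j) (G j)"
  shows "impl n W (\<lambda>l. Sum_any (\<lambda>p. T p l)) G"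
  unfolding impl_def
proof (intro conjI ballI allI impI)
  show "tmat W (\<lambda>l. Sum_any (\<lambda>p. T p l))" using implD(1)[OF T] by (rule tmat_Sum_any)
  fix j assume j: "j \<in> idx n (length W)"
  show "fock_op n (G j)" by (rule op[OF j])
  fix w w' assume w: "smalls n w" and w': "smalls n w'"
  obtain R where R1: "finite R"
    and R2: "\<And>R' s. finite R' \<Longrightarrow> R \<subseteq> R' \<Longrightarrow> symm s \<Longrightarrow> (\<Sum>p\<in>R'. F p j s w') = G j s w'"
    by (rule sums_toE[OF sum[OF j]]) blast
  define R' where "R' = R \<union> {p. T p (tix w) \<noteq> 0}"
  have R': "finite R'" using R1 fin by (simp add: R'_def)
  have "Sum_any (\<lambda>p. T p (tix w)) = (\<Sum>p\<in>R'. T p (tix w))"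
    by (rule Sum_any.expand_superset[OF R']) (auto simp: R'_def)
  then have "fact (length w') * cf n (Sum_any (\<lambda>p. T p (tix w))) (j @ ixs w) w' = (\<Sum>p\<in>R'. fact (length w') * cf n (T p (tix w)) (j @ ixs w) w')"
    by (simp add: cf_sum sum_distrib_left)
  also have "\<dots> = (\<Sum>p\<in>R'. F p j (psum w) w')"
    using implD(3)[OF T j w w'] by simp
  also have "\<dots> = G j (psum w) w'"
    using R2[OF R' _ psymm_symm[OF psymm_psum]] by (simp add: R'_def)
  finally show "fact (length w') * cf n (Sum_any (\<lambda>p. T p (tix w))) (j @ ixs w) w' = G j (psum w) w'" .
qed

lemma impl_pre_comp:
  assumes H: "impl n (U @ W) H F"
  shows "impl n (W @ U) (\<lambda>l. pre_comp (H l) (mor_tensor (W @ U) (U @ W) (scale_mor [:c:] (mor_braid W U)) (mor_id (tword l))))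
    (\<lambda>j s w. c * F (drop (length W) j @ take (length W) j) s w)"
  unfolding impl_def
proof (intro conjI ballI allI impI)
  have th: "tcol (U @ W @ tword l) [] (H l)" for l using implD(1)[OF H] by (simp add: tmat_def)
  have h: "mor_tensor (W @ U) (U @ W) (scale_mor [:c:] (mor_braid W U)) (mor_id (tword l)) \<in> Hom0 (W @ U @ tword l) (U @ W @ tword l)" for l
    using Hom0_tensor[OF Hom0_scale[OF Hom0_braid[of W U]] Hom0_id[of "tword l"]] by simp
  show "tmat (W @ U) (\<lambda>l. pre_comp (H l) (mor_tensor (W @ U) (U @ W) (scale_mor [:c:] (mor_braid W U)) (mor_id (tword l))))"
    unfolding tmat_def append_assoc using tcol_pre_comp[OF th h] by blast
  fix j assume j: "j \<in> idx n (length (W @ U))"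
  define j1 j2 where "j1 = take (length W) j" and "j2 = drop (length W) j"
  have jj: "j = j1 @ j2" "j1 \<in> idx n (length W)" "j2 \<in> idx n (length U)"
    using j by (auto simp: j1_def j2_def idx_def dest: in_set_takeD in_set_dropD)
  have j': "j2 @ j1 \<in> idx n (length (U @ W))" using jj by (auto simp: idx_def)
  show "fock_op n (\<lambda>s w. c * F (drop (length W) j @ take (length W) j) s w)"
    unfolding j1_def[symmetric] j2_def[symmetric] by (rule fock_op_mult[OF implD(2)[OF H j']])
  fix w w' assume w: "smalls n w" and w': "smalls n w'"
  have "cf n (pre_comp (H (tix w)) (mor_tensor (W @ U) (U @ W) (scale_mor [:c:] (mor_braid W U)) (mor_id (tword (tix w))))) (j @ ixs w) w' =
    poly [:c:] (of_nat n) * ev n (lookup (H (tix w)) (tix w')) (j2 @ j1 @ ixs w) (ixs w')"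
    unfolding cf_def lookup_pre_comp jj(1) append_assoc
    by (rule ev_braid_comp[where z = "tword (tix w')"]) (use th[of "tix w"] jj ixs_idx[OF w] ixs_idx[OF w'] in \<open>simp_all add: tcol_def\<close>)
  then show "fact (length w') * cf n (pre_comp (H (tix w)) (mor_tensor (W @ U) (U @ W) (scale_mor [:c:] (mor_braid W U)) (mor_id (tword (tix w))))) (j @ ixs w) w' =
    c * F (drop (length W) j @ take (length W) j) (psum w) w'"
    using implD(3)[OF H j' w w'] by (simp add: cf_def j1_def[symmetric] j2_def[symmetric])
qed

definition ordered_term :: "gen \<Rightarrow> complex \<Rightarrow> (int \<Rightarrow> nat list \<Rightarrow> fock \<Rightarrow> fock) \<Rightarrow> int \<Rightarrow> nat list \<Rightarrow> int \<Rightarrow> fock \<Rightarrow> fock" where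
  "ordered_term x c F m j p s w = (if p < 0 then mode (x, j ! 0, j ! 1) p (F (m - p - 1) (drop 2 j) s) w
     else c * F (m - p - 1) (drop 2 j) (mode (x, j ! 0, j ! 1) p s) w)"

text \<open>One level of the nested normal ordering. It reduces diagrams to functions: what remains
  to be shown is a summation of modes of functions.\<close>

lemma impl_vertex_op_Cons:
  assumes V: "\<And>q. impl n (tword (plain xs)) (vertex_op (plain xs) q) (F q)"
    and op: "\<And>j. j \<in> idx n (length (adj @ tword (plain xs))) \<Longrightarrow> fock_op n (G j)"
    and sum: "\<And>j. j \<in> idx n (length (adj @ tword (plain xs))) \<Longrightarrow>
      sums_to (ordered_term x (koszul (gen_deg x) (tdeg (plain xs))) F m j) (G j)"
  shows "impl n (tword (plain (x # xs))) (vertex_op (plain (x # xs)) m) G"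
proof -
  let ?W = "tword (plain xs)" and ?c = "koszul (gen_deg x) (tdeg (plain xs))"
  have T: "impl n (adj @ ?W) (vertex_term (x, 0) (plain xs) m p) (\<lambda>j. ordered_term x ?c F m j p)" for p
  proof (cases "p < 0")
    case True
    have "impl n (adj @ ?W) (\<lambda>l. post_comp (gen_mode x p) (whisker adj (vertex_op (plain xs) (m - p - 1) l)))
       (\<lambda>j s. mode (x, take (length adj) j ! 0, take (length adj) j ! 1) p (F (m - p - 1) (drop (length adj) j) s))"
      by (rule impl_comp[OF impl_gen_mode V])
    moreover have "(\<lambda>j. ordered_term x ?c F m j p) = (\<lambda>j s. mode (x, j ! 0, j ! 1) p (F (m - p - 1) (drop 2 j) s))"
      using True by (intro ext) (simp add: ordered_term_def)
    ultimately show ?thesis using True by (simp add: vertex_term_def[abs_def] deriv_mode_zero)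
  next
    case False
    have "impl n (?W @ adj) (\<lambda>l. post_comp (vertex_op (plain xs) (m - p - 1)) (whisker ?W (gen_mode x p l)))
       (\<lambda>j s. F (m - p - 1) (take (length ?W) j) (mode (x, drop (length ?W) j ! 0, drop (length ?W) j ! 1) p s))"
      by (rule impl_comp[OF V impl_gen_mode])
    note i = impl_pre_comp[OF this, of ?c]
    have g: "graded_braid [(x, 0)] (plain xs) = scale_mor [:?c:] (mor_braid adj ?W)"
      by (simp add: graded_braid_def tdeg_def)
    have v: "vertex_term (x, 0) (plain xs) m p = (\<lambda>l. pre_comp (post_comp (vertex_op (plain xs) (m - p - 1)) (whisker ?W (gen_mode x p l)))
       (mor_tensor (adj @ ?W) (?W @ adj) (scale_mor [:?c:] (mor_braid adj ?W)) (mor_id (tword l))))"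
      using False by (intro ext) (simp only: vertex_term_def deriv_mode_zero g if_False)
    have "take (length ?W) (drop 2 j @ take 2 j) = drop 2 j \<and> drop (length ?W) (drop 2 j @ take 2 j) = take 2 j"
      if "j \<in> idx n (length (adj @ ?W))" for j
      using that by (simp add: idx_def)
    moreover have "ordered_term x ?c F m j p = (\<lambda>s w. ?c * F (m - p - 1) (drop 2 j) (mode (x, j ! 0, j ! 1) p s) w)" for j
      using False by (intro ext) (simp add: ordered_term_def)
    ultimately show ?thesis using i False unfolding v impl_def by simp
  qed
  have "vertex_op (plain (x # xs)) m = (\<lambda>l. Sum_any (\<lambda>p. vertex_term (x, 0) (plain xs) m p l))"
    by (intro ext) (simp add: vertex_op_Cons del: vertex_op.simps)
  moreover have "impl n (adj @ ?W) (\<lambda>l. Sum_any (\<lambda>p. vertex_term (x, 0) (plain xs) m p l)) G"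
    by (rule impl_Sum_any[OF T finite_vertex_term op sum])
  ultimately show ?thesis by simp
qed

lemma impl_vertex_op_Nil: "impl n (tword (plain [])) (vertex_op (plain []) m) (\<lambda>j s. if m = - 1 then s else (\<lambda>_. 0))"
  using impl_symmetrizer[of n] by (cases "m = - 1") (simp_all add: impl_def tmat_def fock_op_zero)

lemma idx2: "j \<in> idx n (Suc (Suc k)) \<Longrightarrow> j ! 0 < n \<and> j ! 1 < n"
  by (auto simp: idx_def length_Suc_conv)

lemma impl_vertex_op1: "impl n (tword (plain [x])) (vertex_op (plain [x]) m) (\<lambda>j. mode (x, j ! 0, j ! 1) m)"
proof (rule impl_vertex_op_Cons[OF impl_vertex_op_Nil])
  fix j assume j: "j \<in> idx n (length (adj @ tword (plain [])))"
  show "fock_op n (mode (x, j ! 0, j ! 1) m)"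
    using idx2[of j n 0] j by (intro fock_op_mode) (simp add: numeral_2_eq_2)
  let ?F = "ordered_term x (koszul (gen_deg x) (tdeg (plain []))) (\<lambda>q j s. if q = - 1 then s else (\<lambda>_. 0)) m j"
  \<comment> \<open>The empty product has only the mode -1, and \<open>m - p - 1 = - 1\<close> means
    \<open>p = m\<close>.\<close>
  have F: "?F p s w = (if p = m then mode (x, j ! 0, j ! 1) p s w else 0)" for p s w
    by (auto simp: ordered_term_def mode_zero koszul_def tdeg_def)
  show "sums_to ?F (mode (x, j ! 0, j ! 1) m)"
    unfolding sums_to_def F by (intro allI exI[of _ "{m}"]) simp
qed

lemma koszul_plain: "koszul (gen_deg x) (tdeg (plain [y])) = kap x y"
  "koszul (gen_deg x) (tdeg (plain [y, z])) = kap x y * kap x z"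
  by (simp_all add: tdeg_def koszul_add kap_def)

lemma impl_vertex_op2: "impl n (tword (plain [x, y])) (vertex_op (plain [x, y]) m)
    (\<lambda>j. pair_op (x, j ! 0, j ! 1) (y, j ! 2, j ! 3) m)"
proof (rule impl_vertex_op_Cons[OF impl_vertex_op1])
  fix j assume "j \<in> idx n (length (adj @ tword (plain [y])))"
  then obtain a b c d where j: "j = [a, b, c, d]" "a < n" "b < n" "c < n" "d < n"
    by (auto simp: idx_def length_Suc_conv numeral_eq_Suc)
  then show "fock_op n (pair_op (x, j ! 0, j ! 1) (y, j ! 2, j ! 3) m)"
    by (intro fock_op_pair_op) (simp_all add: numeral_eq_Suc)
  have jn: "j ! 0 = a" "j ! 1 = b" "j ! 2 = c" "j ! 3 = d" "drop 2 j ! 0 = c" "drop 2 j ! 1 = d"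
    by (simp_all add: j numeral_eq_Suc)
  have "ordered_term x (kap x y) (\<lambda>q j. mode (y, j ! 0, j ! 1) q) m j = ordered2 (x, a, b) (y, c, d) m"
    by (intro ext) (simp only: ordered_term_def ordered2_def jn fst_conv)
  then show "sums_to (ordered_term x (koszul (gen_deg x) (tdeg (plain [y]))) (\<lambda>q j. mode (y, j ! 0, j ! 1) q) m j)
      (pair_op (x, j ! 0, j ! 1) (y, j ! 2, j ! 3) m)"
    unfolding koszul_plain jn using sum_ordered2 by simp
qed

lemma impl_vertex_op3: "impl n (tword (plain [x, y, z])) (vertex_op (plain [x, y, z]) 0)
    (\<lambda>j. triple_op (x, j ! 0, j ! 1) (y, j ! 2, j ! 3) (z, j ! 4, j ! 5))"
proof (rule impl_vertex_op_Cons[OF impl_vertex_op2])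
  fix j assume "j \<in> idx n (length (adj @ tword (plain [y, z])))"
  then obtain a b c d e f where j: "j = [a, b, c, d, e, f]" "a < n" "b < n" "c < n" "d < n" "e < n" "f < n"
    by (auto simp: idx_def length_Suc_conv numeral_eq_Suc)
  then show "fock_op n (triple_op (x, j ! 0, j ! 1) (y, j ! 2, j ! 3) (z, j ! 4, j ! 5))"
    by (intro fock_op_triple_op) (simp_all add: numeral_eq_Suc)
  have jn: "j ! 0 = a" "j ! 1 = b" "j ! 2 = c" "j ! 3 = d" "j ! 4 = e" "j ! 5 = f"
    "drop 2 j ! 0 = c" "drop 2 j ! 1 = d" "drop 2 j ! 2 = e" "drop 2 j ! 3 = f"
    by (simp_all add: j numeral_eq_Suc)
  have "ordered_term x (kap x y * kap x z) (\<lambda>q j. pair_op (y, j ! 0, j ! 1) (z, j ! 2, j ! 3) q) 0 j =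
      ordered3 (x, a, b) (y, c, d) (z, e, f)"
    by (intro ext) (simp only: ordered_term_def ordered3_def jn fst_conv, simp)
  then show "sums_to (ordered_term x (koszul (gen_deg x) (tdeg (plain [y, z]))) (\<lambda>q j. pair_op (y, j ! 0, j ! 1) (z, j ! 2, j ! 3) q) 0 j)
      (triple_op (x, j ! 0, j ! 1) (y, j ! 2, j ! 3) (z, j ! 4, j ! 5))"
    unfolding koszul_plain jn using sum_ordered3 by simp
qed

section \<open>Invariants, trace fields and nilpotency of Q\<close>

section \<open>Invariants and the BRST operator\<close>

definition state :: "nat \<Rightarrow> tidx col \<Rightarrow> fock" where
  "state n \<alpha> w = (if smalls n w then fact (length w) * cf n \<alpha> [] w else 0)"

lemma col_eqI:
  assumes f: "tcol [] [] f" and g: "tcol [] [] g" and eq: "\<And>n. state n f = state n g"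
  shows "f = g"
proof (rule poly_mapping_eqI)
  fix l
  let ?d = "lookup f l + scale_mor (- 1) (lookup g l)"
  have "?d = 0"
  proof (rule ev_faithful[where w = "tword l"])
    show "?d \<in> Hom0 [] (tword l)"
      using f g by (intro Hom0_add Hom0_scale) (simp_all add: tcol_def)
    fix n j assume "j \<in> idx n (length (tword l))"
    then have "j \<in> ixs ` atoms n l" using bij_ixs[of n l] by (simp add: bij_betw_def)
    then obtain w where w: "tix w = l" "smalls n w" "j = ixs w" by (auto simp: atoms_def)
    have "cf n f [] w = cf n g [] w"
      using fun_cong[OF eq[of n], of w] w(2) by (simp add: state_def)
    then show "ev n ?d [] j = 0" using w by (simp add: cf_def ev_add)
  qed
  then have "lookup ?d x = 0" for x by simp
  then show "lookup f l = lookup g l" by (intro poly_mapping_eqI) (simp add: lookup_add)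
qed

lemma idx_zero: "idx n 0 = {[]}"
  by (auto simp: idx_def)

lemma post_comp_symmetrizer:
  assumes "tcol [] [] \<alpha>" "fock_vec n (state n \<alpha>)"
  shows "state n (post_comp symmetrizer \<alpha>) = state n \<alpha>"
proof
  fix w show "state n (post_comp symmetrizer \<alpha>) w = state n \<alpha> w"
  proof (cases "smalls n w")
    case True
    have "fact (length w) * cf n (post_comp symmetrizer \<alpha>) [] w = (\<Sum>j\<in>idx n (length ([] :: word)). state n \<alpha> w)"
      by (rule cf_post_comp_impl[where S = "\<lambda>_. state n \<alpha>", OF impl_symmetrizer assms(1) _ True])
        (use assms(2) in \<open>auto simp: idx_zero state_def cf_def\<close>)
    then show ?thesis using True by (simp add: state_def idx_zero)
  qed (simp add: state_def)
qed

text \<open>The evaluated image of the symmetrizer is spanned by the functions \<open>psum\<close>,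
  which are symmetric and supported below \<open>n\<close>.\<close>

lemma fock_vec_post_comp_symmetrizer:
  assumes "tcol [] [] \<alpha>"
  shows "fock_vec n (state n (post_comp symmetrizer \<alpha>))"
proof -
  have eq: "state n (post_comp symmetrizer \<alpha>) = (\<lambda>w. \<Sum>v\<in>(SIGMA l:keys \<alpha>. atoms n l). cf n \<alpha> [] (snd v) * psum (snd v) w)" (is "_ = ?R")
  proof
    fix w
    show "state n (post_comp symmetrizer \<alpha>) w = ?R w"
    proof (cases "smalls n w")
      case True
      have "fact (length w) * cf n (post_comp symmetrizer \<alpha>) [] w =
        (\<Sum>l\<in>keys \<alpha>. \<Sum>v\<in>atoms n l. cf n \<alpha> [] v * (fact (length w) * cf n (symmetrizer (tix v)) (ixs v) w))"
        unfolding cf_post_comp[OF implD(1)[OF impl_symmetrizer[of n]] assms _ True, of "[]", simplified idx_zero list.size, simplified]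
        by (simp add: cf_def[of n \<alpha>] sum_distrib_left mult_ac)
      also have "\<dots> = ?R w"
        unfolding cf_symmetrizer by (subst sum.Sigma) (auto simp: case_prod_beta)
      finally show ?thesis using True by (simp add: state_def)
    next
      case False
      have "psum (snd v) w = 0" if "v \<in> (SIGMA l:keys \<alpha>. atoms n l)" for v
        using that False fock_vec_psum[of n "snd v"] by (auto simp: atoms_def fock_vec_def)
      then show ?thesis using False by (simp add: state_def)
    qed
  qed
  have fock_vec_sum: "fock_vec n (\<lambda>w. \<Sum>v\<in>V. c v * psum (snd v) w)"
    if "finite V" "\<And>v. v \<in> V \<Longrightarrow> smalls n (snd v)" for V :: "(tidx \<times> atom list) set" and c
    using that by (induction V rule: finite_induct) (simp_all add: fock_vec_zero fock_vec_plus fock_vec_scale fock_vec_psum)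
  show ?thesis
    unfolding eq by (rule fock_vec_sum) (simp, auto simp: atoms_def)
qed

text \<open>The unit law is read off from evaluation by faithfulness rather than from the stacking
  of diagrams.\<close>

lemma comp_mor_id_Nil:
  assumes "f \<in> Hom0 [] w"
  shows "f \<circ>\<^sub>m mor_id [] = f"
proof -
  let ?d = "(f \<circ>\<^sub>m mor_id []) + scale_mor (- 1) f"
  have "?d = 0"
  proof (rule ev_faithful)
    show "?d \<in> Hom0 [] w"
      using assms by (intro Hom0_add Hom0_scale Hom0_comp[OF Hom0_id])
    fix n j assume "j \<in> idx n (length w)"
    then have "ev n (f \<circ>\<^sub>m mor_id []) [] j = ev n f [] j"
      by (subst ev_comp[OF Hom0_id assms]) (simp_all add: idx_zero ev_id)
    then show "ev n ?d [] j = 0" by (simp add: ev_add)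
  qed
  then have "lookup ?d x = 0" for x by simp
  then show ?thesis by (intro poly_mapping_eqI) (simp add: lookup_add)
qed

lemma mor_of_nonzero: "mor_of d \<noteq> 0"
proof
  assume "mor_of d = 0"
  then have "lookup (mor_of d) d = 0" by simp
  then show False by (simp add: mor_of_def)
qed

lemma A_N_deg_iff:
  "\<alpha> \<in> A_N_deg k \<longleftrightarrow> (\<forall>l\<in>keys \<alpha>. tdeg l = k) \<and> tcol [] [] \<alpha> \<and> post_comp symmetrizer \<alpha> = \<alpha>"
proof -
  have nz: "mor_id [] \<noteq> 0" unfolding mor_id_def by (rule mor_of_nonzero)
  have "post_comp (\<lambda>_. \<alpha>) (single () (mor_id [])) = \<alpha>" if "tcol [] [] \<alpha>"
  proof (rule poly_mapping_eqI)
    fix l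
    have "lookup \<alpha> l \<in> Hom0 [] (tword l)" using that by (simp add: tcol_def)
    then show "lookup (post_comp (\<lambda>_. \<alpha>) (single () (mor_id []))) l = lookup \<alpha> l"
      using nz by (simp add: post_comp_def lookup_map comp_mor_id_Nil)
  qed
  then show ?thesis
    unfolding A_N_deg_def hom_deg_def unit_obj_def V_obj_def mat_comp_def tcol_def
    by (auto simp: fun_eq_iff)
qed

definition degree_part :: "int \<Rightarrow> tidx col \<Rightarrow> tidx col" where
  "degree_part k \<alpha> = (\<Sum>l\<in>{l \<in> keys \<alpha>. tdeg l = k}. single l (lookup \<alpha> l))"

lemma lookup_degree_part: "lookup (degree_part k \<alpha>) l = (if tdeg l = k then lookup \<alpha> l else 0)"
proof -
  have "lookup (degree_part k \<alpha>) l = (\<Sum>l'\<in>{l \<in> keys \<alpha>. tdeg l = k}. if l' = l then lookup \<alpha> l' else 0)"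
    unfolding degree_part_def lookup_sum by (intro sum.cong refl) (simp add: lookup_single when_def)
  then show ?thesis by (simp add: in_keys_iff)
qed

text \<open>Invariance under the symmetrizer becomes symmetry of all evaluations. Conversely a swap
  of letters preserves the degree, so the homogeneous parts are symmetric too, and faithfulness
  turns the invariance of their evaluations into that of the columns.\<close>

lemma A_N_iff: "\<alpha> \<in> A_N \<longleftrightarrow> tcol [] [] \<alpha> \<and> (\<forall>n. fock_vec n (state n \<alpha>))"
proof
  assume "\<alpha> \<in> A_N"
  then obtain K f where K: "\<alpha> = (\<Sum>k\<in>K. f k)" "finite K" "\<And>k. k \<in> K \<Longrightarrow> f k \<in> A_N_deg k"
    by (auto simp: A_N_def)
  have "tcol [] [] \<alpha>" unfolding K(1) using K(3) by (intro tcol_sum) (simp add: A_N_deg_iff)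
  moreover have "fock_vec n (state n \<alpha>)" for n
  proof -
    have "state n \<alpha> = (\<lambda>w. \<Sum>k\<in>K. state n (f k) w)"
      unfolding K(1) state_def by (auto simp: cf_sum sum_distrib_left fun_eq_iff simp del: split_paired_All)
    moreover have "fock_vec n (state n (f k))" if "k \<in> K" for k
      using fock_vec_post_comp_symmetrizer[of "f k" n] K(3)[OF that] by (simp add: A_N_deg_iff)
    with K(2) have "fock_vec n (\<lambda>w. \<Sum>k\<in>K. state n (f k) w)"
      by (induction K rule: finite_induct) (simp_all add: fock_vec_zero fock_vec_plus)
    ultimately show ?thesis by simp
  qed
  ultimately show "tcol [] [] \<alpha> \<and> (\<forall>n. fock_vec n (state n \<alpha>))" by simp
next
  assume *: "tcol [] [] \<alpha> \<and> (\<forall>n. fock_vec n (state n \<alpha>))"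
  have part: "degree_part k \<alpha> \<in> A_N_deg k" for k
    unfolding A_N_deg_iff
  proof (intro conjI ballI)
    fix l assume "l \<in> keys (degree_part k \<alpha>)"
    then show "tdeg l = k" by (simp add: in_keys_iff lookup_degree_part split: if_splits)
  next
    show t: "tcol [] [] (degree_part k \<alpha>)" using * by (simp add: tcol_def lookup_degree_part)
    have s: "state n (degree_part k \<alpha>) w = (if tdeg (tix w) = k then state n \<alpha> w else 0)" for n w
      by (simp add: state_def cf_def lookup_degree_part)
    have "fock_vec n (state n (degree_part k \<alpha>))" for n
      unfolding fock_vec_def
    proof (intro conjI allI impI symmI)
      fix p x y v
      have "tdeg (tix (p @ x # y # v)) = tdeg (tix (p @ y # x # v))" by (simp add: tdeg_def)
      then show "state n (degree_part k \<alpha>) (p @ x # y # v) = akap x y * state n (degree_part k \<alpha>) (p @ y # x # v)"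
        unfolding s using symmD[of "state n \<alpha>" p x y v] * by (simp add: fock_vec_def)
    qed (use * in \<open>simp add: s fock_vec_def\<close>)
    then show "post_comp symmetrizer (degree_part k \<alpha>) = degree_part k \<alpha>"
      using t implD(1)[OF impl_symmetrizer]
      by (intro col_eqI tcol_post_comp[where W = "[]"] post_comp_symmetrizer) auto
  qed
  have "\<alpha> = (\<Sum>k\<in>tdeg ` keys \<alpha>. degree_part k \<alpha>)"
  proof (rule poly_mapping_eqI)
    fix l
    have "lookup (\<Sum>k\<in>tdeg ` keys \<alpha>. degree_part k \<alpha>) l = (\<Sum>k\<in>tdeg ` keys \<alpha>. if tdeg l = k then lookup \<alpha> l else 0)"
      by (simp add: lookup_sum lookup_degree_part)
    also have "\<dots> = lookup \<alpha> l" by (auto simp: in_keys_iff)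
    finally show "lookup \<alpha> l = lookup (\<Sum>k\<in>tdeg ` keys \<alpha>. degree_part k \<alpha>) l" by simp
  qed
  then show "\<alpha> \<in> A_N"
    unfolding A_N_def mem_Collect_eq
    by (intro exI[of _ "tdeg ` keys \<alpha>"] exI[of _ "\<lambda>k. degree_part k \<alpha>"]) (simp add: part)
qed

abbreviation trace3 :: diagram where
  "trace3 \<equiv> {{Inr 1, Inr 2}, {Inr 3, Inr 4}, {Inr 5, Inr 0}}"

lemma Tr3: "Tr [x, y, z] = single (plain [x, y, z]) (mor_of trace3)"
proof -
  have "j < 3 \<longleftrightarrow> j = 0 \<or> j = 1 \<or> j = 2" for j :: nat by auto
  then have h: "{h j | j. j < (3::nat)} = {h 0, h 1, h 2}" for h :: "nat \<Rightarrow> (nat + nat) set" by auto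
  have l: "length [x, y, z] = 3" by simp
  show ?thesis unfolding Tr_def l h by simp
qed

lemma trace3_diagrams: "trace3 \<in> diagrams [] (tword (plain [x, y, z]))"
proof -
  let ?w = "[Bullet, Circ, Bullet, Circ, Bullet, Circ]"
  have pt: "points [] ?w = Inr ` {0, 1, 2, 3, 4, 5}"
    by (auto simp: points_def lessThan_Suc numeral_eq_Suc)
  have o: "outp [] ?w (Inr 1)" "outp [] ?w (Inr 3)" "outp [] ?w (Inr 5)"
    "\<not> outp [] ?w (Inr 0)" "\<not> outp [] ?w (Inr 2)" "\<not> outp [] ?w (Inr 4)"
    by (simp_all add: outp_def numeral_eq_Suc)
  have "trace3 \<in> diagrams [] ?w"
  proof (rule diagramsI)
    fix e assume "e \<in> trace3"
    then show "\<exists>p q. e = {p, q} \<and> p \<in> points [] ?w \<and> q \<in> points [] ?w \<and> outp [] ?w p \<and> \<not> outp [] ?w q"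
      using o unfolding pt by blast
  next
    fix p assume "p \<in> points [] ?w"
    then consider "p = Inr 1 \<or> p = Inr 2" | "p = Inr 3 \<or> p = Inr 4" | "p = Inr 5 \<or> p = Inr 0"
      unfolding pt by blast
    then show "\<exists>!e. e \<in> trace3 \<and> p \<in> e"
    proof cases
      case 1
      then show ?thesis by (intro ex1I[of _ "{Inr 1, Inr 2}"]) auto
    next
      case 2
      then show ?thesis by (intro ex1I[of _ "{Inr 3, Inr 4}"]) auto
    next
      case 3
      then show ?thesis by (intro ex1I[of _ "{Inr 5, Inr 0}"]) auto
    qed
  qed
  moreover have "tword (plain [x, y, z]) = ?w" by (simp add: adj_def)
  ultimately show ?thesis by simp
qed

lemma sat_trace3: "sat [] [a, b, c, d, e, f] trace3 \<longleftrightarrow> b = c \<and> d = e \<and> f = a"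
  by (simp add: sat_insert sat_empty vals_def numeral_eq_Suc)

lemma state_field_single:
  "v \<noteq> 0 \<Longrightarrow> state_field (single l v) m \<beta> =
    post_comp (vertex_op l m) (Poly_Mapping.map (mor_tensor [] (tword l) v) \<beta>)"
  by (simp add: state_field_def)

lemma Tr_field3: "Tr_field [x, y, z] m \<beta> = post_comp (vertex_op (plain [x, y, z]) m)
    (Poly_Mapping.map (mor_tensor [] (tword (plain [x, y, z])) (mor_of trace3)) \<beta>)"
  unfolding Tr_field_def Tr3 by (rule state_field_single[OF mor_of_nonzero])

lemma
  assumes "tcol [] [] \<beta>"
  shows tcol_Tr_field: "tcol [] [] (Tr_field [x, y, z] 0 \<beta>)"
    and cf_Tr_field: "fock_vec n (state n \<beta>) \<Longrightarrow> smalls n w \<Longrightarrow>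
      fact (length w) * cf n (Tr_field [x, y, z] 0 \<beta>) [] w = cubic n x y z (state n \<beta>) w"
proof -
  let ?W = "tword (plain [x, y, z])" and ?V = "vertex_op (plain [x, y, z]) 0"
  let ?h = "\<lambda>(a, b, e). [a, b, b, e, e, a]"
  let ?T = "\<lambda>j. triple_op (x, j ! 0, j ! 1) (y, j ! 2, j ! 3) (z, j ! 4, j ! 5)"
  let ?f = "Poly_Mapping.map (mor_tensor [] ?W (mor_of trace3)) \<beta>"
  have lf: "lookup ?f l = mor_tensor [] ?W (mor_of trace3) (lookup \<beta> l)" for l by (simp add: lookup_map)
  have tf: "tcol [] ?W ?f"
    unfolding tcol_def lf using Hom0_tensor[OF Hom0_mor_of[OF trace3_diagrams], of _ "[]"] assms
    by (fastforce simp: tcol_def)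
  show "tcol [] [] (Tr_field [x, y, z] 0 \<beta>)"
    unfolding Tr_field3 by (rule tcol_post_comp[OF tf implD(1)[OF impl_vertex_op3]])
  assume s: "fock_vec n (state n \<beta>)" and w: "smalls n w"
  \<comment> \<open>The evaluated trace diagram lets \<open>state n \<beta>\<close> through when the
    six indices match cyclically and gives zero otherwise.\<close>
  define S where "S j = (if sat [] j trace3 then state n \<beta> else (\<lambda>_. 0))" for j
  have "fact (length w) * cf n (post_comp ?V ?f) [] w =
    (\<Sum>j\<in>idx n (length ?W). ?T j (S j) w)"
  proof (rule cf_post_comp_impl[OF impl_vertex_op3 tf _ w])
    fix j assume j: "j \<in> idx n (length ?W)"
    show "fock_vec n (S j)" using s by (simp add: S_def fock_vec_zero)
    fix v assume v: "smalls n v"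
    have "ev n (mor_tensor [] ?W (mor_of trace3) (lookup \<beta> (tix v))) ([] @ []) (j @ ixs v) = ev n (mor_of trace3) [] j * ev n (lookup \<beta> (tix v)) [] (ixs v)"
      by (rule ev_tensor[OF Hom0_mor_of[OF trace3_diagrams]]) (use j in \<open>auto simp: idx_def\<close>)
    then show "S j v = fact (length v) * ev n (lookup ?f (tix v)) [] (j @ ixs v)"
      unfolding lf S_def state_def cf_def using v by simp
  qed (simp add: idx_zero)
  also have "\<dots> = (\<Sum>j\<in>idx n 6. if sat [] j trace3 then ?T j (state n \<beta>) w else 0)"
  proof (rule sum.cong)
    have "triple_op y1 y2 y3 (\<lambda>_. 0) w = 0" for y1 y2 y3
      using linear_op_scale[OF linear_op_triple_op[of y1 y2 y3], of 0 "\<lambda>_. 0" w] by simp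
    then show "?T j (S j) w =
      (if sat [] j trace3 then ?T j (state n \<beta>) w else 0)" for j
      by (simp add: S_def)
  qed simp
  also have "\<dots> = (\<Sum>j\<in>{j \<in> idx n 6. sat [] j trace3}. ?T j (state n \<beta>) w)"
    by (rule sum.inter_filter[symmetric]) simp
  also have "\<dots> = (\<Sum>(a, b, e)\<in>{..<n} \<times> {..<n} \<times> {..<n}. triple_op (x, a, b) (y, b, e) (z, e, a) (state n \<beta>) w)"
  \<comment> \<open>A cyclically matched list is determined by its entries at positions 0, 1 and 3,
    which are \<open>a\<close>, \<open>b\<close> and \<open>e\<close>.\<close>
  proof (rule sum.reindex_bij_witness[where i = ?h and j = "\<lambda>j. (j ! 0, j ! 1, j ! 3)"])
    fix j assume "j \<in> {j \<in> idx n 6. sat [] j trace3}"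
    then have "j \<in> idx n 6" and s: "sat [] j trace3" by simp_all
    then obtain a b c d e f where j: "j = [a, b, c, d, e, f]" "a < n" "b < n" "c < n" "d < n" "e < n" "f < n"
      by (auto simp: idx_def length_Suc_conv numeral_eq_Suc)
    with s have eq: "c = b" "e = d" "f = a" by (simp_all only: sat_trace3)
    have nth: "j ! 0 = a" "j ! 1 = b" "j ! 2 = b" "j ! 3 = d" "j ! 4 = d" "j ! 5 = a"
      by (simp_all add: j(1) eq numeral_eq_Suc)
    show "?h (j ! 0, j ! 1, j ! 3) = j" unfolding nth by (simp add: j eq)
    show "(j ! 0, j ! 1, j ! 3) \<in> {..<n} \<times> {..<n} \<times> {..<n}" unfolding nth using j by simp
    show "(case (j ! 0, j ! 1, j ! 3) of (a, b, e) \<Rightarrow> triple_op (x, a, b) (y, b, e) (z, e, a) (state n \<beta>) w) =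
      ?T j (state n \<beta>) w" unfolding nth by simp
  next
    fix t assume "t \<in> {..<n} \<times> {..<n} \<times> {..<n}"
    then obtain a b e where t: "t = (a, b, e)" "a < n" "b < n" "e < n" by auto
    show "(?h t ! 0, ?h t ! 1, ?h t ! 3) = t"
      by (simp add: t numeral_eq_Suc)
    show "?h t \<in> {j \<in> idx n 6. sat [] j trace3}"
      using t sat_trace3[of a b b e e a] by (simp add: idx_def)
  qed
  also have "\<dots> = cubic n x y z (state n \<beta>) w"
    unfolding cubic_def by (simp add: sum.cartesian_product)
  finally show "fact (length w) * cf n (Tr_field [x, y, z] 0 \<beta>) [] w = cubic n x y z (state n \<beta>) w"
    unfolding Tr_field3 .
qed

lemma tcol_uminus: "tcol u W f \<Longrightarrow> tcol u W (- f)"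
proof -
  have "- g = scale_mor (- 1) g" for g :: mor by (rule poly_mapping_eqI) simp
  then show "tcol u W f \<Longrightarrow> tcol u W (- f)" by (simp add: tcol_def Hom0_scale)
qed

lemma cf_diff: "cf n (f - g) i w = cf n f i w - cf n g i w"
  using cf_add[of n "f - g" g i w] by simp

lemma fock_op_brst: "fock_op n (brst n)"
proof -
  have c: "fock_op n (cubic n x y z)" for x y z
    unfolding cubic_def[abs_def] by (intro fock_op_Sum fock_op_triple_op) simp_all
  have "fock_op n (\<lambda>s w. cubic n Gen_b Gen_c Gen_c s w +
     (cubic n Gen_c Gen_Z1 Gen_Z2 s w + (- 1) * cubic n Gen_c Gen_Z2 Gen_Z1 s w))"
    by (rule fock_op_plus[OF c fock_op_plus[OF c fock_op_mult[OF c]]])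
  then show ?thesis by (simp add: brst_def[abs_def])
qed

lemma
  assumes "tcol [] [] \<beta>"
  shows tcol_Q: "tcol [] [] (Q \<beta>)"
    and state_Q: "fock_vec n (state n \<beta>) \<Longrightarrow> state n (Q \<beta>) = brst n (state n \<beta>)"
proof -
  let ?F = "\<lambda>x y z. Tr_field [x, y, z] 0 \<beta>"
  have Q: "Q \<beta> = ?F Gen_b Gen_c Gen_c + (?F Gen_c Gen_Z1 Gen_Z2 + - ?F Gen_c Gen_Z2 Gen_Z1)"
    by (simp add: Q_def residue_mode_def)
  show "tcol [] [] (Q \<beta>)"
    unfolding Q by (intro tcol_add tcol_uminus tcol_Tr_field[OF assms])
  assume s: "fock_vec n (state n \<beta>)"
  show "state n (Q \<beta>) = brst n (state n \<beta>)"
  proof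
    fix w show "state n (Q \<beta>) w = brst n (state n \<beta>) w"
    proof (cases "smalls n w")
      case True
      then show ?thesis
        unfolding brst_def cf_Tr_field[OF assms s True, symmetric]
        by (simp add: state_def Q cf_add cf_diff algebra_simps)
    next
      case False
      then show ?thesis using fock_op_brst[of n] s by (simp add: fock_op_def fock_vec_def state_def)
    qed
  qed
qed

theorem proposition4p1:
  shows "Q \<in> A_N \<rightarrow> A_N \<and> (\<forall>\<alpha>\<in>A_N. Q (Q \<alpha>) = 0)"
proof (intro conjI ballI Pi_I)
  fix \<alpha> assume "\<alpha> \<in> A_N"
  then have t: "tcol [] [] \<alpha>" and s: "fock_vec n (state n \<alpha>)" for n by (simp_all add: A_N_iff)
  have sQ: "fock_vec n (state n (Q \<alpha>))" for n
    using fock_op_brst[of n] s state_Q[OF t s, of n] by (simp add: fock_op_def)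
  then show "Q \<alpha> \<in> A_N" using tcol_Q[OF t] by (simp add: A_N_iff)
  show "Q (Q \<alpha>) = 0"
  \<comment> \<open>At every \<open>n\<close> the operator \<open>Q\<close> acts as
    \<open>brst\<close>, whose square vanishes on words with indices below \<open>n\<close>; on
    other words \<open>state\<close> is zero by definition.\<close>
  proof (rule col_eqI)
    show "tcol [] [] (Q (Q \<alpha>))" by (intro tcol_Q t)
    show "state n (Q (Q \<alpha>)) = state n 0" for n
    proof
      fix w
      have "smalls n w \<Longrightarrow> brst n (brst n (state n \<alpha>)) w = 0"
        using brst_brst s by (simp add: fock_vec_def)
      then show "state n (Q (Q \<alpha>)) w = state n 0 w"
        using state_Q[OF tcol_Q[OF t] sQ, of n] state_Q[OF t s, of n] by (metis cf_zero mult_zero_right state_def)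
    qed
  qed simp
qed

end
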